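(* Let $(\mathcal L,(\cdot,\cdot),\mathcal H)\in\mathcal T$ and let $\dot{\mathfrak g}$ be the subalgebra of $\mathcal L_c$ generated by $\{e_{\pm\dot\alpha_i}\}_{i=1}^\ell$ (notation as in the context). Then $\dot{\mathfrak g}$ is a finite-dimensional split simple Lie subalgebra of $\mathcal L_c$ with root system $\dot R_{red}$ and splitting Cartan subalgebra $\dot{\mathfrak h}=\bigoplus_{i=1}^\ell\mathbb F h_{\dot\alpha_i}$.
   Context: $\mathbb F$ is a field of characteristic $0$. If $V$ is a finite-dimensional space with a non-degenerate symmetric bilinear form and $\alpha\in V^\star$, $t_\alpha$ denotes the unique element of $V$ with $(t_\alpha,v)=\alpha(v)$ for all $v\in V$. A nonzero subalgebra $\mathcal H$ of a Lie algebra $\mathcal L$ is a (split) toral subalgebra if $\mathcal L=\bigoplus_{\alpha\in\mathcal H^\star}\mathcal L_\alpha$, where $\mathcal L_\alpha=\{x\in\mathcal L:[h,x]=\alpha(h)x\ \forall h\in\mathcal H\}$. The class $\mathcal T$ consists of triples $(\mathcal L,(\cdot,\cdot),\mathcal H)$ with: (T1) $\mathcal L$ is a Lie algebra over $\mathbb F$ with a non-degenerate symmetric invariant bilinear form $(\cdot,\cdot)$; (T2) $\mathcal H$ is a finite-dimensional toral subalgebra of $\mathcal L$ and $(\cdot,\cdot)|_{\mathcal H\times\mathcal H}$ is non-degenerate. Put $R=\{\alpha\in\mathcal H^\star:\mathcal L_\alpha\neq0\}$ (root system), transfer the form to $\mathcal H^\star$ by $(\alpha,\beta):=(t_\alpha,t_\beta)$,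 and let $R^\times=\{\alpha\in R:(\alpha,\alpha)\ne0\}$, $R^0=\{\alpha\in R:(\alpha,\alpha)=0\}$; (T3) for each $\delta\in R^0$ there are $x\in\mathcal L_\delta$, $y\in\mathcal L_{-\delta}$ with $[x,y]=t_\delta$, and for each $\alpha\in R^\times$ and each $0\ne x\in\mathcal L_\alpha$ there is $y\in\mathcal L_{-\alpha}$ with $[x,y]=t_\alpha$; (T4) for $\alpha\in R^\times$ and $x\in\mathcal L_\alpha$, $\mathrm{ad}\,x$ acts locally nilpotently on $\mathcal L$; (T5) (a) $R^\times$ is not a disjoint union of two nonempty mutually orthogonal subsets, (b) for each $\delta\in R^0$ there is $\alpha\in R^\times$ with $\alpha+\delta\in R$; (T6) $\Lambda:=\mathrm{span}_{\mathbb Z}(R^0)$ is a free abelian group of finite rank. The core $\mathcal L_c$ is the subalgebra generated by the $\mathcal L_\alpha$, $\alpha\in R^\times$. A finite root system is a subset $\Delta$ containing $0$ with $\Delta^\times:=\Delta\setminus\{0\}$ a finite root system in the sense of Bourbaki; $\Delta_{red}=\{0\}\cup\{\alpha\in\Delta:\alpha/2\notin\Delta\}$. Standard setup: normalize the form so that $(\alpha_0,\alpha_0)=1$ for some $\alpha_0\in R^\times$; then $(R,R)\subseteq\mathbb Q$. Let $\mathcal V=\mathbb R\otimes_{\mathbb Q}\mathrm{span}_{\mathbb Q}(R)$ with the induced real positive semidefinite form, $\mathcal V^0$ its radical, and $\bar{\ }:\mathcal V\to\mathcal V/\mathcal V^0$. The image $\bar R$ is an irreducible finite root system; fix a base $\{\bar\alpha_1,\dots,\bar\alpha_\ell\}$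 of $\bar R$ and preimages $\dot\alpha_i\in R$ of $\bar\alpha_i$. With $\dot{\mathcal V}=\mathrm{span}_{\mathbb R}\{\dot\alpha_i\}$ one has $\mathcal V=\dot{\mathcal V}\oplus\mathcal V^0$, $R^0=R\cap\mathcal V^0$, and $\dot R:=\{\dot\alpha\in\dot{\mathcal V}:\dot\alpha+\delta\in R\text{ for some }\delta\in\mathcal V^0\}$ is an irreducible finite root system with base $\{\dot\alpha_1,\dots,\dot\alpha_\ell\}$, isomorphic to $\bar R$, with $\dot R\subseteq\mathrm{span}_{\mathbb Z}\{\dot\alpha_i\}\subseteq\mathcal H^\star$ and $\dot R_{red}\subseteq R$. For $\alpha\in R^\times$ let $h_\alpha=2t_\alpha/(t_\alpha,t_\alpha)$. For each $i$ fix $e_{\pm\dot\alpha_i}\in\mathcal L_{\pm\dot\alpha_i}$ with $[h_{\dot\alpha_i},e_{\pm\dot\alpha_i}]=\pm2e_{\pm\dot\alpha_i}$, $[e_{\dot\alpha_i},e_{-\dot\alpha_i}]=h_{\dot\alpha_i}$ (possible by (T3)). *)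

theory Defs
  imports Complex_Main
begin

text \<open>A Lie algebra over a field 'k is modelled as the whole type 'v, with scalar
multiplication sc and bracket br. Linear functionals on a subspace H are modelled
as functions 'v \<Rightarrow> 'k that are linear on H and vanish outside H.\<close>

definition lie_algebra :: "('k::field \<Rightarrow> 'v::ab_group_add \<Rightarrow> 'v) \<Rightarrow> ('v \<Rightarrow> 'v \<Rightarrow> 'v) \<Rightarrow> bool" where
  "lie_algebra sc br \<longleftrightarrow> vector_space sc \<and>
     (\<forall>x y z. br (x + y) z = br x z + br y z) \<and>
     (\<forall>x y z. br x (y + z) = br x y + br x z) \<and>
     (\<forall>c x y. br (sc c x) y = sc c (br x y)) \<and>
     (\<forall>c x y. br x (sc c y) = sc c (br x y)) \<and>
     (\<forall>x. br x x = 0) \<and>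
     (\<forall>x y z. br x (br y z) + br y (br z x) + br z (br x y) = 0)"

definition sym_invariant_form :: "('k::field \<Rightarrow> 'v::ab_group_add \<Rightarrow> 'v) \<Rightarrow> ('v \<Rightarrow> 'v \<Rightarrow> 'v) \<Rightarrow> ('v \<Rightarrow> 'v \<Rightarrow> 'k) \<Rightarrow> bool" where
  "sym_invariant_form sc br B \<longleftrightarrow>
     (\<forall>x y. B x y = B y x) \<and>
     (\<forall>x y z. B (x + y) z = B x z + B y z) \<and>
     (\<forall>c x y. B (sc c x) y = c * B x y) \<and>
     (\<forall>x y z. B (br x y) z = B x (br y z))"

definition nondegenerate_on :: "('v::zero \<Rightarrow> 'v \<Rightarrow> 'k::field) \<Rightarrow> 'v set \<Rightarrow> bool" where
  "nondegenerate_on B S \<longleftrightarrow> (\<forall>x\<in>S. (\<forall>y\<in>S. B x y = 0) \<longrightarrow> x = 0)"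

definition lie_subalgebra :: "('k::field \<Rightarrow> 'v::ab_group_add \<Rightarrow> 'v) \<Rightarrow> ('v \<Rightarrow> 'v \<Rightarrow> 'v) \<Rightarrow> 'v set \<Rightarrow> bool" where
  "lie_subalgebra sc br S \<longleftrightarrow> module.subspace sc S \<and> (\<forall>x\<in>S. \<forall>y\<in>S. br x y \<in> S)"

definition gen_subalgebra :: "('k::field \<Rightarrow> 'v::ab_group_add \<Rightarrow> 'v) \<Rightarrow> ('v \<Rightarrow> 'v \<Rightarrow> 'v) \<Rightarrow> 'v set \<Rightarrow> 'v set" where
  "gen_subalgebra sc br X = \<Inter>{S. lie_subalgebra sc br S \<and> X \<subseteq> S}"

definition finite_dim :: "('k::field \<Rightarrow> 'v::ab_group_add \<Rightarrow> 'v) \<Rightarrow> 'v set \<Rightarrow> bool" where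
  "finite_dim sc S \<longleftrightarrow> (\<exists>F. finite F \<and> F \<subseteq> S \<and> S \<subseteq> module.span sc F)"

definition dual :: "('k::field \<Rightarrow> 'v::ab_group_add \<Rightarrow> 'v) \<Rightarrow> 'v set \<Rightarrow> ('v \<Rightarrow> 'k) set" where
  "dual sc H = {\<alpha>. (\<forall>x\<in>H. \<forall>y\<in>H. \<alpha> (x + y) = \<alpha> x + \<alpha> y) \<and>
                   (\<forall>c. \<forall>x\<in>H. \<alpha> (sc c x) = c * \<alpha> x) \<and>
                   (\<forall>x. x \<notin> H \<longrightarrow> \<alpha> x = 0)}"

definition weight_space :: "('k::field \<Rightarrow> 'v::ab_group_add \<Rightarrow> 'v) \<Rightarrow> ('v \<Rightarrow> 'v \<Rightarrow> 'v) \<Rightarrow> 'v set \<Rightarrow> ('v \<Rightarrow> 'k) \<Rightarrow> 'v set" where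
  "weight_space sc br H \<alpha> = {x. \<forall>h\<in>H. br h x = sc (\<alpha> h) x}"

definition weight_decomposition :: "('k::field \<Rightarrow> 'v::ab_group_add \<Rightarrow> 'v) \<Rightarrow> ('v \<Rightarrow> 'v \<Rightarrow> 'v) \<Rightarrow> 'v set \<Rightarrow> 'v set \<Rightarrow> bool" where
  "weight_decomposition sc br M H \<longleftrightarrow>
     (\<forall>x\<in>M. \<exists>S f. finite S \<and> S \<subseteq> dual sc H \<and>
        (\<forall>\<alpha>\<in>S. f \<alpha> \<in> M \<inter> weight_space sc br H \<alpha>) \<and> x = (\<Sum>\<alpha>\<in>S. f \<alpha>)) \<and>
     (\<forall>S f. finite S \<and> S \<subseteq> dual sc H \<and>
        (\<forall>\<alpha>\<in>S. f \<alpha> \<in> M \<inter> weight_space sc br H \<alpha>) \<and> (\<Sum>\<alpha>\<in>S. f \<alpha>) = 0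
        \<longrightarrow> (\<forall>\<alpha>\<in>S. f \<alpha> = 0))"

definition toral_subalgebra :: "('k::field \<Rightarrow> 'v::ab_group_add \<Rightarrow> 'v) \<Rightarrow> ('v \<Rightarrow> 'v \<Rightarrow> 'v) \<Rightarrow> 'v set \<Rightarrow> bool" where
  "toral_subalgebra sc br H \<longleftrightarrow> lie_subalgebra sc br H \<and> H \<noteq> {0} \<and>
     weight_decomposition sc br UNIV H"

definition tvec :: "('v \<Rightarrow> 'v \<Rightarrow> 'k) \<Rightarrow> 'v set \<Rightarrow> ('v \<Rightarrow> 'k) \<Rightarrow> 'v" where
  "tvec B H \<alpha> = (THE t. t \<in> H \<and> (\<forall>h\<in>H. B t h = \<alpha> h))"

definition dform :: "('v \<Rightarrow> 'v \<Rightarrow> 'k) \<Rightarrow> 'v set \<Rightarrow> ('v \<Rightarrow> 'k) \<Rightarrow> ('v \<Rightarrow> 'k) \<Rightarrow> 'k" where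
  "dform B H \<alpha> \<beta> = B (tvec B H \<alpha>) (tvec B H \<beta>)"

definition roots :: "('k::field \<Rightarrow> 'v::ab_group_add \<Rightarrow> 'v) \<Rightarrow> ('v \<Rightarrow> 'v \<Rightarrow> 'v) \<Rightarrow> 'v set \<Rightarrow> ('v \<Rightarrow> 'k) set" where
  "roots sc br H = {\<alpha> \<in> dual sc H. weight_space sc br H \<alpha> \<noteq> {0}}"

definition roots_nonisotropic :: "('k::field \<Rightarrow> 'v::ab_group_add \<Rightarrow> 'v) \<Rightarrow> ('v \<Rightarrow> 'v \<Rightarrow> 'v) \<Rightarrow> ('v \<Rightarrow> 'v \<Rightarrow> 'k) \<Rightarrow> 'v set \<Rightarrow> ('v \<Rightarrow> 'k) set" where
  "roots_nonisotropic sc br B H = {\<alpha> \<in> roots sc br H. dform B H \<alpha> \<alpha> \<noteq> 0}"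

definition roots_isotropic :: "('k::field \<Rightarrow> 'v::ab_group_add \<Rightarrow> 'v) \<Rightarrow> ('v \<Rightarrow> 'v \<Rightarrow> 'v) \<Rightarrow> ('v \<Rightarrow> 'v \<Rightarrow> 'k) \<Rightarrow> 'v set \<Rightarrow> ('v \<Rightarrow> 'k) set" where
  "roots_isotropic sc br B H = {\<alpha> \<in> roots sc br H. dform B H \<alpha> \<alpha> = 0}"

definition int_span :: "('v \<Rightarrow> 'k::field) set \<Rightarrow> ('v \<Rightarrow> 'k) set" where
  "int_span A = {(\<lambda>v. \<Sum>b\<in>S. of_int (c b) * b v) | S c. finite S \<and> S \<subseteq> A}"

definition free_abelian_finite_rank :: "('v \<Rightarrow> 'k::field) set \<Rightarrow> bool" where
  "free_abelian_finite_rank \<Lambda> \<longleftrightarrow> (\<exists>Bs. finite Bs \<and> Bs \<subseteq> \<Lambda> \<and> \<Lambda> = int_span Bs \<and>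
      (\<forall>c. (\<lambda>v. \<Sum>b\<in>Bs. of_int (c b) * b v) = (\<lambda>v. 0) \<longrightarrow> (\<forall>b\<in>Bs. c b = 0)))"

definition class_T :: "('k::field_char_0 \<Rightarrow> 'v::ab_group_add \<Rightarrow> 'v) \<Rightarrow> ('v \<Rightarrow> 'v \<Rightarrow> 'v) \<Rightarrow> ('v \<Rightarrow> 'v \<Rightarrow> 'k) \<Rightarrow> 'v set \<Rightarrow> bool" where
  "class_T sc br B H \<longleftrightarrow>
     \<comment> \<open>(T1)\<close>
     lie_algebra sc br \<and> sym_invariant_form sc br B \<and> nondegenerate_on B UNIV \<and>
     \<comment> \<open>(T2)\<close>
     toral_subalgebra sc br H \<and> finite_dim sc H \<and> nondegenerate_on B H \<and>
     \<comment> \<open>(T3)\<close>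
     (\<forall>\<delta>\<in>roots_isotropic sc br B H. \<exists>x\<in>weight_space sc br H \<delta>.
        \<exists>y\<in>weight_space sc br H (\<lambda>v. - \<delta> v). br x y = tvec B H \<delta>) \<and>
     (\<forall>\<alpha>\<in>roots_nonisotropic sc br B H. \<forall>x\<in>weight_space sc br H \<alpha>. x \<noteq> 0 \<longrightarrow>
        (\<exists>y\<in>weight_space sc br H (\<lambda>v. - \<alpha> v). br x y = tvec B H \<alpha>)) \<and>
     \<comment> \<open>(T4)\<close>
     (\<forall>\<alpha>\<in>roots_nonisotropic sc br B H. \<forall>x\<in>weight_space sc br H \<alpha>.
        \<forall>y. \<exists>n. (br x ^^ n) y = 0) \<and>
     \<comment> \<open>(T5a)\<close>
     \<not> (\<exists>P Q. P \<noteq> {} \<and> Q \<noteq> {} \<and> P \<inter> Q = {} \<and> P \<union> Q = roots_nonisotropic sc br B H \<and>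
            (\<forall>\<alpha>\<in>P. \<forall>\<beta>\<in>Q. dform B H \<alpha> \<beta> = 0)) \<and>
     \<comment> \<open>(T5b)\<close>
     (\<forall>\<delta>\<in>roots_isotropic sc br B H. \<exists>\<alpha>\<in>roots_nonisotropic sc br B H.
        (\<lambda>v. \<alpha> v + \<delta> v) \<in> roots sc br H) \<and>
     \<comment> \<open>(T6)\<close>
     free_abelian_finite_rank (int_span (roots_isotropic sc br B H))"

definition core :: "('k::field \<Rightarrow> 'v::ab_group_add \<Rightarrow> 'v) \<Rightarrow> ('v \<Rightarrow> 'v \<Rightarrow> 'v) \<Rightarrow> ('v \<Rightarrow> 'v \<Rightarrow> 'k) \<Rightarrow> 'v set \<Rightarrow> 'v set" where
  "core sc br B H = gen_subalgebra sc br (\<Union>\<alpha>\<in>roots_nonisotropic sc br B H. weight_space sc br H \<alpha>)"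

definition hvec :: "('k::field \<Rightarrow> 'v \<Rightarrow> 'v) \<Rightarrow> ('v \<Rightarrow> 'v \<Rightarrow> 'k) \<Rightarrow> 'v set \<Rightarrow> ('v \<Rightarrow> 'k) \<Rightarrow> 'v" where
  "hvec sc B H \<alpha> = sc (2 / dform B H \<alpha> \<alpha>) (tvec B H \<alpha>)"

text \<open>Membership in the radical V^0 of the form on V, for elements of the
Q-span of R: being orthogonal to every root.\<close>
definition in_radical :: "('k::field \<Rightarrow> 'v::ab_group_add \<Rightarrow> 'v) \<Rightarrow> ('v \<Rightarrow> 'v \<Rightarrow> 'v) \<Rightarrow> ('v \<Rightarrow> 'v \<Rightarrow> 'k) \<Rightarrow> 'v set \<Rightarrow> ('v \<Rightarrow> 'k) \<Rightarrow> bool" where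
  "in_radical sc br B H x \<longleftrightarrow> (\<forall>\<beta>\<in>roots sc br H. dform B H x \<beta> = 0)"

definition intcomb :: "nat \<Rightarrow> (nat \<Rightarrow> 'v \<Rightarrow> 'k::field) \<Rightarrow> (nat \<Rightarrow> int) \<Rightarrow> ('v \<Rightarrow> 'k)" where
  "intcomb l a k = (\<lambda>v. \<Sum>i<l. of_int (k i) * a i v)"

text \<open>a_0..a_{l-1} in R are preimages of a base of the finite root system R-bar
(the image of R in V/V^0).\<close>
definition base_preimages :: "('k::field \<Rightarrow> 'v::ab_group_add \<Rightarrow> 'v) \<Rightarrow> ('v \<Rightarrow> 'v \<Rightarrow> 'v) \<Rightarrow> ('v \<Rightarrow> 'v \<Rightarrow> 'k) \<Rightarrow> 'v set \<Rightarrow> nat \<Rightarrow> (nat \<Rightarrow> 'v \<Rightarrow> 'k) \<Rightarrow> bool" where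
  "base_preimages sc br B H l a \<longleftrightarrow>
     (\<forall>i<l. a i \<in> roots sc br H) \<and>
     (\<forall>k. in_radical sc br B H (intcomb l a k) \<longrightarrow> (\<forall>i<l. k i = 0)) \<and>
     (\<forall>\<alpha>\<in>roots_nonisotropic sc br B H. \<exists>k.
        in_radical sc br B H (\<lambda>v. \<alpha> v - intcomb l a k v) \<and>
        ((\<forall>i<l. 0 \<le> k i) \<or> (\<forall>i<l. k i \<le> 0)))"

definition Rdot :: "('k::field \<Rightarrow> 'v::ab_group_add \<Rightarrow> 'v) \<Rightarrow> ('v \<Rightarrow> 'v \<Rightarrow> 'v) \<Rightarrow> ('v \<Rightarrow> 'v \<Rightarrow> 'k) \<Rightarrow> 'v set \<Rightarrow> nat \<Rightarrow> (nat \<Rightarrow> 'v \<Rightarrow> 'k) \<Rightarrow> ('v \<Rightarrow> 'k) set" where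
  "Rdot sc br B H l a = {intcomb l a k | k. \<exists>\<alpha>\<in>roots sc br H.
       in_radical sc br B H (\<lambda>v. \<alpha> v - intcomb l a k v)}"

definition reduced_part :: "('v \<Rightarrow> 'k::field) set \<Rightarrow> ('v \<Rightarrow> 'k) set" where
  "reduced_part D = {\<lambda>v. 0} \<union> {\<alpha> \<in> D. (\<lambda>v. \<alpha> v / 2) \<notin> D}"

definition lie_ideal :: "('k::field \<Rightarrow> 'v::ab_group_add \<Rightarrow> 'v) \<Rightarrow> ('v \<Rightarrow> 'v \<Rightarrow> 'v) \<Rightarrow> 'v set \<Rightarrow> 'v set \<Rightarrow> bool" where
  "lie_ideal sc br g I \<longleftrightarrow> module.subspace sc I \<and> I \<subseteq> g \<and> (\<forall>x\<in>g. \<forall>y\<in>I. br x y \<in> I)"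

definition simple_lie :: "('k::field \<Rightarrow> 'v::ab_group_add \<Rightarrow> 'v) \<Rightarrow> ('v \<Rightarrow> 'v \<Rightarrow> 'v) \<Rightarrow> 'v set \<Rightarrow> bool" where
  "simple_lie sc br g \<longleftrightarrow> lie_subalgebra sc br g \<and> (\<exists>x\<in>g. \<exists>y\<in>g. br x y \<noteq> 0) \<and>
     (\<forall>I. lie_ideal sc br g I \<longrightarrow> I = {0} \<or> I = g)"

definition nilpotent_lie :: "('v \<Rightarrow> 'v \<Rightarrow> 'v::ab_group_add) \<Rightarrow> 'v set \<Rightarrow> bool" where
  "nilpotent_lie br A \<longleftrightarrow> (\<exists>n. \<forall>xs. length xs = Suc n \<and> set xs \<subseteq> A \<longrightarrow>
      foldr br (butlast xs) (last xs) = 0)"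

definition cartan_subalgebra :: "('k::field \<Rightarrow> 'v::ab_group_add \<Rightarrow> 'v) \<Rightarrow> ('v \<Rightarrow> 'v \<Rightarrow> 'v) \<Rightarrow> 'v set \<Rightarrow> 'v set \<Rightarrow> bool" where
  "cartan_subalgebra sc br g h \<longleftrightarrow> lie_subalgebra sc br h \<and> h \<subseteq> g \<and> nilpotent_lie br h \<and>
     {x\<in>g. \<forall>y\<in>h. br x y \<in> h} = h"

definition splitting_cartan :: "('k::field \<Rightarrow> 'v::ab_group_add \<Rightarrow> 'v) \<Rightarrow> ('v \<Rightarrow> 'v \<Rightarrow> 'v) \<Rightarrow> 'v set \<Rightarrow> 'v set \<Rightarrow> bool" where
  "splitting_cartan sc br g h \<longleftrightarrow> cartan_subalgebra sc br g h \<and> weight_decomposition sc br g h"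

definition root_system_of :: "('k::field \<Rightarrow> 'v::ab_group_add \<Rightarrow> 'v) \<Rightarrow> ('v \<Rightarrow> 'v \<Rightarrow> 'v) \<Rightarrow> 'v set \<Rightarrow> 'v set \<Rightarrow> ('v \<Rightarrow> 'k) set" where
  "root_system_of sc br g h = {\<alpha> \<in> dual sc h. g \<inter> weight_space sc br h \<alpha> \<noteq> {0}}"

definition restrict_fun :: "'v set \<Rightarrow> ('v \<Rightarrow> 'k::zero) \<Rightarrow> ('v \<Rightarrow> 'k)" where
  "restrict_fun S \<alpha> = (\<lambda>v. if v \<in> S then \<alpha> v else 0)"

end

theory Submission
  imports Defs
begin

text \<open>No Serre relations are needed. Heisenberg triples produce infinite strings through isotropic roots, so
integrality of Cartan integers forces isotropic roots to be orthogonal to all roots. For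
nonisotropic \<open>\<alpha>, \<beta>\<close> with \<open>n = \<alpha>(h_\<beta>) \<ge> 7\<close>, integrality along the string member \<open>\<alpha> - 3\<beta>\<close>
is contradictory; hence all Cartan integers are bounded by 6. As a negative product of Cartan
integers would make them grow under reflections, norms of nonisotropic roots are positive rational
multiples of each other. Thus finitely many roots remain modulo the radical, and simple reflections
take each of them to a multiple of some \<open>\<alpha>_i\<close>. The algebra generated by the \<open>e_{\<plusminus>i}\<close> is spanned by
iterated brackets, its weights are stable under simple reflections, and so are the weights of each
of its ideals. Carrying a weight to a multiple of \<open>\<alpha>_i\<close>, where the weight spaces of the algebra are known,
gives the root system and puts some generator in every nonzero ideal; connectedness of the
Dynkin diagram then gives simplicity.\<close>

section \<open>Weights and strings for sl2-triples\<close>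

text \<open>The form takes values in a field without order, so Cauchy-Schwarz cannot confine the
  Cartan integers; integrality alone must do it. Why three steps: with m =
  \<open>\<beta> (h_\<alpha>)\<close> \<ge> 1, the string member \<alpha> - j\<beta> is
  contradictory as soon as m((j-1)n - j(j-2)) > n. At m = 1 this fails for j = 1 and j = 2, while j
  = 3 turns it into 2n - 3 > n; and n > 6 keeps the Cartan integer n - 6 of \<alpha> - 3\<beta> with
  \<beta> positive. The bound 6 is weaker than the classical 4 but suffices for both of its uses:
  finitely many pairings, and the value 2 - p^2 \<le> -7 that excludes negative products. Positivity
  then exists only as positivity of rational norm ratios. It gives every coefficient vector k of a
  root an index i at which k_i and the i-th pairing have the same sign; the sign coherence of a base
  makes the reflection in i shrink the sum of all |k_j| unless k is a multiple of a unit vector.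
  This induction stands in for the Weyl group.\<close>

locale lie_alg = vector_space sc
  for sc :: "'k::field_char_0 \<Rightarrow> 'v::ab_group_add \<Rightarrow> 'v" (infixr "*s" 75) +
  fixes br :: "'v \<Rightarrow> 'v \<Rightarrow> 'v"
  assumes lie: "lie_algebra sc br"
begin

abbreviation W :: "'v set \<Rightarrow> ('v \<Rightarrow> 'k) \<Rightarrow> 'v set" where
  "W \<equiv> weight_space sc br"

section \<open>Bracket identities, weight spaces and generated subalgebras\<close>

lemma br_add_left: "br (x + y) z = br x z + br y z"
  and br_add_right: "br x (y + z) = br x y + br x z"
  and br_scale_left: "br (c *s x) y = c *s br x y"
  and br_scale_right: "br x (c *s y) = c *s br x y"
  and br_self: "br x x = 0"
  and br_jacobi: "br x (br y z) + br y (br z x) + br z (br x y) = 0"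
  using lie unfolding lie_algebra_def by blast+

lemma br_zero_left [simp]: "br 0 y = 0"
  using br_scale_left[of 0 0 y] by simp

lemma br_zero_right [simp]: "br x 0 = 0"
  using br_scale_right[of x 0 0] by simp

lemma br_minus_left: "br (- x) y = - br x y"
  using br_scale_left[of "-1" x y] by simp

lemma br_minus_right: "br x (- y) = - br x y"
  using br_scale_right[of x "-1" y] by simp

lemma br_anti: "br x y = - br y x"
proof -
  have "br x y + br y x = br (x + y) (x + y)"
    unfolding br_add_left br_add_right by (simp add: br_self)
  then have "br x y + br y x = 0" by (simp add: br_self)
  then show ?thesis by (simp add: eq_neg_iff_add_eq_0)
qed

lemma br_br_left: "br (br x y) z = br x (br y z) - br y (br x z)"
proof -
  have "br (br x y) z = - br z (br x y)" by (rule br_anti)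
  moreover have "br y (br z x) = - br y (br x z)"
    by (metis br_anti br_minus_right)
  ultimately show ?thesis using br_jacobi[of x y z]
    by (metis add.commute add_diff_cancel_left' diff_conv_add_uminus eq_neg_iff_add_eq_0 minus_diff_eq)
qed

lemma br_derivation: "br x (br y z) = br (br x y) z + br y (br x z)"
  by (simp add: br_br_left)

lemma br_sum_right: "br x (sum f S) = (\<Sum>i\<in>S. br x (f i))"
  by (induction S rule: infinite_finite_induct) (auto simp: br_add_right)

lemma W_I: "(\<And>h. h \<in> A \<Longrightarrow> br h x = \<alpha> h *s x) \<Longrightarrow> x \<in> W A \<alpha>"
  by (simp add: weight_space_def)

lemma W_D: "x \<in> W A \<alpha> \<Longrightarrow> h \<in> A \<Longrightarrow> br h x = \<alpha> h *s x"
  by (simp add: weight_space_def)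

lemma W_mono: "x \<in> W A \<alpha> \<Longrightarrow> A' \<subseteq> A \<Longrightarrow> x \<in> W A' \<alpha>"
  by (auto simp: weight_space_def)

lemma W_cong: "(\<And>h. h \<in> A \<Longrightarrow> \<alpha> h = \<beta> h) \<Longrightarrow> W A \<alpha> = W A \<beta>"
  by (auto simp: weight_space_def)

lemma subspace_W: "subspace (W A \<alpha>)"
  by (rule subspaceI) (auto simp: weight_space_def br_add_right br_scale_right scale_right_distrib mult.commute)

lemma W_br: "x \<in> W A \<alpha> \<Longrightarrow> y \<in> W A \<beta> \<Longrightarrow> br x y \<in> W A (\<lambda>v. \<alpha> v + \<beta> v)"
  by (rule W_I) (simp add: br_derivation[of _ x y] W_D br_scale_left br_scale_right scale_left_distrib)

lemma W_br_power:
  assumes x: "x \<in> W A \<alpha>" and y: "y \<in> W A \<beta>"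
  shows "(br x ^^ n) y \<in> W A (\<lambda>v. \<beta> v + of_nat n * \<alpha> v)"
proof (induction n)
  case 0 then show ?case using y by simp
next
  case (Suc n)
  have "br x ((br x ^^ n) y) \<in> W A (\<lambda>v. \<alpha> v + (\<beta> v + of_nat n * \<alpha> v))"
    by (rule W_br[OF x Suc])
  then show ?case by (simp add: algebra_simps)
qed

text \<open>Applying ad h - \<open>\<omega> s h\<close> removes the weight \<open>s\<close> and
  leaves a shorter sum in \<open>M\<close>. With \<open>M = {0}\<close> this is independence of
  weight spaces; with \<open>M\<close> an ideal it shows that ideals are graded.\<close>

lemma weight_components:
  assumes "finite S" and "\<And>i. i \<in> S \<Longrightarrow> f i \<in> W A (\<omega> i)"
    and "\<And>i j. i \<in> S \<Longrightarrow> j \<in> S \<Longrightarrow> i \<noteq> j \<Longrightarrow> \<exists>h\<in>A. \<omega> i h \<noteq> \<omega> j h"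
    and M: "subspace M" and st: "\<And>h x. h \<in> A \<Longrightarrow> x \<in> M \<Longrightarrow> br h x \<in> M"
    and "(\<Sum>i\<in>S. f i) \<in> M" and "i \<in> S"
  shows "f i \<in> M"
  using assms(1,2,3,6,7)
proof (induction S arbitrary: f i rule: finite_induct)
  case empty then show ?case by simp
next
  case (insert s S)
  let ?x = "f s + (\<Sum>i\<in>S. f i)"
  have x: "?x \<in> M" using insert by simp
  have S: "f j \<in> M" if j: "j \<in> S" for j
  proof -
    \<comment> \<open>This \<open>h\<close> separates \<open>s\<close> from the single index
      \<open>j\<close>; the factors at other indices may vanish, so each \<open>j\<close> needs its
      own \<open>h\<close>.\<close>
    obtain h where h: "h \<in> A" "\<omega> j h \<noteq> \<omega> s h" using insert.prems(2)[of j s] insert.hyps j by blast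
    have "br h ?x - \<omega> s h *s ?x \<in> M"
      using x st h M by (auto intro: subspace_diff subspace_scale)
    also have "br h ?x - \<omega> s h *s ?x = (\<Sum>i\<in>S. (\<omega> i h - \<omega> s h) *s f i)"
    proof -
      have 1: "br h (f s) = \<omega> s h *s f s" by (rule W_D[OF insert.prems(1) h(1)]) simp
      have 2: "(\<Sum>i\<in>S. br h (f i)) = (\<Sum>i\<in>S. \<omega> i h *s f i)"
        by (rule sum.cong) (use W_D[OF insert.prems(1) h(1)] in auto)
      show ?thesis
        by (simp add: br_add_right br_sum_right 1 2 scale_right_distrib scale_sum_right
            scale_left_diff_distrib sum_subtractf)
    qed
    finally have "(\<Sum>i\<in>S. (\<omega> i h - \<omega> s h) *s f i) \<in> M" .
    then have "(\<omega> j h - \<omega> s h) *s f j \<in> M"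
      by (intro insert.IH[where f="\<lambda>i. (\<omega> i h - \<omega> s h) *s f i" and i = j])
        (use insert.prems j subspace_scale[OF subspace_W] in auto)
    then have "inverse (\<omega> j h - \<omega> s h) *s (\<omega> j h - \<omega> s h) *s f j \<in> M"
      using M subspace_scale by blast
    then show ?thesis using h by simp
  qed
  then have "(\<Sum>i\<in>S. f i) \<in> M" using M subspace_sum by blast
  then have "f s \<in> M" using x M subspace_diff[of M ?x "sum f S"] by simp
  then show ?case using S insert.prems by auto
qed

text \<open>Collects the terms of a linear combination by their labels. Uniqueness is not claimed
  here; it comes later from the separation of weights.\<close>

lemma span_weight_decomp:
  assumes "x \<in> span (snd ` X)"
  shows "\<exists>S f. finite S \<and> S \<subseteq> fst ` X \<and> (\<forall>k\<in>S. f k \<in> span {t. (k, t) \<in> X}) \<and> x = sum f S"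
  using assms
proof (induction rule: span_induct_alt)
  case base
  show ?case by (rule exI[of _ "{}"]) auto
next
  case (step c t y)
  then obtain S f k where S: "finite S" "S \<subseteq> fst ` X" "\<forall>k\<in>S. f k \<in> span {t. (k, t) \<in> X}"
      "y = sum f S" and k: "(k, t) \<in> X" by auto
  define f0 where "f0 j = (if j \<in> S then f j else 0)" for j
  define f1 where "f1 j = (if j = k then c *s t else 0)" for j
  have "sum f0 (insert k S) = sum f S"
    unfolding f0_def using S(1) by (cases "k \<in> S") (auto simp: insert_absorb intro!: sum.cong)
  moreover have "sum f1 (insert k S) = c *s t"
    unfolding f1_def using S(1) by simp
  ultimately have "c *s t + y = (\<Sum>j\<in>insert k S. f1 j + f0 j)" using S by (simp add: sum.distrib)
  moreover have "\<forall>j\<in>insert k S. f1 j + f0 j \<in> span {t. (j, t) \<in> X}"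
    using S(3) k unfolding f0_def f1_def by (auto intro: span_add span_scale span_zero span_base)
  moreover have "insert k S \<subseteq> fst ` X" using S(2) k by force
  ultimately show ?case using S(1)
    by (intro exI[of _ "insert k S"] exI[of _ "\<lambda>j. f1 j + f0 j"]) auto
qed

lemma gen_subalgebra_least: "lie_subalgebra sc br S \<Longrightarrow> Y \<subseteq> S \<Longrightarrow> gen_subalgebra sc br Y \<subseteq> S"
  unfolding gen_subalgebra_def by blast

lemma gen_subalgebra_superset: "Y \<subseteq> gen_subalgebra sc br Y"
  unfolding gen_subalgebra_def by blast

lemma gen_subalgebra_subalgebra: "lie_subalgebra sc br (gen_subalgebra sc br Y)"
  unfolding lie_subalgebra_def
proof (intro conjI ballI)
  show "subspace (gen_subalgebra sc br Y)"
    unfolding gen_subalgebra_def by (rule subspace_Inter) (simp add: lie_subalgebra_def)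
  fix x y assume "x \<in> gen_subalgebra sc br Y" "y \<in> gen_subalgebra sc br Y"
  then show "br x y \<in> gen_subalgebra sc br Y"
    unfolding gen_subalgebra_def by (simp add: lie_subalgebra_def)
qed

section \<open>Representations of sl2 under local nilpotency\<close>

definition sl2_triple :: "'v \<Rightarrow> 'v \<Rightarrow> 'v \<Rightarrow> bool" where
  "sl2_triple e f h \<longleftrightarrow> br e f = h \<and> br h e = 2 *s e \<and> br h f = (-2) *s f"

lemma sl2_triple_opposite: "sl2_triple e f h \<Longrightarrow> sl2_triple f e (- h)"
  unfolding sl2_triple_def by (metis br_anti br_minus_left minus_minus scale_minus_left)

lemma sl2_weight:
  assumes t: "sl2_triple e f h" and w: "br h w = c *s w"
  shows "br h ((br f ^^ j) w) = (c - 2 * of_nat j) *s (br f ^^ j) w"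
proof (induction j)
  case 0 then show ?case using w by simp
next
  case (Suc j)
  have "br h (br f ((br f ^^ j) w)) = br (br h f) ((br f ^^ j) w) + br f (br h ((br f ^^ j) w))"
    by (rule br_derivation)
  also have "\<dots> = (-2) *s br f ((br f ^^ j) w) + (c - 2 * of_nat j) *s br f ((br f ^^ j) w)"
    using t unfolding Suc.IH by (simp add: sl2_triple_def br_scale_left br_scale_right br_minus_left)
  also have "\<dots> = (c - 2 * of_nat (Suc j)) *s br f ((br f ^^ j) w)"
    by (simp only: scale_left_distrib[symmetric]) (simp add: algebra_simps)
  finally show ?case by simp
qed

text \<open>The classical formula for e on the string below a highest weight vector. In
  characteristic 0 its scalar vanishes only for c = j, which is the source of all integrality
  below.\<close>

lemma sl2_highest_weight:
  assumes t: "sl2_triple e f h" and w: "br h w = c *s w" and e: "br e w = 0"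
  shows "br e ((br f ^^ Suc j) w) = (of_nat (Suc j) * (c - of_nat j)) *s (br f ^^ j) w"
proof (induction j)
  case 0
  have "br e (br f w) = br h w" using t e br_derivation[of e f w] by (simp add: sl2_triple_def)
  then show ?case using w by simp
next
  case (Suc j)
  let ?u = "\<lambda>j. (br f ^^ j) w"
  have "br e (br f (?u (Suc j))) = br h (?u (Suc j)) + br f (br e (?u (Suc j)))"
    using t br_derivation[of e f] by (simp add: sl2_triple_def)
  also have "\<dots> = (c - 2 * of_nat (Suc j)) *s ?u (Suc j) + (of_nat (Suc j) * (c - of_nat j)) *s ?u (Suc j)"
    unfolding Suc.IH sl2_weight[OF t w] by (simp add: br_scale_right)
  also have "\<dots> = (of_nat (Suc (Suc j)) * (c - of_nat (Suc j))) *s ?u (Suc j)"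
    by (simp only: scale_left_distrib[symmetric]) (simp add: algebra_simps)
  finally show ?case by simp
qed

lemma last_nonzero_power:
  fixes g :: "'v \<Rightarrow> 'v"
  assumes "(g ^^ n) v = 0" "v \<noteq> 0"
  obtains p where "(g ^^ p) v \<noteq> 0" "(g ^^ Suc p) v = 0"
proof -
  define q where "q = (LEAST n. (g ^^ n) v = 0)"
  have q: "(g ^^ q) v = 0" unfolding q_def using assms(1) by (rule LeastI)
  moreover have "q \<noteq> 0" using q assms(2) by (intro notI) simp
  then obtain p where p: "q = Suc p" using not0_implies_Suc by blast
  moreover have "(g ^^ p) v \<noteq> 0" using not_less_Least[of p "\<lambda>n. (g ^^ n) v = 0"] p
    unfolding q_def by simp
  ultimately show ?thesis using that by blast
qed

text \<open>Climb with \<open>e\<close> to the last nonzero power, of weight c + 2p, then descend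
  with \<open>f\<close> to the last nonzero power N. Applying \<open>e\<close> to the next,
  vanishing, power gives (N+1)(c + 2p - N) = 0. Local nilpotency replaces finite dimension.\<close>

lemma sl2_string_vectors:
  assumes t: "sl2_triple e f h" and ne: "\<And>x. \<exists>n. (br e ^^ n) x = 0"
    and nf: "\<And>x. \<exists>n. (br f ^^ n) x = 0" and v: "br h v = c *s v" "v \<noteq> 0"
  shows "\<exists>N p::nat. c = of_nat N - 2 * of_nat p \<and> (\<forall>j\<le>N. (br f ^^ j) ((br e ^^ p) v) \<noteq> 0)"
proof -
  obtain p where p: "(br e ^^ p) v \<noteq> 0" "(br e ^^ Suc p) v = 0"
    using ne last_nonzero_power[OF _ v(2)] by metis
  define w where "w = (br e ^^ p) v"
  have "br (- h) v = (- c) *s v" using v by (simp add: br_minus_left)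
  then have "br (- h) w = (- c - 2 * of_nat p) *s w"
    unfolding w_def by (rule sl2_weight[OF sl2_triple_opposite[OF t]])
  then have hw: "br h w = (c + 2 * of_nat p) *s w" (is "_ = ?c *s _")
  proof -
    assume a: "br (- h) w = (- c - 2 * of_nat p) *s w"
    have "br h w = - ((- c - 2 * of_nat p) *s w)" using a by (metis br_minus_left minus_minus)
    also have "\<dots> = (- (- c - 2 * of_nat p)) *s w" by (rule scale_minus_left[symmetric])
    finally show ?thesis by (simp add: add.commute)
  qed
  have ew: "br e w = 0" using p by (simp add: w_def)
  obtain N where N: "(br f ^^ N) w \<noteq> 0" "(br f ^^ Suc N) w = 0"
    using nf[of w] last_nonzero_power[where g = "br f" and v = w] p unfolding w_def by metis
  have "(of_nat (Suc N) * (?c - of_nat N)) *s (br f ^^ N) w = 0"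
    using sl2_highest_weight[OF t hw ew, of N] N(2) by (metis br_zero_right)
  then have "(of_nat (Suc N) * (?c - of_nat N) :: 'k) = 0" using N(1) scale_eq_0_iff by blast
  then have c: "?c = of_nat N" using of_nat_neq_0[of N] by (metis eq_iff_diff_eq_0 mult_eq_0_iff)
  have "(br f ^^ j) w \<noteq> 0" if "j \<le> N" for j
  proof
    assume "(br f ^^ j) w = 0"
    moreover have "(br f ^^ m) 0 = 0" for m by (induction m) auto
    ultimately have "(br f ^^ (N - j + j)) w = 0" by (simp only: funpow_add o_apply)
    then show False using that N by simp
  qed
  then show ?thesis using c unfolding w_def by (intro exI[of _ N] exI[of _ p]) (simp add: eq_diff_eq)
qed

lemma funpow_stable: "(\<And>x. x \<in> M \<Longrightarrow> g x \<in> M) \<Longrightarrow> x \<in> M \<Longrightarrow> (g ^^ n) x \<in> M"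
  by (induction n) auto

text \<open>The witness at j is f^(p+j) e^p v: since n = N - 2p, the bound j \<le> n gives p + j
  \<le> N. The stable set \<open>M\<close> is kept general so that the same string argument serves
  all of the Lie algebra, a subalgebra, or an ideal.\<close>

lemma sl2_half_string:
  assumes t: "sl2_triple e f h" and ne: "\<And>x. \<exists>n. (br e ^^ n) x = 0"
    and nf: "\<And>x. \<exists>n. (br f ^^ n) x = 0"
    and M: "\<And>x. x \<in> M \<Longrightarrow> br e x \<in> M" "\<And>x. x \<in> M \<Longrightarrow> br f x \<in> M"
    and e: "e \<in> W A \<alpha>" and f: "f \<in> W A (\<lambda>v. - \<alpha> v)"
    and v: "v \<in> M" "v \<in> W A \<beta>" "v \<noteq> 0" "br h v = c *s v"
  shows "\<exists>n::int. c = of_int n \<and> (\<forall>j::int. 0 \<le> j \<and> j \<le> n \<longrightarrow>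
           M \<inter> W A (\<lambda>v. \<beta> v - of_int j * \<alpha> v) \<noteq> {0})"
proof -
  obtain N p where c: "c = of_nat N - 2 * of_nat p"
    and nz: "\<And>j. j \<le> N \<Longrightarrow> (br f ^^ j) ((br e ^^ p) v) \<noteq> 0"
    using sl2_string_vectors[OF t ne nf v(4,3)] by blast
  have "M \<inter> W A (\<lambda>v. \<beta> v - of_int j * \<alpha> v) \<noteq> {0}" if j: "0 \<le> j" "j \<le> int N - 2 * int p" for j
  proof -
    define m where "m = nat j"
    have m: "j = int m" "p + m \<le> N" using j by (auto simp: m_def)
    let ?u = "(br f ^^ (p + m)) ((br e ^^ p) v)"
    have "?u \<in> M" by (intro funpow_stable M v)
    moreover have "?u \<in> W A (\<lambda>x. (\<beta> x + of_nat p * \<alpha> x) + of_nat (p + m) * (- \<alpha> x))"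
      by (rule W_br_power[OF f W_br_power[OF e v(2)]])
    then have "?u \<in> W A (\<lambda>v. \<beta> v - of_int j * \<alpha> v)" by (simp add: m algebra_simps)
    ultimately show ?thesis using nz[OF m(2)] by blast
  qed
  then show ?thesis using c by (intro exI[of _ "int N - 2 * int p"]) simp
qed

text \<open>The opposite triple covers negative n. The member j = n is the reflected weight, the
  intermediate ones form the string.\<close>

lemma sl2_string:
  assumes t: "sl2_triple e f h" and ne: "\<And>x. \<exists>n. (br e ^^ n) x = 0"
    and nf: "\<And>x. \<exists>n. (br f ^^ n) x = 0"
    and M: "\<And>x. x \<in> M \<Longrightarrow> br e x \<in> M" "\<And>x. x \<in> M \<Longrightarrow> br f x \<in> M"
    and e: "e \<in> W A \<alpha>" and f: "f \<in> W A (\<lambda>v. - \<alpha> v)"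
    and v: "v \<in> M" "v \<in> W A \<beta>" "v \<noteq> 0" "br h v = c *s v"
  shows "\<exists>n::int. c = of_int n \<and> (\<forall>j::int. (0 \<le> j \<and> j \<le> n) \<or> (n \<le> j \<and> j \<le> 0) \<longrightarrow>
           M \<inter> W A (\<lambda>v. \<beta> v - of_int j * \<alpha> v) \<noteq> {0})"
proof -
  obtain n where n: "c = of_int n" "\<And>j. 0 \<le> j \<and> j \<le> n \<Longrightarrow> M \<inter> W A (\<lambda>v. \<beta> v - of_int j * \<alpha> v) \<noteq> {0}"
    using sl2_half_string[OF t ne nf M e f v] by blast
  have "br (- h) v = (- c) *s v" using v by (simp add: br_minus_left)
  moreover have "e \<in> W A (\<lambda>v. - (- \<alpha> v))" using e by simp
  ultimately obtain n' where n': "- c = of_int n'"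
    "\<And>j. 0 \<le> j \<and> j \<le> n' \<Longrightarrow> M \<inter> W A (\<lambda>v. \<beta> v - of_int j * - \<alpha> v) \<noteq> {0}"
    using sl2_half_string[OF sl2_triple_opposite[OF t] nf ne M(2,1) f _ v(1-3)] by blast
  have nn: "n' = - n" using n(1) n'(1) by (metis of_int_eq_iff of_int_minus)
  have "M \<inter> W A (\<lambda>v. \<beta> v - of_int j * \<alpha> v) \<noteq> {0}" if "(0 \<le> j \<and> j \<le> n) \<or> (n \<le> j \<and> j \<le> 0)" for j
    using that
  proof
    assume "n \<le> j \<and> j \<le> 0"
    then have "M \<inter> W A (\<lambda>v. \<beta> v - of_int (-j) * - \<alpha> v) \<noteq> {0}" using nn by (intro n') auto
    then show ?thesis by simp
  qed (rule n)
  then show ?thesis using n(1) by blast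
qed

end

section \<open>Cartan integers of nonisotropic roots\<close>

locale class_T_alg = lie_alg sc br
  for sc :: "'k::field_char_0 \<Rightarrow> 'v::ab_group_add \<Rightarrow> 'v" (infixr "*s" 75) and br +
  fixes B :: "'v \<Rightarrow> 'v \<Rightarrow> 'k" and H :: "'v set"
  assumes class_T: "class_T sc br B H"
begin

abbreviation "D \<equiv> dual sc H"
abbreviation "R \<equiv> roots sc br H"
abbreviation "Rx \<equiv> roots_nonisotropic sc br B H"
abbreviation "R0 \<equiv> roots_isotropic sc br B H"
abbreviation "ip \<equiv> dform B H"
abbreviation "tv \<equiv> tvec B H"
abbreviation "hv \<equiv> hvec sc B H"

section \<open>The form, its transfer to the dual of \<open>H\<close>, and the axioms\<close>

lemma form: "sym_invariant_form sc br B" and nondeg: "nondegenerate_on B H"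
  and toral: "toral_subalgebra sc br H" and H_fin: "finite_dim sc H"
  using class_T unfolding class_T_def by blast+

lemma B_sym: "B x y = B y x"
  and B_add_left: "B (x + y) z = B x z + B y z"
  and B_scale_left: "B (c *s x) y = c * B x y"
  using form unfolding sym_invariant_form_def by blast+

lemma B_add_right: "B x (y + z) = B x y + B x z"
  by (metis B_sym B_add_left)

lemma B_scale_right: "B x (c *s y) = c * B x y"
  by (metis B_sym B_scale_left)

lemma subspace_H: "subspace H"
  using toral unfolding toral_subalgebra_def lie_subalgebra_def by blast

lemma dual_add: "\<alpha> \<in> D \<Longrightarrow> x \<in> H \<Longrightarrow> y \<in> H \<Longrightarrow> \<alpha> (x + y) = \<alpha> x + \<alpha> y"
  and dual_scale: "\<alpha> \<in> D \<Longrightarrow> x \<in> H \<Longrightarrow> \<alpha> (c *s x) = c * \<alpha> x"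
  unfolding dual_def by blast+

lemma dual_zero: "\<alpha> \<in> D \<Longrightarrow> \<alpha> 0 = 0"
  using dual_scale[of \<alpha> 0 0] subspace_0[OF subspace_H] by simp

lemma D_zero: "(\<lambda>v. 0) \<in> D"
  unfolding dual_def by auto

lemma D_lin: "\<alpha> \<in> D \<Longrightarrow> \<beta> \<in> D \<Longrightarrow> (\<lambda>v. \<alpha> v + c * \<beta> v) \<in> D"
  unfolding dual_def by (auto simp: algebra_simps)

lemma D_diff: "\<alpha> \<in> D \<Longrightarrow> \<beta> \<in> D \<Longrightarrow> (\<lambda>v. \<alpha> v - c * \<beta> v) \<in> D"
  using D_lin[of \<alpha> \<beta> "- c"] by simp

lemma D_minus: "\<alpha> \<in> D \<Longrightarrow> (\<lambda>v. - \<alpha> v) \<in> D"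
  using D_diff[OF D_zero, of \<alpha> 1] by simp

lemma D_sum: "(\<And>i. i \<in> S \<Longrightarrow> a i \<in> D) \<Longrightarrow> (\<lambda>v. \<Sum>i\<in>S. c i * a i v) \<in> D"
proof (induction S rule: infinite_finite_induct)
  case (insert i S)
  then have "(\<lambda>v. (\<Sum>i\<in>S. c i * a i v) + c i * a i v) \<in> D" by (intro D_lin) auto
  then show ?case using insert by (simp add: add.commute)
qed (auto intro: D_zero)

text \<open>For a basis \<open>b\<close> of \<open>H\<close>, nondegeneracy makes \<open>t \<mapsto> \<Sum>e\<in>b. B t e *s e\<close> an injective, hence surjective,
endomorphism of \<open>H\<close>.\<close>

lemma tvec_exists:
  assumes \<alpha>: "\<alpha> \<in> D"
  shows "\<exists>t\<in>H. \<forall>h\<in>H. B t h = \<alpha> h"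
proof -
  obtain F where F: "finite F" "F \<subseteq> H" "H \<subseteq> span F" using H_fin unfolding finite_dim_def by blast
  obtain b where b: "b \<subseteq> H" "independent b" "H \<subseteq> span b" by (rule maximal_independent_subset)
  have fb: "finite b" using independent_span_bound[OF F(1) b(2)] b(1) F(3) by blast
  have spb: "span b = H" using b(1,3) subspace_H by (rule span_subspace)
  define \<theta> where "\<theta> t = (\<Sum>e\<in>b. B t e *s e)" for t
  interpret \<theta>: Vector_Spaces.linear sc sc \<theta>
    by unfold_locales
      (simp_all add: \<theta>_def B_add_left B_scale_left scale_left_distrib sum.distrib scale_sum_right)
  have coords: "t = 0" if "t \<in> H" and te: "\<And>e. e \<in> b \<Longrightarrow> B t e = 0" for t
  proof -
    have "B t h = 0" if "h \<in> span b" for h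
      using that
    proof (induction rule: span_induct_alt)
      case base show ?case using B_scale_right[of t 0 0] by simp
    next
      case (step c x y) then show ?case using te by (simp add: B_add_right B_scale_right)
    qed
    then show ?thesis using nondeg that(1) unfolding nondegenerate_on_def spb by blast
  qed
  have inj: "inj_on \<theta> (span b)"
    unfolding \<theta>.inj_on_iff_eq_0[OF subspace_span]
  proof (intro ballI impI)
    fix t assume t: "t \<in> span b" "\<theta> t = 0"
    then have "B t e = 0" if "e \<in> b" for e
      using independentD[OF b(2) fb subset_refl _ that, of "\<lambda>e. B t e"] unfolding \<theta>_def by blast
    then show "t = 0" using coords t(1) spb by blast
  qed
  have ind: "independent (\<theta> ` b)" using b(2) inj by (rule \<theta>.independent_inj_on_image)
  have sub: "\<theta> t \<in> span b" for t unfolding \<theta>_def by (intro span_sum span_scale span_base)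
  define z where "z = (\<Sum>e\<in>b. \<alpha> e *s e)"
  have z: "z \<in> span b" unfolding z_def by (intro span_sum span_scale span_base)
  have "z \<in> span (\<theta> ` b)"
  proof (rule ccontr)
    assume nz: "z \<notin> span (\<theta> ` b)"
    \<comment> \<open>A vector of \<open>span b\<close> missed by \<theta> would extend the image of
      \<open>b\<close> to an independent set with one element more than \<open>b\<close>.\<close>
    then have "independent (insert z (\<theta> ` b))" using ind dependent_insertD by blast
    then have "card (insert z (\<theta> ` b)) \<le> card b"
      using independent_span_bound[OF fb] z sub by blast
    moreover have "card (\<theta> ` b) = card b" by (rule card_image) (rule inj_on_subset[OF inj span_superset])
    moreover have "z \<notin> \<theta> ` b" using nz span_base by blast
    ultimately show False using fb by simp
  qed
  then have "z \<in> \<theta> ` span b" by (simp add: \<theta>.span_image)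
  then obtain t where t: "t \<in> H" "\<theta> t = z" using spb by blast
  have te: "B t e = \<alpha> e" if "e \<in> b" for e
  proof -
    have "(\<Sum>e\<in>b. (B t e - \<alpha> e) *s e) = 0"
      using t(2) unfolding \<theta>_def z_def by (simp add: scale_left_diff_distrib sum_subtractf)
    then have "B t e - \<alpha> e = 0" by (rule independentD[OF b(2) fb subset_refl _ that])
    then show ?thesis by simp
  qed
  have "h \<in> H \<and> B t h = \<alpha> h" if "h \<in> span b" for h
    using that
  proof (induction rule: span_induct_alt)
    case base then show ?case using subspace_0[OF subspace_H] dual_zero[OF \<alpha>] B_scale_right[of t 0 0] by simp
  next
    case (step c x y)
    then have "x \<in> H" "c *s x \<in> H" using b(1) subspace_H subspace_scale by blast+
    then show ?case using step te subspace_add[OF subspace_H]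
      by (simp add: B_add_right B_scale_right dual_add[OF \<alpha>] dual_scale[OF \<alpha>])
  qed
  then show ?thesis using t spb by blast
qed

lemma tv:
  assumes "\<alpha> \<in> D"
  shows "tv \<alpha> \<in> H" and "h \<in> H \<Longrightarrow> B (tv \<alpha>) h = \<alpha> h"
proof -
  obtain t where t: "t \<in> H" "\<forall>h\<in>H. B t h = \<alpha> h" using tvec_exists[OF assms] by blast
  have "tv \<alpha> \<in> H \<and> (\<forall>h\<in>H. B (tv \<alpha>) h = \<alpha> h)"
    unfolding tvec_def
  proof (rule theI)
    show "t \<in> H \<and> (\<forall>h\<in>H. B t h = \<alpha> h)" using t by blast
    fix s assume s: "s \<in> H \<and> (\<forall>h\<in>H. B s h = \<alpha> h)"
    have "B (s - t) h = 0" if "h \<in> H" for h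
      using B_add_left[of "s - t" t h] s t that by simp
    moreover have "s - t \<in> H" using s t subspace_diff[OF subspace_H] by blast
    ultimately have "s - t = 0" using nondeg unfolding nondegenerate_on_def by blast
    then show "s = t" by simp
  qed
  then show "tv \<alpha> \<in> H" "h \<in> H \<Longrightarrow> B (tv \<alpha>) h = \<alpha> h" by blast+
qed

lemma ip_eval: "\<alpha> \<in> D \<Longrightarrow> \<beta> \<in> D \<Longrightarrow> ip \<alpha> \<beta> = \<alpha> (tv \<beta>)"
  unfolding dform_def by (simp add: tv)

lemma ip_sym: "ip \<alpha> \<beta> = ip \<beta> \<alpha>"
  unfolding dform_def by (rule B_sym)

lemma ip_lin_left: "\<alpha> \<in> D \<Longrightarrow> \<beta> \<in> D \<Longrightarrow> \<gamma> \<in> D \<Longrightarrow> ip (\<lambda>v. \<alpha> v + c * \<beta> v) \<gamma> = ip \<alpha> \<gamma> + c * ip \<beta> \<gamma>"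
  by (simp add: ip_eval D_lin)

lemma ip_diff_left: "\<alpha> \<in> D \<Longrightarrow> \<beta> \<in> D \<Longrightarrow> \<gamma> \<in> D \<Longrightarrow> ip (\<lambda>v. \<alpha> v - c * \<beta> v) \<gamma> = ip \<alpha> \<gamma> - c * ip \<beta> \<gamma>"
  by (simp add: ip_eval D_diff)

lemma ip_diff_right: "\<alpha> \<in> D \<Longrightarrow> \<beta> \<in> D \<Longrightarrow> \<gamma> \<in> D \<Longrightarrow> ip \<gamma> (\<lambda>v. \<alpha> v - c * \<beta> v) = ip \<gamma> \<alpha> - c * ip \<gamma> \<beta>"
  using ip_diff_left[of \<alpha> \<beta> \<gamma> c] ip_sym[of \<gamma> "\<lambda>v. \<alpha> v - c * \<beta> v"] ip_sym[of \<alpha> \<gamma>] ip_sym[of \<beta> \<gamma>]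
  by simp

lemma ip_minus_left: "\<alpha> \<in> D \<Longrightarrow> \<gamma> \<in> D \<Longrightarrow> ip (\<lambda>v. - \<alpha> v) \<gamma> = - ip \<alpha> \<gamma>"
  by (simp add: ip_eval D_minus)

lemma ip_minus_right: "\<alpha> \<in> D \<Longrightarrow> \<gamma> \<in> D \<Longrightarrow> ip \<gamma> (\<lambda>v. - \<alpha> v) = - ip \<gamma> \<alpha>"
  using ip_minus_left[of \<alpha> \<gamma>] ip_sym[of \<gamma> "\<lambda>v. - \<alpha> v"] ip_sym[of \<alpha> \<gamma>] by simp

lemma ip_sum_left:
  assumes a: "\<And>i. i \<in> S \<Longrightarrow> a i \<in> D" and \<gamma>: "\<gamma> \<in> D"
  shows "ip (\<lambda>v. \<Sum>i\<in>S. c i * a i v) \<gamma> = (\<Sum>i\<in>S. c i * ip (a i) \<gamma>)"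
proof -
  have "(\<lambda>v. \<Sum>i\<in>S. c i * a i v) \<in> D" by (rule D_sum[OF a])
  then have "ip (\<lambda>v. \<Sum>i\<in>S. c i * a i v) \<gamma> = (\<Sum>i\<in>S. c i * a i (tv \<gamma>))"
    using ip_eval \<gamma> by blast
  also have "\<dots> = (\<Sum>i\<in>S. c i * ip (a i) \<gamma>)" using ip_eval[OF a \<gamma>] by simp
  finally show ?thesis .
qed

lemma R_D: "\<alpha> \<in> R \<Longrightarrow> \<alpha> \<in> D"
  unfolding roots_def by blast

lemma Rx_R: "\<alpha> \<in> Rx \<Longrightarrow> \<alpha> \<in> R"
  unfolding roots_nonisotropic_def by blast

lemma Rx_D: "\<alpha> \<in> Rx \<Longrightarrow> \<alpha> \<in> D"
  using Rx_R R_D by blast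

lemma Rx_ip: "\<alpha> \<in> Rx \<Longrightarrow> ip \<alpha> \<alpha> \<noteq> 0"
  unfolding roots_nonisotropic_def by blast

lemma Rx_I: "\<alpha> \<in> R \<Longrightarrow> ip \<alpha> \<alpha> \<noteq> 0 \<Longrightarrow> \<alpha> \<in> Rx"
  unfolding roots_nonisotropic_def by blast

lemma R_cases: "\<alpha> \<in> R \<Longrightarrow> \<alpha> \<in> Rx \<or> \<alpha> \<in> R0"
  unfolding roots_nonisotropic_def roots_isotropic_def by blast

lemma R_I: "\<alpha> \<in> D \<Longrightarrow> x \<in> W H \<alpha> \<Longrightarrow> x \<noteq> 0 \<Longrightarrow> \<alpha> \<in> R"
  unfolding roots_def by blast

lemma R_E: assumes "\<alpha> \<in> R" obtains x where "x \<in> W H \<alpha>" "x \<noteq> 0"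
  using assms subspace_0[OF subspace_W] unfolding roots_def by blast

lemma T3_isotropic: "\<forall>\<delta>\<in>R0. \<exists>x\<in>W H \<delta>. \<exists>y\<in>W H (\<lambda>v. - \<delta> v). br x y = tv \<delta>"
  using class_T unfolding class_T_def by (elim conjE)

lemma T3: "\<alpha> \<in> Rx \<Longrightarrow> x \<in> W H \<alpha> \<Longrightarrow> x \<noteq> 0 \<Longrightarrow> \<exists>y\<in>W H (\<lambda>v. - \<alpha> v). br x y = tv \<alpha>"
proof -
  have "\<forall>\<alpha>\<in>Rx. \<forall>x\<in>W H \<alpha>. x \<noteq> 0 \<longrightarrow> (\<exists>y\<in>W H (\<lambda>v. - \<alpha> v). br x y = tv \<alpha>)"
    using class_T unfolding class_T_def by (elim conjE)
  then show "\<alpha> \<in> Rx \<Longrightarrow> x \<in> W H \<alpha> \<Longrightarrow> x \<noteq> 0 \<Longrightarrow> ?thesis" by blast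
qed

lemma T4: "\<alpha> \<in> Rx \<Longrightarrow> x \<in> W H \<alpha> \<Longrightarrow> \<exists>n. (br x ^^ n) y = 0"
proof -
  have "\<forall>\<alpha>\<in>Rx. \<forall>x\<in>W H \<alpha>. \<forall>y. \<exists>n. (br x ^^ n) y = 0"
    using class_T unfolding class_T_def by (elim conjE)
  then show "\<alpha> \<in> Rx \<Longrightarrow> x \<in> W H \<alpha> \<Longrightarrow> ?thesis" by blast
qed

lemma T5a:
  assumes "P \<noteq> {}" "Q \<noteq> {}" "P \<inter> Q = {}" "P \<union> Q = Rx"
    and "\<And>\<alpha> \<beta>. \<alpha> \<in> P \<Longrightarrow> \<beta> \<in> Q \<Longrightarrow> ip \<alpha> \<beta> = 0"
  shows False
proof -
  have "\<not> (\<exists>P Q. P \<noteq> {} \<and> Q \<noteq> {} \<and> P \<inter> Q = {} \<and> P \<union> Q = Rx \<and> (\<forall>\<alpha>\<in>P. \<forall>\<beta>\<in>Q. ip \<alpha> \<beta> = 0))"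
    using class_T unfolding class_T_def by (elim conjE)
  then show ?thesis by (rule notE) (intro exI[of _ P] exI[of _ Q] conjI ballI assms)
qed

lemma T5b: "\<forall>\<delta>\<in>R0. \<exists>\<alpha>\<in>Rx. (\<lambda>v. \<alpha> v + \<delta> v) \<in> R"
  using class_T unfolding class_T_def by (elim conjE)

text \<open>A nonzero element of \<open>H\<close> has a nonzero weight component, so roots exist; if
  that root is isotropic, (T5b) supplies a nonisotropic one.\<close>

lemma Rx_nonempty: "Rx \<noteq> {}"
proof -
  obtain x where x: "x \<in> H" "x \<noteq> 0" using toral subspace_0[OF subspace_H]
    unfolding toral_subalgebra_def by blast
  have "\<forall>x\<in>UNIV. \<exists>S f. finite S \<and> S \<subseteq> D \<and> (\<forall>\<alpha>\<in>S. f \<alpha> \<in> UNIV \<inter> W H \<alpha>) \<and> x = sum f S"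
    using toral unfolding toral_subalgebra_def weight_decomposition_def by (elim conjE)
  then obtain S f where S: "finite S" "S \<subseteq> D" "\<forall>\<alpha>\<in>S. f \<alpha> \<in> UNIV \<inter> W H \<alpha>" "x = sum f S"
    by (elim ballE[of _ _ x] exE conjE) auto
  obtain \<alpha> where "\<alpha> \<in> S" "f \<alpha> \<noteq> 0" using x(2) S(4) by (metis sum.neutral)
  then have "\<alpha> \<in> R" using S(2,3) by (intro R_I[of \<alpha> "f \<alpha>"]) auto
  then show ?thesis using R_cases T5b by blast
qed

section \<open>Coroots, root strings and reflections\<close>

lemma hv_eval: "\<alpha> \<in> D \<Longrightarrow> \<beta> \<in> D \<Longrightarrow> \<beta> (hv \<alpha>) = 2 * ip \<beta> \<alpha> / ip \<alpha> \<alpha>"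
  unfolding hvec_def by (simp add: ip_eval dual_scale tv)

lemma hv_int: "\<alpha> \<in> Rx \<Longrightarrow> \<beta> \<in> D \<Longrightarrow> \<beta> (hv \<alpha>) = n \<Longrightarrow> 2 * ip \<beta> \<alpha> = n * ip \<alpha> \<alpha>"
  using Rx_ip[of \<alpha>] hv_eval[of \<alpha> \<beta>] Rx_D[of \<alpha>] by (simp add: field_simps)

lemma hv_H: "\<alpha> \<in> D \<Longrightarrow> hv \<alpha> \<in> H"
  unfolding hvec_def using subspace_H tv(1) subspace_scale by blast

lemma hv_self: "\<alpha> \<in> Rx \<Longrightarrow> \<alpha> (hv \<alpha>) = 2"
  using Rx_ip by (simp add: hv_eval Rx_D)

lemma tv_nonzero: assumes "\<alpha> \<in> Rx" shows "tv \<alpha> \<noteq> 0"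
  using assms ip_eval[of \<alpha> \<alpha>] Rx_ip dual_zero Rx_D by metis

text \<open>The partner that (T3) gives to a root vector is nonzero, because the bracket
  \<open>tv \<alpha>\<close> is.\<close>

lemma minus_Rx:
  assumes \<alpha>: "\<alpha> \<in> Rx" shows "(\<lambda>v. - \<alpha> v) \<in> Rx"
proof -
  obtain x where "x \<in> W H \<alpha>" "x \<noteq> 0" using R_E[OF Rx_R[OF \<alpha>]] .
  then obtain y where "y \<in> W H (\<lambda>v. - \<alpha> v)" "br x y = tv \<alpha>" using T3[OF \<alpha>] by blast
  moreover from this have "y \<noteq> 0" using tv_nonzero[OF \<alpha>] by auto
  ultimately have "(\<lambda>v. - \<alpha> v) \<in> R" using R_I D_minus[OF Rx_D[OF \<alpha>]] by blast
  then show ?thesis using \<alpha> Rx_ip by (auto intro!: Rx_I simp: ip_minus_left ip_minus_right Rx_D D_minus)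
qed

lemma sl2_triple_of_root:
  assumes "\<alpha> \<in> Rx" "e \<in> W H \<alpha>" "f \<in> W H (\<lambda>v. - \<alpha> v)" "br e f = hv \<alpha>"
  shows "sl2_triple e f (hv \<alpha>)"
  using assms W_D[OF assms(2) hv_H] W_D[OF assms(3) hv_H] hv_self Rx_D unfolding sl2_triple_def by simp

lemma root_string_stable:
  assumes \<alpha>: "\<alpha> \<in> Rx" and e: "e \<in> W H \<alpha>" and f: "f \<in> W H (\<lambda>v. - \<alpha> v)" and ef: "br e f = hv \<alpha>"
    and M: "\<And>x. x \<in> M \<Longrightarrow> br e x \<in> M" "\<And>x. x \<in> M \<Longrightarrow> br f x \<in> M"
    and v: "v \<in> M" "v \<in> W H \<beta>" "v \<noteq> 0"
  shows "\<exists>n::int. \<beta> (hv \<alpha>) = of_int n \<and> (\<forall>j::int. (0 \<le> j \<and> j \<le> n) \<or> (n \<le> j \<and> j \<le> 0) \<longrightarrow>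
           M \<inter> W H (\<lambda>v. \<beta> v - of_int j * \<alpha> v) \<noteq> {0})"
proof (rule sl2_string[where M = M and \<alpha> = \<alpha> and \<beta> = \<beta>, OF sl2_triple_of_root[OF \<alpha> e f ef] _ _ M e f v])
  show "\<exists>n. (br e ^^ n) x = 0" for x using T4[OF \<alpha> e] .
  show "\<exists>n. (br f ^^ n) x = 0" for x using T4[OF minus_Rx[OF \<alpha>] f] .
  show "br (hv \<alpha>) v = \<beta> (hv \<alpha>) *s v" using W_D[OF v(2)] hv_H[OF Rx_D[OF \<alpha>]] .
qed

lemma root_string:
  assumes \<alpha>: "\<alpha> \<in> Rx" and \<beta>: "\<beta> \<in> R"
  shows "\<exists>n::int. \<beta> (hv \<alpha>) = of_int n \<and> (\<forall>j::int. (0 \<le> j \<and> j \<le> n) \<or> (n \<le> j \<and> j \<le> 0) \<longrightarrow>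
           (\<lambda>v. \<beta> v - of_int j * \<alpha> v) \<in> R)"
proof -
  obtain e where e: "e \<in> W H \<alpha>" "e \<noteq> 0" using R_E[OF Rx_R[OF \<alpha>]] .
  then obtain y where y: "y \<in> W H (\<lambda>v. - \<alpha> v)" "br e y = tv \<alpha>" using T3[OF \<alpha>] by blast
  \<comment> \<open>(T3) yields the bracket \<open>tv \<alpha>\<close>; this factor rescales it to
    the coroot.\<close>
  define f where "f = (2 / ip \<alpha> \<alpha>) *s y"
  have f: "f \<in> W H (\<lambda>v. - \<alpha> v)" "br e f = hv \<alpha>"
    unfolding f_def hvec_def using y subspace_scale[OF subspace_W] by (auto simp: br_scale_right)
  obtain v where v: "v \<in> W H \<beta>" "v \<noteq> 0" using R_E[OF \<beta>] .
  have "\<exists>n::int. \<beta> (hv \<alpha>) = of_int n \<and> (\<forall>j::int. (0 \<le> j \<and> j \<le> n) \<or> (n \<le> j \<and> j \<le> 0) \<longrightarrow>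
           UNIV \<inter> W H (\<lambda>v. \<beta> v - of_int j * \<alpha> v) \<noteq> {0})"
    by (rule root_string_stable[where \<alpha> = \<alpha> and \<beta> = \<beta> and M = UNIV, OF \<alpha> e(1) f _ _ _ v]) (rule UNIV_I)+
  then obtain n :: int where n: "\<beta> (hv \<alpha>) = of_int n" and
    "\<forall>j::int. (0 \<le> j \<and> j \<le> n) \<or> (n \<le> j \<and> j \<le> 0) \<longrightarrow> W H (\<lambda>v. \<beta> v - of_int j * \<alpha> v) \<noteq> {0}"
    unfolding Int_UNIV_left by blast
  moreover have "(\<lambda>v. \<beta> v - of_int j * \<alpha> v) \<in> D" for j :: int
    using D_diff[OF R_D[OF \<beta>] Rx_D[OF \<alpha>]] .
  ultimately show ?thesis unfolding roots_def by (intro exI[of _ n]) simp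
qed

lemma cartan_integer:
  assumes "\<alpha> \<in> Rx" "\<beta> \<in> R" obtains n where "\<beta> (hv \<alpha>) = of_int n"
  using root_string[OF assms] by blast

lemma reflection_root:
  assumes "\<alpha> \<in> Rx" "\<beta> \<in> R" "\<beta> (hv \<alpha>) = of_int n"
  shows "(\<lambda>v. \<beta> v - of_int n * \<alpha> v) \<in> R"
  using root_string[OF assms(1,2)] assms(3) by fastforce

lemma reflection_ip:
  assumes \<alpha>: "\<alpha> \<in> Rx" and \<beta>: "\<beta> \<in> D" and n: "\<beta> (hv \<alpha>) = of_int n"
  shows "ip (\<lambda>v. \<beta> v - of_int n * \<alpha> v) (\<lambda>v. \<beta> v - of_int n * \<alpha> v) = ip \<beta> \<beta>"
proof -
  have a: "\<alpha> \<in> D" by (rule Rx_D[OF \<alpha>])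
  have "ip (\<lambda>v. \<beta> v - of_int n * \<alpha> v) (\<lambda>v. \<beta> v - of_int n * \<alpha> v)
      = ip \<beta> \<beta> - of_int n * ip \<beta> \<alpha> - of_int n * (ip \<beta> \<alpha> - of_int n * ip \<alpha> \<alpha>)"
    unfolding ip_diff_left[OF \<beta> a D_diff[OF \<beta> a]] ip_diff_right[OF \<beta> a \<beta>] ip_diff_right[OF \<beta> a a]
      ip_sym[of \<alpha> \<beta>] by (rule refl)
  also have "\<dots> = ip \<beta> \<beta> - of_int n * (2 * ip \<beta> \<alpha> - of_int n * ip \<alpha> \<alpha>)"
    by (simp add: algebra_simps)
  finally show ?thesis using hv_int[OF \<alpha> \<beta> n] by simp
qed

lemma reflection_Rx:
  assumes "\<alpha> \<in> Rx" "\<beta> \<in> Rx" "\<beta> (hv \<alpha>) = of_int n"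
  shows "(\<lambda>v. \<beta> v - of_int n * \<alpha> v) \<in> Rx"
  using reflection_root[OF assms(1) Rx_R[OF assms(2)] assms(3)] reflection_ip[OF assms(1) Rx_D[OF assms(2)] assms(3)]
    Rx_ip[OF assms(2)] by (intro Rx_I) simp_all

text \<open>As \<delta> vanishes on \<open>tv \<delta>\<close>, the triple x, y,
  \<open>tv \<delta>\<close> is of Heisenberg type, and \<open>tv \<delta>\<close> acts on the whole
  string through \<beta> by the constant \<open>ip \<beta> \<delta>\<close>. Either no power of x
  kills v and the string ascends forever, or some vector w is killed by x and [x, y^(n+1) w] = (n+1)
  \<open>ip \<beta> \<delta>\<close> y^n w keeps the descending powers nonzero. \<open>s\<close> is
  the direction, \<open>m\<close> the starting point.\<close>

lemma heisenberg_string: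
  assumes x: "x \<in> W H \<delta>" and y: "y \<in> W H (\<lambda>v. - \<delta> v)" and xy: "br x y = tv \<delta>"
    and \<delta>: "\<delta> \<in> D" "ip \<delta> \<delta> = 0" and v: "v \<in> W H \<beta>" "v \<noteq> 0" and \<beta>: "\<beta> \<in> D" "ip \<beta> \<delta> \<noteq> 0"
  shows "\<exists>m s::int. \<bar>s\<bar> = 1 \<and> (\<forall>n::nat. (\<lambda>v. \<beta> v + of_int (m + s * int n) * \<delta> v) \<in> R)"
proof (cases "\<exists>n. (br x ^^ n) v = 0")
  case False
  have "(\<lambda>v. \<beta> v + of_nat n * \<delta> v) \<in> R" for n
    using R_I[OF D_lin[OF \<beta>(1) \<delta>(1)] W_br_power[OF x v(1)]] False by blast
  then show ?thesis by (intro exI[of _ 0] exI[of _ 1]) simp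
next
  case True
  then obtain p where p: "(br x ^^ p) v \<noteq> 0" "(br x ^^ Suc p) v = 0"
    using last_nonzero_power[where g = "br x" and v = v] v(2) by metis
  define w where "w = (br x ^^ p) v"
  have w: "w \<in> W H (\<lambda>v. \<beta> v + of_nat p * \<delta> v)" "br x w = 0" "w \<noteq> 0"
    using W_br_power[OF x v(1)] p by (simp_all add: w_def)
  have wn: "(br y ^^ n) w \<in> W H (\<lambda>v. \<beta> v + of_int (int p + (-1) * int n) * \<delta> v)" for n
    using W_br_power[OF y w(1), of n] by (simp add: algebra_simps)
  have step: "br x ((br y ^^ Suc n) w) = (of_nat (Suc n) * ip \<beta> \<delta>) *s (br y ^^ n) w" for n
  proof (induction n)
    case 0
    have "br x (br y w) = br (tv \<delta>) w" using xy w(2) br_derivation[of x y w] by simp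
    then show ?case using W_D[OF w(1) tv(1)[OF \<delta>(1)]] \<delta> \<beta> by (simp add: ip_eval)
  next
    case (Suc n)
    let ?u = "(br y ^^ Suc n) w"
    have "br (tv \<delta>) ?u = ip \<beta> \<delta> *s ?u"
      using W_D[OF wn tv(1)[OF \<delta>(1)], of "Suc n"] \<delta> \<beta> ip_eval[of \<delta> \<delta>] by (simp add: ip_eval)
    then have "br x (br y ?u) = ip \<beta> \<delta> *s ?u + (of_nat (Suc n) * ip \<beta> \<delta>) *s ?u"
      using br_derivation[of x y ?u] xy Suc.IH by (simp add: br_scale_right)
    also have "\<dots> = (of_nat (Suc (Suc n)) * ip \<beta> \<delta>) *s ?u"
      by (simp only: scale_left_distrib[symmetric]) (simp add: algebra_simps)
    finally show ?case by simp
  qed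
  have "(br y ^^ n) w \<noteq> 0" for n
  proof (induction n)
    case 0 then show ?case using w by simp
  next
    case (Suc n)
    have "(of_nat (Suc n) * ip \<beta> \<delta>) *s (br y ^^ n) w \<noteq> 0"
      using Suc \<beta>(2) of_nat_neq_0[of n, where ?'a = 'k] by (metis scale_eq_0_iff mult_eq_0_iff)
    then show ?case using step[of n] by (metis br_zero_right)
  qed
  then have "(\<lambda>v. \<beta> v + of_int (int p + (-1) * int n) * \<delta> v) \<in> R" for n
    using R_I[OF D_lin[OF \<beta>(1) \<delta>(1)] wn] by blast
  then show ?thesis by (intro exI[of _ "int p"] exI[of _ "-1"]) simp
qed

text \<open>Along the infinite string the norms \<open>q n\<close> form an arithmetic progression
  with difference 2sc. Wherever \<open>q n\<close> is nonzero, the member is a nonisotropic root and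
  its Cartan integer with \<delta> makes 2c / \<open>q n\<close> a nonzero integer; a progression
  cannot sustain this.\<close>

lemma isotropic_orthogonal:
  assumes \<delta>: "\<delta> \<in> R0" and \<beta>: "\<beta> \<in> R"
  shows "ip \<beta> \<delta> = 0"
proof (rule ccontr)
  define c where "c = ip \<beta> \<delta>"
  assume "ip \<beta> \<delta> \<noteq> 0"
  then have c: "c \<noteq> 0" by (simp add: c_def)
  have \<delta>': "\<delta> \<in> R" "ip \<delta> \<delta> = 0" "\<delta> \<in> D" using \<delta> R_D unfolding roots_isotropic_def by blast+
  have \<beta>': "\<beta> \<in> D" using \<beta> R_D by blast
  obtain x y where xy: "x \<in> W H \<delta>" "y \<in> W H (\<lambda>v. - \<delta> v)" "br x y = tv \<delta>" using T3_isotropic \<delta> by blast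
  obtain v where v: "v \<in> W H \<beta>" "v \<noteq> 0" using R_E[OF \<beta>] .
  obtain m s :: int where s: "\<bar>s\<bar> = 1"
    and "\<forall>n::nat. (\<lambda>v. \<beta> v + of_int (m + s * int n) * \<delta> v) \<in> R"
    using heisenberg_string[OF xy \<delta>'(3,2) v \<beta>' \<open>ip \<beta> \<delta> \<noteq> 0\<close>] by blast
  then have gR: "(\<lambda>v. \<beta> v + of_int (m + s * int n) * \<delta> v) \<in> R" for n by blast
  define q where "q n = ip \<beta> \<beta> + 2 * of_int (m + s * int n) * c" for n
  have p: "\<exists>p::int. of_int p * q n = 2 * c" if "q n \<noteq> 0" for n
  proof -
    let ?r = "of_int (m + s * int n) :: 'k"
    let ?\<gamma> = "\<lambda>v. \<beta> v + ?r * \<delta> v"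
    have 1: "ip ?\<gamma> \<delta> = c"
      using ip_lin_left[OF \<beta>' \<delta>'(3) \<delta>'(3), of ?r] \<delta>'(2) by (simp add: c_def)
    have 2: "ip ?\<gamma> \<beta> = ip \<beta> \<beta> + ?r * c"
      using ip_lin_left[OF \<beta>' \<delta>'(3) \<beta>', of ?r] ip_sym[of \<delta> \<beta>] by (simp add: c_def)
    have "ip ?\<gamma> ?\<gamma> = ip \<beta> ?\<gamma> + ?r * ip \<delta> ?\<gamma>"
      by (rule ip_lin_left[OF \<beta>' \<delta>'(3) R_D[OF gR]])
    then have qn: "ip ?\<gamma> ?\<gamma> = q n"
      using 1 2 ip_sym[of \<beta> ?\<gamma>] ip_sym[of \<delta> ?\<gamma>] by (simp add: q_def algebra_simps)
    then have "?\<gamma> \<in> Rx" using that by (intro Rx_I[OF gR]) simp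
    then obtain p where "\<delta> (hv ?\<gamma>) = of_int p" using cartan_integer[OF _ \<delta>'(1)] by blast
    then have "2 * ip \<delta> ?\<gamma> = of_int p * ip ?\<gamma> ?\<gamma>" using hv_int[OF \<open>?\<gamma> \<in> Rx\<close> \<delta>'(3)] by blast
    then have "of_int p * q n = 2 * c" using 1 qn ip_sym[of \<delta> ?\<gamma>] by simp
    then show ?thesis by (rule exI)
  qed
  \<comment> \<open>With a = 2c / \<open>q i\<close> and b = 2c / \<open>q j\<close>, the
    progression reads 1/b - 1/a = s(j - i). Reciprocals of nonzero integers differ by at most 2, so
    a gap of 3 is contradictory; the computation clears denominators.\<close>
  have False if q: "q i \<noteq> 0" "q j \<noteq> 0" and ij: "i + 3 \<le> j" for i j
  proof -
    obtain a where a: "of_int a * q i = 2 * c" using p q by blast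
    obtain b where b: "of_int b * q j = 2 * c" using p q by blast
    have ab: "a \<noteq> 0" "b \<noteq> 0" using a b c by (metis mult_eq_0_iff of_int_0 zero_neq_numeral)+
    have "of_int a * of_int b * (q j - q i) = of_int a * (of_int b * q j) - of_int b * (of_int a * q i)"
      by (simp add: algebra_simps)
    also have "\<dots> = (2 * c) * of_int (a - b)" unfolding a b by (simp add: algebra_simps)
    also have "q j - q i = (2 * c) * of_int (s * (int j - int i))"
      by (simp add: q_def algebra_simps)
    finally have "(2 * c) * of_int (a * b * s * (int j - int i)) = (2 * c) * of_int (a - b)"
      by (simp add: mult.assoc mult.left_commute)
    then have "(of_int (a * b * s * (int j - int i)) :: 'k) = of_int (a - b)"
      using c by (simp only: mult_cancel_left mult_eq_0_iff) simp
    then have "a * b * s * (int j - int i) = a - b" by (simp only: of_int_eq_iff)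
    moreover have "\<bar>a * b * s * (int j - int i)\<bar> = \<bar>a\<bar> * \<bar>b\<bar> * (int j - int i)"
      using s ij by (simp add: abs_mult)
    ultimately have "\<bar>a\<bar> * \<bar>b\<bar> * (int j - int i) = \<bar>a - b\<bar>" by simp
    moreover have "\<bar>a\<bar> * \<bar>b\<bar> * (int j - int i) \<ge> \<bar>a\<bar> * \<bar>b\<bar> * 3" using ij by (intro mult_left_mono) simp_all
    moreover have "\<bar>a\<bar> * 1 \<le> \<bar>a\<bar> * \<bar>b\<bar>" "1 * \<bar>b\<bar> \<le> \<bar>a\<bar> * \<bar>b\<bar>"
      using ab by (intro mult_left_mono mult_right_mono; simp)+
    moreover have "\<bar>a\<bar> > 0" "\<bar>a - b\<bar> \<le> \<bar>a\<bar> + \<bar>b\<bar>" using ab by simp_all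
    ultimately show False by linarith
  qed
  note contr = this
  have "q i \<noteq> 0 \<or> q j \<noteq> 0" if "i < j" for i j
  proof (rule ccontr)
    assume "\<not> ?thesis"
    then have "q j - q i = 0" by simp
    moreover have "q j - q i = (2 * c) * of_int (s * (int j - int i))"
      by (simp add: q_def algebra_simps)
    ultimately have "(of_int (s * (int j - int i)) :: 'k) = 0" using c by (metis mult_eq_0_iff zero_neq_numeral)
    then have "s * (int j - int i) = 0" by (simp only: of_int_eq_0_iff)
    then show False using s that by auto
  qed
  note two = this
  \<comment> \<open>At most one term of the progression vanishes, so two of the indices 0, 3, 6 have
    nonzero norm, and any two of them are at least 3 apart.\<close>
  have "q 0 \<noteq> 0 \<or> q 3 \<noteq> 0" "q 0 \<noteq> 0 \<or> q 6 \<noteq> 0" "q 3 \<noteq> 0 \<or> q 6 \<noteq> 0"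
    using two[of 0 3] two[of 0 6] two[of 3 6] by simp_all
  then show False using contr[of 0 3] contr[of 0 6] contr[of 3 6] by auto
qed

lemma cartan_pair_norms:
  assumes \<alpha>: "\<alpha> \<in> Rx" and \<beta>: "\<beta> \<in> Rx" and n: "\<alpha> (hv \<beta>) = of_int n" and m: "\<beta> (hv \<alpha>) = of_int m"
  shows "of_int m * ip \<alpha> \<alpha> = of_int n * ip \<beta> \<beta>"
  using hv_int[OF \<alpha> Rx_D[OF \<beta>] m] hv_int[OF \<beta> Rx_D[OF \<alpha>] n] ip_sym[of \<alpha> \<beta>] by simp

text \<open>Integrality of \<beta> against the coroots of \<alpha> and of \<alpha> - 3\<beta>, with
  all norms eliminated, leaves m(n - 6) = p(n - 3mn + 9m) over the integers. The bracketed factor is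
  too large in absolute value to divide the left side.\<close>

lemma cartan_integer_less_7:
  assumes \<alpha>: "\<alpha> \<in> Rx" and \<beta>: "\<beta> \<in> Rx" and n: "\<alpha> (hv \<beta>) = of_int n"
  shows "n < 7"
proof (rule ccontr)
  assume "\<not> n < 7"
  then have n7: "n \<ge> 7" by simp
  let ?\<gamma> = "\<lambda>v. \<alpha> v - of_int 3 * \<beta> v"
  have aD: "\<alpha> \<in> D" and bD: "\<beta> \<in> D" using \<alpha> \<beta> Rx_D by auto
  obtain m where m: "\<beta> (hv \<alpha>) = of_int m" using cartan_integer[OF \<alpha> Rx_R[OF \<beta>]] by blast
  obtain n' where n': "\<alpha> (hv \<beta>) = of_int n'" "\<forall>j. 0 \<le> j \<and> j \<le> n' \<or> n' \<le> j \<and> j \<le> 0 \<longrightarrow> (\<lambda>v. \<alpha> v - of_int j * \<beta> v) \<in> R"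
    using root_string[OF \<beta> Rx_R[OF \<alpha>]] by blast
  have "n' = n" using n n'(1) by simp
  then have \<gamma>R: "?\<gamma> \<in> R" using n'(2)[THEN spec, of 3] n7 by simp
  define b where "b = ip \<beta> \<beta>"
  have b: "b \<noteq> 0" using Rx_ip[OF \<beta>] by (simp add: b_def)
  have ab: "2 * ip \<alpha> \<beta> = of_int n * b" using hv_int[OF \<beta> aD n] by (simp add: b_def)
  have aa: "of_int m * ip \<alpha> \<alpha> = of_int n * b" using cartan_pair_norms[OF \<alpha> \<beta> n m] by (simp add: b_def)
  have gb: "2 * ip ?\<gamma> \<beta> = of_int (n - 6) * b"
  proof -
    have "2 * ip ?\<gamma> \<beta> = 2 * ip \<alpha> \<beta> - 2 * (of_int 3 * b)"
      unfolding ip_diff_left[OF aD bD bD] b_def by (rule right_diff_distrib)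
    then show ?thesis unfolding ab by (simp add: algebra_simps)
  qed
  \<comment> \<open>The Cartan integer n - 6 is nonzero, so \<open>?\<gamma>\<close> is not
    orthogonal to \<beta> and cannot be isotropic; only then does it have a coroot of its own, which
    provides \<open>p\<close>.\<close>
  have "of_int (n - 6) \<noteq> (0 :: 'k)" using n7 by (simp del: of_int_diff)
  then have "ip ?\<gamma> \<beta> \<noteq> 0" using gb b by (metis mult_eq_0_iff mult_zero_right)
  then have "?\<gamma> \<in> Rx" using R_cases[OF \<gamma>R] isotropic_orthogonal[OF _ Rx_R[OF \<beta>]] ip_sym[of ?\<gamma> \<beta>] by metis
  obtain p where p: "\<beta> (hv ?\<gamma>) = of_int p" using cartan_integer[OF \<open>?\<gamma> \<in> Rx\<close> Rx_R[OF \<beta>]] by blast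
  have pg: "of_int (n - 6) * b = of_int p * ip ?\<gamma> ?\<gamma>"
    using hv_int[OF \<open>?\<gamma> \<in> Rx\<close> bD p] gb ip_sym[of ?\<gamma> \<beta>] by simp
  have "ip ?\<gamma> ?\<gamma> = ip \<alpha> \<alpha> - of_int 3 * ip \<alpha> \<beta> - of_int 3 * (ip \<alpha> \<beta> - of_int 3 * b)"
    unfolding ip_diff_left[OF aD bD D_diff[OF aD bD]] ip_diff_right[OF aD bD aD] ip_diff_right[OF aD bD bD]
      ip_sym[of \<beta> \<alpha>] b_def by (rule refl)
  also have "\<dots> = ip \<alpha> \<alpha> - 3 * (2 * ip \<alpha> \<beta>) + 9 * b" by (simp add: algebra_simps)
  finally have G: "ip ?\<gamma> ?\<gamma> = ip \<alpha> \<alpha> - 3 * (2 * ip \<alpha> \<beta>) + 9 * b" .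
  have "of_int m * ip ?\<gamma> ?\<gamma> = of_int m * ip \<alpha> \<alpha> - of_int m * (3 * (of_int n * b)) + of_int m * (9 * b)"
    unfolding G ab by (simp only: distrib_left right_diff_distrib)
  then have mg: "of_int m * ip ?\<gamma> ?\<gamma> = of_int (n - 3 * m * n + 9 * m) * b"
    unfolding aa by (simp add: algebra_simps)
  have "of_int (m * (n - 6)) * b = of_int m * (of_int (n - 6) * b)" by simp
  also have "\<dots> = of_int p * (of_int m * ip ?\<gamma> ?\<gamma>)" unfolding pg by (simp add: mult.left_commute)
  also have "\<dots> = of_int (p * (n - 3 * m * n + 9 * m)) * b" unfolding mg by simp
  finally have "(of_int (m * (n - 6)) :: 'k) = of_int (p * (n - 3 * m * n + 9 * m))" using b by simp
  then have e: "m * (n - 6) = p * (n - 3 * m * n + 9 * m)" by (simp only: of_int_eq_iff)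
  have m0: "m \<noteq> 0" using aa b n7 by auto
  then have "p \<noteq> 0" using e n7 by auto
  then have "1 * \<bar>n - 3 * m * n + 9 * m\<bar> \<le> \<bar>p\<bar> * \<bar>n - 3 * m * n + 9 * m\<bar>"
    by (intro mult_right_mono) simp_all
  also have "\<dots> = \<bar>m * (n - 6)\<bar>" unfolding e abs_mult ..
  finally have le: "\<bar>n - 3 * m * n + 9 * m\<bar> \<le> \<bar>m * (n - 6)\<bar>" by simp
  \<comment> \<open>As |p| \<ge> 1, the equation gives |n - X - Y| \<le> |Y|. For m \<ge> 1 this
    forces X \<le> n although X \<ge> 2n - 3; for m \<le> -1 it forces X \<ge> n although X <
    0.\<close>
  define X where "X = m * (2 * n - 3)"
  define Y where "Y = m * (n - 6)"
  have XY: "n - 3 * m * n + 9 * m = n - X - Y" by (simp add: X_def Y_def algebra_simps)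
  have le': "\<bar>n - X - Y\<bar> \<le> \<bar>Y\<bar>" using le unfolding XY Y_def .
  consider "m \<ge> 1" | "m \<le> -1" using m0 by linarith
  then show False
  proof cases
    case 1
    have "1 * (2 * n - 3) \<le> X" unfolding X_def using 1 n7 by (intro mult_right_mono) auto
    moreover have "0 \<le> Y" unfolding Y_def using 1 n7 by simp
    then have "- (n - X - Y) \<le> Y" using le' by (metis abs_of_nonneg abs_ge_minus_self order_trans)
    ultimately show False using n7 by simp
  next
    case 2
    have "X \<le> (-1) * (2 * n - 3)" unfolding X_def using 2 n7 by (intro mult_right_mono) auto
    moreover have "Y \<le> 0" unfolding Y_def using 2 n7 by (intro mult_nonpos_nonneg) auto
    then have "n - X - Y \<le> - Y" using le' by (metis abs_of_nonpos abs_ge_self order_trans)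
    ultimately show False using n7 by simp
  qed
qed

lemma cartan_integer_bound:
  assumes \<alpha>: "\<alpha> \<in> Rx" and \<beta>: "\<beta> \<in> Rx" and n: "\<alpha> (hv \<beta>) = of_int n"
  shows "\<bar>n\<bar> < 7"
proof -
  have "n < 7" by (rule cartan_integer_less_7[OF assms])
  moreover have "- n < 7"
    by (rule cartan_integer_less_7[OF minus_Rx[OF \<alpha>] \<beta>]) (simp add: n)
  ultimately show ?thesis by linarith
qed

text \<open>With \<open>p = 2 - nm \<ge> 3\<close>, reflecting twice yields a nonisotropic root whose Cartan
integer with \<open>\<alpha>\<close> is \<open>2 - p^2 \<le> -7\<close>.\<close>

lemma cartan_integer_sign:
  assumes \<alpha>: "\<alpha> \<in> Rx" and \<beta>: "\<beta> \<in> Rx" and n: "\<alpha> (hv \<beta>) = of_int n" and m: "\<beta> (hv \<alpha>) = of_int m"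
  shows "n * m \<ge> 0"
proof (rule ccontr)
  assume neg: "\<not> n * m \<ge> 0"
  define p where "p = 2 - n * m"
  have p: "p \<ge> 3" using neg by (simp add: p_def)
  define \<gamma> where "\<gamma> = (\<lambda>v. \<alpha> v - of_int n * \<beta> v)"
  have \<gamma>: "\<gamma> \<in> Rx" unfolding \<gamma>_def by (rule reflection_Rx[OF \<beta> \<alpha> n])
  have norm: "ip \<gamma> \<gamma> = ip \<alpha> \<alpha>" unfolding \<gamma>_def by (rule reflection_ip[OF \<beta> Rx_D[OF \<alpha>] n])
  have \<gamma>h: "\<gamma> (hv \<alpha>) = of_int p" unfolding \<gamma>_def using m hv_self[OF \<alpha>] by (simp add: p_def)
  have "2 * ip \<gamma> \<alpha> = of_int p * ip \<alpha> \<alpha>" by (rule hv_int[OF \<alpha> Rx_D[OF \<gamma>] \<gamma>h])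
  \<comment> \<open>\<gamma> is a reflection of \<alpha>, so their norms agree and the Cartan
    integer p holds in both directions.\<close>
  then have \<alpha>h: "\<alpha> (hv \<gamma>) = of_int p"
    using hv_eval[OF Rx_D[OF \<gamma>] Rx_D[OF \<alpha>]] norm ip_sym[of \<alpha> \<gamma>] Rx_ip[OF \<alpha>] by simp
  let ?\<epsilon> = "\<lambda>v. \<alpha> v - of_int p * \<gamma> v"
  have "?\<epsilon> \<in> Rx" by (rule reflection_Rx[OF \<gamma> \<alpha> \<alpha>h])
  moreover have "?\<epsilon> (hv \<alpha>) = of_int (2 - p * p)" using \<gamma>h hv_self[OF \<alpha>] by simp
  ultimately have "\<bar>2 - p * p\<bar> < 7" by (rule cartan_integer_bound[OF _ \<alpha>])
  moreover have "p * p \<ge> 3 * 3" using p by (intro mult_mono) auto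
  ultimately show False by linarith
qed

text \<open>The roots whose norm is a positive rational multiple of
  \<open>ip \<alpha> \<alpha>\<close> are orthogonal to all others: for nonorthogonal roots the norm
  ratio is a quotient of two nonzero Cartan integers, positive by
  \<open>cartan_integer_sign\<close>. (T5a) then leaves no others.\<close>

lemma norm_ratio_positive:
  assumes \<alpha>: "\<alpha> \<in> Rx" and \<beta>: "\<beta> \<in> Rx"
  shows "\<exists>r::rat. r > 0 \<and> ip \<beta> \<beta> = of_rat r * ip \<alpha> \<alpha>"
proof (rule ccontr)
  assume n: "\<not> ?thesis"
  let ?P = "{\<beta> \<in> Rx. \<exists>r::rat. r > 0 \<and> ip \<beta> \<beta> = of_rat r * ip \<alpha> \<alpha>}"
  have "\<alpha> \<in> ?P" using \<alpha> by (auto intro!: exI[of _ 1])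
  then have P: "?P \<noteq> {}" by blast
  have Q: "Rx - ?P \<noteq> {}" using n \<beta> by blast
  show False
  proof (rule T5a[OF P Q])
    fix \<gamma> \<epsilon> assume g: "\<gamma> \<in> ?P" and e: "\<epsilon> \<in> Rx - ?P"
    then obtain r :: rat where r: "r > 0" "ip \<gamma> \<gamma> = of_rat r * ip \<alpha> \<alpha>" by blast
    have Rx: "\<gamma> \<in> Rx" "\<epsilon> \<in> Rx" using g e by auto
    obtain i where i: "\<gamma> (hv \<epsilon>) = of_int i" using cartan_integer[OF Rx(2) Rx_R[OF Rx(1)]] .
    obtain j where j: "\<epsilon> (hv \<gamma>) = of_int j" using cartan_integer[OF Rx(1) Rx_R[OF Rx(2)]] .
    show "ip \<gamma> \<epsilon> = 0"
    proof (rule ccontr)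
      assume nz: "ip \<gamma> \<epsilon> \<noteq> 0"
      have i0: "i \<noteq> 0" using hv_int[OF Rx(2) Rx_D[OF Rx(1)] i] nz by auto
      have j0: "j \<noteq> 0" using hv_int[OF Rx(1) Rx_D[OF Rx(2)] j] nz ip_sym[of \<gamma> \<epsilon>] by auto
      have "i * j > 0" using cartan_integer_sign[OF Rx i j] i0 j0 by (simp add: order_less_le)
      then have "0 < of_int j / (of_int i :: rat)" by (auto simp: zero_less_mult_iff zero_less_divide_iff)
      then have "0 < of_int j / of_int i * r" using r(1) by (rule mult_pos_pos)
      moreover have "ip \<epsilon> \<epsilon> = of_int j / of_int i * ip \<gamma> \<gamma>"
        using cartan_pair_norms[OF Rx i j] i0 by (simp add: field_simps)
      then have "ip \<epsilon> \<epsilon> = of_rat (of_int j / of_int i * r) * ip \<alpha> \<alpha>"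
        using r by (simp add: of_rat_mult of_rat_divide)
      ultimately show False using e Rx by blast
    qed
  qed auto
qed

end

section \<open>The root system modulo the radical\<close>

text \<open>The field is a rational vector space in which \<open>{c}\<close> is independent; \<phi>
  is a linear extension of the map sending c to 1.\<close>

lemma rational_functional:
  fixes c :: "'k::field_char_0"
  assumes "c \<noteq> 0"
  shows "\<exists>\<phi>::'k \<Rightarrow> rat. (\<forall>x y. \<phi> (x + y) = \<phi> x + \<phi> y) \<and> (\<forall>q x. \<phi> (of_rat q * x) = q * \<phi> x) \<and> \<phi> c = 1"
proof -
  interpret vector_space_pair "\<lambda>(q::rat) (x::'k). of_rat q * x" "(*) :: rat \<Rightarrow> rat \<Rightarrow> rat"
    by unfold_locales (auto simp: algebra_simps of_rat_add of_rat_mult)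
  have "vs1.independent {c}" using assms by simp
  then obtain \<phi> where \<phi>: "Vector_Spaces.linear (\<lambda>q x. of_rat q * x) (*) \<phi>" "\<phi> c = 1"
    using linear_independent_extend[of "{c}" "\<lambda>_. 1"] by auto
  interpret \<phi>: Vector_Spaces.linear "\<lambda>(q::rat) (x::'k). of_rat q * x" "(*)" \<phi> by fact
  show ?thesis using \<phi>.add \<phi>.scale \<phi>(2) by blast
qed

lemma common_denominator:
  fixes r :: "'i \<Rightarrow> rat"
  assumes "finite S"
  shows "\<exists>N::int. N > 0 \<and> (\<forall>i\<in>S. \<exists>z. of_int N * r i = of_int z)"
  using assms
proof (induction S rule: finite_induct)
  case empty
  show ?case by (rule exI[of _ 1]) simp
next
  case (insert s S)
  then obtain N :: int where N: "N > 0" "\<forall>i\<in>S. \<exists>z. of_int N * r i = of_int z" by blast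
  obtain p q where pq: "quotient_of (r s) = (p, q)" by (cases "quotient_of (r s)")
  have q: "q > 0" "r s = of_int p / of_int q"
    using quotient_of_denom_pos[OF pq] quotient_of_div[OF pq] by auto
  have "\<exists>z. of_int (N * q) * r i = of_int z" if i: "i \<in> insert s S" for i
  proof (cases "i = s")
    case True
    have "of_int (N * q) * r i = of_int (N * p)" using q True by simp
    then show ?thesis by blast
  next
    case False
    then obtain z where "of_int N * r i = of_int z" using i N by blast
    then have "of_int (N * q) * r i = of_int (q * z)" by (simp add: mult.commute mult.left_commute)
    then show ?thesis by blast
  qed
  then show ?case using N(1) q(1) by (intro exI[of _ "N * q"]) simp
qed

locale base_setup = class_T_alg sc br B H
  for sc :: "'k::field_char_0 \<Rightarrow> 'v::ab_group_add \<Rightarrow> 'v" (infixr "*s" 75) and br B H +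
  fixes l :: nat and a :: "nat \<Rightarrow> 'v \<Rightarrow> 'k"
  assumes base: "base_preimages sc br B H l a"
begin

abbreviation "wt \<equiv> intcomb l a"
abbreviation "rad \<equiv> in_radical sc br B H"
abbreviation "ha i \<equiv> hvec sc B H (a i)"

text \<open>Values at indices from \<open>l\<close> on do not affect \<open>wt k\<close>. Forcing
  them to be zero lets equality of functions serve as equality of coordinates.\<close>

definition supported :: "(nat \<Rightarrow> int) \<Rightarrow> bool" where "supported k \<longleftrightarrow> (\<forall>i\<ge>l. k i = 0)"
definition unit :: "nat \<Rightarrow> int \<Rightarrow> nat \<Rightarrow> int" where "unit i c = (\<lambda>j. if j = i then c else 0)"

lemma a_R: "i < l \<Longrightarrow> a i \<in> R"
  using base unfolding base_preimages_def by blast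

lemma a_D: "i < l \<Longrightarrow> a i \<in> D"
  using a_R R_D by blast

lemma wt_D: "wt k \<in> D"
  unfolding intcomb_def by (rule D_sum) (simp add: a_D)

lemma wt_cong: "(\<And>i. i < l \<Longrightarrow> k i = k' i) \<Longrightarrow> wt k = wt k'"
  unfolding intcomb_def by (intro ext sum.cong) auto

lemma wt_zero: "wt (\<lambda>_. 0) = (\<lambda>v. 0)"
  unfolding intcomb_def by simp

lemma wt_add: "wt (\<lambda>i. k i + k' i) = (\<lambda>v. wt k v + wt k' v)"
  unfolding intcomb_def by (simp add: distrib_right sum.distrib)

lemma wt_diff: "wt (\<lambda>i. k i - k' i) = (\<lambda>v. wt k v - wt k' v)"
  unfolding intcomb_def by (simp add: left_diff_distrib sum_subtractf)

lemma wt_scale: "wt (\<lambda>i. c * k i) = (\<lambda>v. of_int c * wt k v)"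
  unfolding intcomb_def by (simp add: sum_distrib_left mult.assoc)

lemma wt_unit: "i < l \<Longrightarrow> wt (unit i c) = (\<lambda>v. of_int c * a i v)"
proof -
  assume i: "i < l"
  have "of_int (unit i c j) * a j v = (if j = i then of_int c * a i v else 0)" for j v
    by (simp add: unit_def)
  then show ?thesis unfolding intcomb_def using i by simp
qed

lemma rad_D: "rad x \<Longrightarrow> \<beta> \<in> R \<Longrightarrow> ip x \<beta> = 0"
  unfolding in_radical_def by blast

lemma rad_zero: "rad (\<lambda>v. 0)"
  unfolding in_radical_def using ip_eval[OF D_zero] R_D by auto

lemma R0_rad: "\<delta> \<in> R0 \<Longrightarrow> rad \<delta>"
  unfolding in_radical_def using isotropic_orthogonal ip_sym by metis

lemma rad_wt_0: "rad (wt k) \<Longrightarrow> supported k \<Longrightarrow> k = (\<lambda>_. 0)"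
  using base unfolding base_preimages_def supported_def by (metis not_le_imp_less)

lemma supported_unit: "i < l \<Longrightarrow> supported (unit i c)"
  by (simp add: supported_def unit_def)

text \<open>An isotropic \<open>a i\<close> would lie in the radical, against independence of the
  base modulo the radical.\<close>

lemma a_Rx: assumes "i < l" shows "a i \<in> Rx"
proof (rule ccontr)
  assume "a i \<notin> Rx"
  then have "rad (a i)" using R_cases[OF a_R[OF assms]] R0_rad by blast
  then have "rad (wt (unit i 1))" using wt_unit[OF assms, of 1] by simp
  then have "unit i 1 = (\<lambda>_. 0)" using rad_wt_0 supported_unit[OF assms] by blast
  then show False unfolding unit_def by (metis zero_neq_one)
qed

lemma rad_diff: "rad x \<Longrightarrow> rad y \<Longrightarrow> x \<in> D \<Longrightarrow> y \<in> D \<Longrightarrow> rad (\<lambda>v. x v - y v)"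
  unfolding in_radical_def using ip_diff_left[of x y _ 1] R_D by auto

lemma rep_exists:
  assumes "\<alpha> \<in> R"
  shows "\<exists>k. supported k \<and> rad (\<lambda>v. \<alpha> v - wt k v)"
proof (cases "\<alpha> \<in> Rx")
  case True
  then obtain k where k: "rad (\<lambda>v. \<alpha> v - wt k v)"
    using base unfolding base_preimages_def by blast
  define k' where "k' i = (if i < l then k i else 0)" for i
  have "wt k' = wt k" by (rule wt_cong) (simp add: k'_def)
  moreover have "supported k'" by (simp add: supported_def k'_def)
  ultimately show ?thesis using k by metis
next
  case False
  then have "rad \<alpha>" using R_cases[OF assms] R0_rad by blast
  then have "rad (\<lambda>v. \<alpha> v - wt (\<lambda>_. 0) v)" by (simp add: wt_zero)
  then show ?thesis by (intro exI[of _ "\<lambda>_. 0"]) (simp add: supported_def)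
qed

lemma rep_unique:
  assumes "\<alpha> \<in> D" "supported k" "supported k'" "rad (\<lambda>v. \<alpha> v - wt k v)" "rad (\<lambda>v. \<alpha> v - wt k' v)"
  shows "k = k'"
proof -
  have d: "(\<lambda>v. \<alpha> v - wt j v) \<in> D" for j using D_diff[OF assms(1) wt_D, of 1 j] by simp
  have "rad (\<lambda>v. (\<alpha> v - wt k' v) - (\<alpha> v - wt k v))" by (rule rad_diff[OF assms(5,4) d d])
  then have "rad (wt (\<lambda>i. k i - k' i))" by (simp add: wt_diff)
  then have "(\<lambda>i. k i - k' i) = (\<lambda>_. 0)" using assms(2,3) by (intro rad_wt_0) (auto simp: supported_def)
  then show ?thesis by (simp add: fun_eq_iff)
qed

text \<open>Coefficient vectors, with respect to \<open>a\<close>, of the images of nonisotropic roots in \<open>V/V^0\<close>.\<close>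

definition K :: "(nat \<Rightarrow> int) set" where
  "K = {k. supported k \<and> (\<exists>\<alpha>\<in>Rx. rad (\<lambda>v. \<alpha> v - wt k v))}"

lemma K_I: "\<alpha> \<in> Rx \<Longrightarrow> supported k \<Longrightarrow> rad (\<lambda>v. \<alpha> v - wt k v) \<Longrightarrow> k \<in> K"
  unfolding K_def by blast

lemma rep_ip:
  assumes "\<alpha> \<in> D" "rad (\<lambda>v. \<alpha> v - wt k v)" "\<beta> \<in> R"
  shows "ip \<alpha> \<beta> = ip (wt k) \<beta>"
  using rad_D[OF assms(2,3)] ip_diff_left[OF assms(1) wt_D R_D[OF assms(3)], of 1 k] by simp

lemma wt_ip_sum: "\<beta> \<in> D \<Longrightarrow> ip (wt k) \<beta> = (\<Sum>i<l. of_int (k i) * ip (a i) \<beta>)"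
  unfolding intcomb_def by (rule ip_sum_left) (simp_all add: a_D)

text \<open>The base supplies some coherent coefficient vector; uniqueness of coordinates modulo the
  radical identifies it with \<open>k\<close>.\<close>

lemma K_coherent:
  assumes "k \<in> K"
  shows "(\<forall>i. 0 \<le> k i) \<or> (\<forall>i. k i \<le> 0)"
proof -
  obtain \<alpha> where \<alpha>: "\<alpha> \<in> Rx" "supported k" "rad (\<lambda>v. \<alpha> v - wt k v)" using assms unfolding K_def by blast
  obtain j where j: "rad (\<lambda>v. \<alpha> v - wt j v)" "(\<forall>i<l. 0 \<le> j i) \<or> (\<forall>i<l. j i \<le> 0)"
    using base \<alpha>(1) unfolding base_preimages_def by blast
  define j' where "j' i = (if i < l then j i else 0)" for i
  have "wt j' = wt j" by (rule wt_cong) (simp add: j'_def)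
  then have "rad (\<lambda>v. \<alpha> v - wt j' v)" using j by simp
  then have "k = j'" by (intro rep_unique[OF Rx_D[OF \<alpha>(1)] \<alpha>(2) _ \<alpha>(3)]) (auto simp: supported_def j'_def)
  then show ?thesis using j(2) by (auto simp: j'_def)
qed

text \<open>The Cartan matrix is indexed so that \<open>C j i\<close> pairs the root \<open>a j\<close> with the coroot of \<open>a i\<close>.\<close>

definition C :: "nat \<Rightarrow> nat \<Rightarrow> int" where "C j i = (SOME n. a j (ha i) = of_int n)"
definition pairing :: "(nat \<Rightarrow> int) \<Rightarrow> nat \<Rightarrow> int" where "pairing k i = (\<Sum>j<l. k j * C j i)"

lemma C: "i < l \<Longrightarrow> j < l \<Longrightarrow> a j (ha i) = of_int (C j i)"
  unfolding C_def by (rule someI_ex) (metis cartan_integer a_Rx a_R)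

lemma C_self: "i < l \<Longrightarrow> C i i = 2"
  using C[of i i] hv_self[OF a_Rx, of i] by (metis of_int_eq_numeral_iff)

lemma wt_ha: "i < l \<Longrightarrow> wt k (ha i) = of_int (pairing k i)"
  unfolding intcomb_def pairing_def by (simp add: C)

lemma rep_ha:
  assumes \<alpha>: "\<alpha> \<in> D" and k: "rad (\<lambda>v. \<alpha> v - wt k v)" and i: "i < l"
  shows "\<alpha> (ha i) = of_int (pairing k i)"
  using rep_ip[OF \<alpha> k a_R[OF i]] wt_ha[OF i, of k] hv_eval[OF a_D[OF i] \<alpha>] hv_eval[OF a_D[OF i] wt_D, of k]
  by simp

text \<open>Nondegeneracy of the Cartan matrix: a combination orthogonal to all \<open>a i\<close>
  is orthogonal to every root, since roots are combinations of the \<open>a i\<close> modulo the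
  radical, and so lies in the radical itself.\<close>

lemma pairing_zero:
  assumes "supported k" "\<And>i. i < l \<Longrightarrow> pairing k i = 0"
  shows "k = (\<lambda>_. 0)"
proof (rule rad_wt_0[OF _ assms(1)])
  have z: "ip (a i) (wt k) = 0" if "i < l" for i
    using hv_int[OF a_Rx[OF that] wt_D wt_ha[OF that, of k]] assms(2)[OF that] ip_sym[of "a i" "wt k"] by simp
  have "ip (wt k) \<beta> = 0" if \<beta>: "\<beta> \<in> R" for \<beta>
  proof -
    obtain j where j: "rad (\<lambda>v. \<beta> v - wt j v)" using rep_exists[OF \<beta>] by blast
    have "ip (wt k) \<beta> = (\<Sum>i<l. of_int (k i) * ip (a i) \<beta>)" by (rule wt_ip_sum[OF R_D[OF \<beta>]])
    \<comment> \<open>\<beta> may be replaced by \<open>wt j\<close> only against a root, which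
      \<open>wt k\<close> need not be; hence the detour through the single
      \<open>a i\<close>.\<close>
    also have "\<dots> = (\<Sum>i<l. of_int (k i) * ip (a i) (wt j))"
    proof (rule sum.cong[OF refl])
      fix i assume "i \<in> {..<l}"
      then have "ip \<beta> (a i) = ip (wt j) (a i)" using rep_ip[OF R_D[OF \<beta>] j a_R] by simp
      then show "of_int (k i) * ip (a i) \<beta> = of_int (k i) * ip (a i) (wt j)"
        using ip_sym[of "a i" \<beta>] ip_sym[of "a i" "wt j"] by simp
    qed
    also have "\<dots> = ip (wt k) (wt j)" by (rule wt_ip_sum[OF wt_D, symmetric])
    also have "\<dots> = ip (wt j) (wt k)" by (rule ip_sym)
    also have "\<dots> = 0" unfolding wt_ip_sum[OF wt_D] using z by simp
    finally show ?thesis .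
  qed
  then show "rad (wt k)" unfolding in_radical_def by blast
qed

lemma pairing_diff: "pairing (\<lambda>i. k i - k' i) i = pairing k i - pairing k' i"
  unfolding pairing_def by (simp add: left_diff_distrib sum_subtractf)

lemma pairing_inj:
  assumes "supported k" "supported k'" "\<And>i. i < l \<Longrightarrow> pairing k i = pairing k' i"
  shows "k = k'"
proof -
  have "(\<lambda>i. k i - k' i) = (\<lambda>_. 0)"
    using assms by (intro pairing_zero) (auto simp: supported_def pairing_diff)
  then show ?thesis by (simp add: fun_eq_iff)
qed

text \<open>A nontrivial relation over the field becomes one over the integers by applying a
rational linear functional and clearing denominators.\<close>

lemma coroot_coefficients:
  assumes "\<And>j. j < l \<Longrightarrow> (\<Sum>i<l. c i * a j (ha i)) = 0" and "i < l"
  shows "c i = 0"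
proof (rule ccontr)
  assume ci: "c i \<noteq> 0"
  \<comment> \<open>Dividing by norms passes from coroots to roots, and the relation becomes one
    between the \<open>d i\<close> with the integer coefficients \<open>C i j\<close>. Requiring
    \<open>\<phi> (d i) = 1\<close> keeps its rational image nontrivial.\<close>
  define d where "d i = c i / ip (a i) (a i)" for i
  have "d i \<noteq> 0" using ci Rx_ip[OF a_Rx[OF assms(2)]] by (simp add: d_def)
  then obtain \<phi> :: "'k \<Rightarrow> rat" where \<phi>: "\<And>x y. \<phi> (x + y) = \<phi> x + \<phi> y"
    "\<And>q x. \<phi> (of_rat q * x) = q * \<phi> x" "\<phi> (d i) = 1" using rational_functional[of "d i"] by auto
  have \<phi>0: "\<phi> 0 = 0" using \<phi>(2)[of 0 0] by simp
  have \<phi>_sum: "\<phi> (sum f S) = (\<Sum>i\<in>S. \<phi> (f i))" for f and S :: "nat set"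
    by (induction S rule: infinite_finite_induct) (simp_all add: \<phi>(1) \<phi>0)
  have d: "(\<Sum>i<l. d i * of_int (C i j)) = 0" if j: "j < l" for j
  proof -
    have "ip (a j) (a j) * (d i * of_int (C i j)) = c i * a j (ha i)" if i: "i < l" for i
    proof -
      have "of_int (C i j) * ip (a j) (a j) = 2 * ip (a j) (a i)"
        using hv_int[OF a_Rx[OF j] a_D[OF i] C[OF j i]] ip_sym[of "a j" "a i"] by simp
      then have "ip (a j) (a j) * (d i * of_int (C i j)) = d i * (2 * ip (a j) (a i))"
        by (metis mult.commute mult.left_commute)
      also have "\<dots> = c i * a j (ha i)"
        unfolding d_def hv_eval[OF a_D[OF i] a_D[OF j]] by (simp only: times_divide_eq_left times_divide_eq_right)
      finally show ?thesis .
    qed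
    then have "ip (a j) (a j) * (\<Sum>i<l. d i * of_int (C i j)) = (\<Sum>i<l. c i * a j (ha i))"
      unfolding sum_distrib_left by (intro sum.cong[OF refl]) simp
    then show ?thesis using assms(1)[OF j] Rx_ip[OF a_Rx[OF j]] by simp
  qed
  have \<phi>d: "(\<Sum>i<l. \<phi> (d i) * of_int (C i j)) = 0" if j: "j < l" for j
  proof -
    have "\<phi> (d i * of_int (C i j)) = \<phi> (d i) * of_int (C i j)" for i
      using \<phi>(2)[of "of_int (C i j)" "d i"] by (simp add: mult.commute)
    then show ?thesis using arg_cong[OF d[OF j], of \<phi>] by (simp add: \<phi>_sum \<phi>0)
  qed
  obtain N :: int where N: "N > 0" "\<forall>i\<in>{..<l}. \<exists>z. of_int N * \<phi> (d i) = of_int z"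
    using common_denominator[OF finite_lessThan, of l "\<lambda>i. \<phi> (d i)"] by (elim exE conjE)
  obtain z where "\<forall>i\<in>{..<l}. of_int N * \<phi> (d i) = of_int (z i)"
    using bchoice[OF N(2)] by (elim exE)
  then have z: "of_int N * \<phi> (d i) = of_int (z i)" if "i < l" for i using that by simp
  define k where "k i = (if i < l then z i else 0)" for i
  have "pairing k j = 0" if j: "j < l" for j
  proof -
    have "(of_int (pairing k j) :: rat) = (\<Sum>i<l. of_int N * \<phi> (d i) * of_int (C i j))"
      unfolding pairing_def k_def by (simp add: z)
    also have "\<dots> = of_int N * (\<Sum>i<l. \<phi> (d i) * of_int (C i j))" by (simp add: sum_distrib_left mult.assoc)
    finally show ?thesis using \<phi>d[OF j] by simp
  qed
  then have "k = (\<lambda>_. 0)" by (intro pairing_zero) (auto simp: supported_def k_def)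
  from fun_cong[OF this, of i] have "z i = 0" using assms(2) by (simp add: k_def)
  then show False using z[OF assms(2)] \<phi>(3) N(1) by simp
qed

section \<open>Simple reflections and induction on coefficient vectors\<close>

definition simple_refl :: "nat \<Rightarrow> (nat \<Rightarrow> int) \<Rightarrow> nat \<Rightarrow> int" where "simple_refl i k = (\<lambda>j. k j - unit i (pairing k i) j)"

lemma wt_simple_refl: "i < l \<Longrightarrow> wt (simple_refl i k) = (\<lambda>v. wt k v - of_int (pairing k i) * a i v)"
  unfolding simple_refl_def wt_diff by (simp add: wt_unit)

lemma supported_simple_refl: "supported k \<Longrightarrow> i < l \<Longrightarrow> supported (simple_refl i k)"
  unfolding simple_refl_def supported_def unit_def by auto

lemma K_simple_refl:
  assumes k: "k \<in> K" and i: "i < l"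
  shows "simple_refl i k \<in> K"
proof -
  obtain \<alpha> where \<alpha>: "\<alpha> \<in> Rx" "supported k" "rad (\<lambda>v. \<alpha> v - wt k v)" using k unfolding K_def by blast
  have "(\<lambda>v. \<alpha> v - of_int (pairing k i) * a i v) \<in> Rx"
    by (rule reflection_Rx[OF a_Rx[OF i] \<alpha>(1) rep_ha[OF Rx_D[OF \<alpha>(1)] \<alpha>(3) i]])
  moreover have "rad (\<lambda>v. (\<alpha> v - of_int (pairing k i) * a i v) - wt (simple_refl i k) v)"
    using \<alpha>(3) by (simp add: wt_simple_refl[OF i])
  ultimately show ?thesis using supported_simple_refl[OF \<alpha>(2) i] K_I by blast
qed

lemma K_unit: "i < l \<Longrightarrow> unit i 1 \<in> K"
proof -
  assume i: "i < l"
  have "(\<lambda>v. a i v - wt (unit i 1) v) = (\<lambda>v. 0)" unfolding wt_unit[OF i] by (intro ext) simp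
  then have "rad (\<lambda>v. a i v - wt (unit i 1) v)" using rad_zero by presburger
  then show ?thesis by (rule K_I[OF a_Rx[OF i] supported_unit[OF i]])
qed

text \<open>Expanding 2(\<alpha>,\<alpha>) along \<open>k\<close> and dividing by
  (\<alpha>,\<alpha>) gives 2 as the sum of the \<open>k i * pairing k i\<close> weighted by the
  positive rationals \<open>r i\<close>; so some summand is positive.\<close>

lemma K_positive:
  assumes "k \<in> K"
  shows "\<exists>i<l. k i * pairing k i > 0"
proof (rule ccontr)
  assume neg: "\<not> ?thesis"
  obtain \<alpha> where \<alpha>: "\<alpha> \<in> Rx" "supported k" "rad (\<lambda>v. \<alpha> v - wt k v)" using assms unfolding K_def by blast
  have "\<forall>i\<in>{..<l}. \<exists>r::rat. r > 0 \<and> ip (a i) (a i) = of_rat r * ip \<alpha> \<alpha>"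
    using norm_ratio_positive[OF \<alpha>(1) a_Rx] by blast
  from bchoice[OF this] obtain r :: "nat \<Rightarrow> rat"
    where r: "\<And>i. i < l \<Longrightarrow> r i > 0" "\<And>i. i < l \<Longrightarrow> ip (a i) (a i) = of_rat (r i) * ip \<alpha> \<alpha>" by auto
  have "ip \<alpha> \<alpha> * 2 = 2 * ip (wt k) \<alpha>" using rep_ip[OF Rx_D[OF \<alpha>(1)] \<alpha>(3) Rx_R[OF \<alpha>(1)]] by simp
  also have "\<dots> = (\<Sum>i<l. of_int (k i) * (2 * ip \<alpha> (a i)))"
    unfolding wt_ip_sum[OF Rx_D[OF \<alpha>(1)]] sum_distrib_left ip_sym[of \<alpha>] by (simp add: mult.left_commute)
  also have "\<dots> = (\<Sum>i<l. ip \<alpha> \<alpha> * of_rat (of_int (k i * pairing k i) * r i))"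
  proof (rule sum.cong[OF refl])
    fix i assume "i \<in> {..<l}"
    then have i: "i < l" by simp
    have "2 * ip \<alpha> (a i) = of_int (pairing k i) * ip (a i) (a i)"
      by (rule hv_int[OF a_Rx[OF i] Rx_D[OF \<alpha>(1)] rep_ha[OF Rx_D[OF \<alpha>(1)] \<alpha>(3) i]])
    then show "of_int (k i) * (2 * ip \<alpha> (a i)) = ip \<alpha> \<alpha> * of_rat (of_int (k i * pairing k i) * r i)"
      unfolding r(2)[OF i] by (simp add: of_rat_mult)
  qed
  also have "\<dots> = ip \<alpha> \<alpha> * of_rat (\<Sum>i<l. of_int (k i * pairing k i) * r i)"
    by (simp add: of_rat_sum sum_distrib_left)
  finally have "(2 :: 'k) = of_rat (\<Sum>i<l. of_int (k i * pairing k i) * r i)"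
    using Rx_ip[OF \<alpha>(1)] by simp
  then have "of_rat 2 = (of_rat (\<Sum>i<l. of_int (k i * pairing k i) * r i) :: 'k)" by simp
  then have "2 = (\<Sum>i<l. of_int (k i * pairing k i) * r i)" by (simp only: of_rat_eq_iff)
  moreover have "(\<Sum>i<l. of_int (k i * pairing k i) * r i) \<le> 0"
  proof (rule sum_nonpos)
    fix i assume "i \<in> {..<l}"
    then have i: "i < l" by simp
    then have "\<not> 0 < k i * pairing k i" using neg by blast
    then have "k i * pairing k i \<le> 0" "r i > 0" using r(1)[OF i] by simp_all
    then show "of_int (k i * pairing k i) * r i \<le> 0"
      by (intro mult_nonpos_nonneg) (simp_all only: of_int_le_0_iff less_imp_le)
  qed
  ultimately show False by simp
qed

lemma K_induct [consumes 1, case_names unit reflect]: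
  assumes "k \<in> K"
    and unit: "\<And>i c. i < l \<Longrightarrow> c \<noteq> 0 \<Longrightarrow> unit i c \<in> K \<Longrightarrow> P (unit i c)"
    and reflect: "\<And>k i. k \<in> K \<Longrightarrow> i < l \<Longrightarrow> P (simple_refl i k) \<Longrightarrow> P k"
  shows "P k"
  using assms(1)
proof (induction "nat (\<Sum>i<l. \<bar>k i\<bar>)" arbitrary: k rule: less_induct)
  case less
  obtain i where i: "i < l" "k i * pairing k i > 0" using K_positive[OF less.prems] by blast
  have ki: "k i \<noteq> 0" using i by auto
  have sk: "supported k" using less.prems unfolding K_def by blast
  show ?case
  proof (cases "\<exists>j. j \<noteq> i \<and> k j \<noteq> 0")
    case False
    then have "k = unit i (k i)" unfolding unit_def fun_eq_iff by auto
    then show ?thesis using unit[OF i(1) ki] less.prems by metis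
  next
    case True
    then obtain j where j: "j \<noteq> i" "k j \<noteq> 0" by blast
    have s: "simple_refl i k \<in> K" by (rule K_simple_refl[OF less.prems i(1)])
    have sj: "simple_refl i k m = k m" if "m \<noteq> i" for m using that by (simp add: simple_refl_def unit_def)
    have si: "simple_refl i k i = k i - pairing k i" by (simp add: simple_refl_def unit_def)
    have "\<bar>simple_refl i k i\<bar> < \<bar>k i\<bar>"
      using K_coherent[OF less.prems] K_coherent[OF s]
    proof (elim disjE)
      assume "\<forall>i. 0 \<le> k i" "\<forall>m. 0 \<le> simple_refl i k m"
      then have "0 \<le> k i" "0 \<le> simple_refl i k i" by auto
      then show ?thesis using i(2) si by (auto simp: zero_less_mult_iff)
    next
      assume "\<forall>i. k i \<le> 0" "\<forall>m. simple_refl i k m \<le> 0"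
      then have "k i \<le> 0" "simple_refl i k i \<le> 0" by auto
      then show ?thesis using i(2) si by (auto simp: zero_less_mult_iff)
    next
      assume "\<forall>i. 0 \<le> k i" "\<forall>m. simple_refl i k m \<le> 0"
      then have "0 \<le> k j" "k j \<le> 0" using sj[OF j(1)] by metis+
      then show ?thesis using j by simp
    next
      assume "\<forall>i. k i \<le> 0" "\<forall>m. 0 \<le> simple_refl i k m"
      then have "0 \<le> k j" "k j \<le> 0" using sj[OF j(1)] by metis+
      then show ?thesis using j by simp
    qed
    then have "(\<Sum>m<l. \<bar>simple_refl i k m\<bar>) < (\<Sum>m<l. \<bar>k m\<bar>)"
      using i(1) sj by (intro sum_strict_mono_ex1) (auto, metis order_refl less_imp_le)
    moreover have "0 \<le> (\<Sum>m<l. \<bar>simple_refl i k m\<bar>)" by (rule sum_nonneg) simp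
    ultimately have "nat (\<Sum>m<l. \<bar>simple_refl i k m\<bar>) < nat (\<Sum>m<l. \<bar>k m\<bar>)" by linarith
    then have "P (simple_refl i k)" using less.hyps s by blast
    then show ?thesis using reflect[OF less.prems i(1)] by blast
  qed
qed

lemma K_pairing_bound:
  assumes "k \<in> K" and i: "i < l"
  shows "\<bar>pairing k i\<bar> < 7"
proof -
  obtain \<alpha> where \<alpha>: "\<alpha> \<in> Rx" "rad (\<lambda>v. \<alpha> v - wt k v)" using assms(1) unfolding K_def by blast
  show ?thesis by (rule cartan_integer_bound[OF \<alpha>(1) a_Rx[OF i] rep_ha[OF Rx_D[OF \<alpha>(1)] \<alpha>(2) i]])
qed

text \<open>A coefficient vector is determined by its l pairings, each of which lies between -6 and
  6.\<close>

lemma finite_K: "finite K"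
proof (rule finite_imageD)
  have "(\<lambda>k. map (pairing k) [0..<l]) ` K \<subseteq> {xs. set xs \<subseteq> {-6..6} \<and> length xs = l}"
    using K_pairing_bound by fastforce
  then show "finite ((\<lambda>k. map (pairing k) [0..<l]) ` K)"
    using finite_lists_length_eq[of "{-6..6::int}" l] finite_subset by blast
  show "inj_on (\<lambda>k. map (pairing k) [0..<l]) K"
  proof (rule inj_onI)
    fix k k' assume "k \<in> K" "k' \<in> K" "map (pairing k) [0..<l] = map (pairing k') [0..<l]"
    then show "k = k'" by (intro pairing_inj) (auto simp: K_def)
  qed
qed

section \<open>Connectedness of the Dynkin diagram\<close>

lemma l_pos: "0 < l"
proof -
  obtain \<alpha> where \<alpha>: "\<alpha> \<in> Rx" using Rx_nonempty by blast
  obtain k where "supported k" "rad (\<lambda>v. \<alpha> v - wt k v)" using rep_exists[OF Rx_R[OF \<alpha>]] by blast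
  then have "k \<in> K" by (rule K_I[OF \<alpha>])
  then show ?thesis using K_positive by fastforce
qed

lemma ip_zero_of_C: "i < l \<Longrightarrow> j < l \<Longrightarrow> C j i = 0 \<Longrightarrow> ip (a j) (a i) = 0"
  using hv_int[OF a_Rx a_D C, of i j] by simp

lemma C_zero_sym:
  assumes "i < l" "j < l" "C j i = 0" shows "C i j = 0"
proof -
  have "ip (a i) (a j) = 0" using ip_zero_of_C[OF assms] ip_sym[of "a i" "a j"] by simp
  then have "a i (ha j) = 0" using hv_eval[OF a_D[OF assms(2)] a_D[OF assms(1)]] by simp
  then show ?thesis using C[OF assms(2,1)] by simp
qed

text \<open>If i lies outside \<open>S\<close>, all terms of the i-th pairing except that of i
  itself vanish, so it equals 2 \<open>k i\<close>; but a reflected coordinate of zero says that it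
  equals \<open>k i\<close>. Hence \<open>k i = 0\<close>.\<close>

lemma reflection_support:
  assumes C0: "\<And>i j. i < l \<Longrightarrow> j < l \<Longrightarrow> j \<in> S \<Longrightarrow> i \<notin> S \<Longrightarrow> C j i = 0"
    and i: "i < l" and s: "\<And>m. simple_refl i k m \<noteq> 0 \<Longrightarrow> m \<in> S"
  shows "k m \<noteq> 0 \<Longrightarrow> m \<in> S"
proof -
  have sm: "simple_refl i k m = k m" if "m \<noteq> i" for m using that by (simp add: simple_refl_def unit_def)
  have "k i = 0" if iS: "i \<notin> S"
  proof -
    have "simple_refl i k i = 0" using s iS by blast
    then have 1: "k i = pairing k i" by (simp add: simple_refl_def unit_def)
    have "k j * C j i = (if j = i then 2 * k i else 0)" if "j < l" for j
    proof (cases "j = i")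
      case False
      then have "k j = 0 \<or> C j i = 0" using s[of j] sm[OF False] C0[OF i that _ iS] by auto
      then show ?thesis using False by auto
    qed (simp add: C_self[OF i])
    then have "pairing k i = 2 * k i" unfolding pairing_def using i by (simp add: sum.delta)
    then show ?thesis using 1 by simp
  qed
  then show "m \<in> S" if "k m \<noteq> 0" using that s[of m] sm[of m] by (cases "m = i") auto
qed

text \<open>Otherwise the roots supported in \<open>J\<close> modulo the radical and the remaining
  ones would split \<open>Rx\<close> orthogonally, against (T5a). The vanishing is assumed in one
  direction only, the one that an ideal provides.\<close>

lemma dynkin_connected:
  assumes J: "J \<subseteq> {..<l}" "J \<noteq> {}"
    and C0: "\<And>i j. i \<in> J \<Longrightarrow> j < l \<Longrightarrow> j \<notin> J \<Longrightarrow> C j i = 0"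
  shows "J = {..<l}"
proof (rule ccontr)
  assume "J \<noteq> {..<l}"
  then obtain j0 where j0: "j0 < l" "j0 \<notin> J" using J(1) by auto
  obtain i0 where i0: "i0 \<in> J" "i0 < l" using J by auto
  \<comment> \<open>Unit vectors have one-point support, and a reflection cannot leave
    \<open>J\<close> or its complement. For \<open>J\<close> itself this takes the symmetry
    \<open>C_zero_sym\<close>.\<close>
  have side: "(\<forall>m. k m \<noteq> 0 \<longrightarrow> m \<in> J) \<or> (\<forall>m. k m \<noteq> 0 \<longrightarrow> m \<in> - J)" if "k \<in> K" for k
    using that
  proof (induction rule: K_induct)
    case (unit i c)
    then show ?case by (auto simp: unit_def)
  next
    case (reflect k i)
    have 1: "C j i = 0" if "i < l" "j < l" "j \<in> J" "i \<notin> J" for i j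
      using C_zero_sym[OF that(2,1)] C0[OF that(3,1,4)] by blast
    have 2: "C j i = 0" if "i < l" "j < l" "j \<in> - J" "i \<notin> - J" for i j
      using C0[of i j] that by simp
    show ?case using reflect(3)
    proof
      assume "\<forall>m. simple_refl i k m \<noteq> 0 \<longrightarrow> m \<in> J"
      then have "k m \<noteq> 0 \<Longrightarrow> m \<in> J" for m
        by (intro reflection_support[of J i k m]) (use 1 reflect(2) in auto)
      then show ?thesis by blast
    next
      assume "\<forall>m. simple_refl i k m \<noteq> 0 \<longrightarrow> m \<in> - J"
      then have "k m \<noteq> 0 \<Longrightarrow> m \<in> - J" for m
        by (intro reflection_support[of "- J" i k m]) (use 2 reflect(2) in auto)
      then show ?thesis by blast
    qed
  qed
  let ?P = "{\<alpha> \<in> Rx. \<exists>k. supported k \<and> rad (\<lambda>v. \<alpha> v - wt k v) \<and> (\<forall>m. k m \<noteq> 0 \<longrightarrow> m \<in> J)}"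
  have rep_a: "rad (\<lambda>v. a i v - wt (unit i 1) v)" if "i < l" for i
  proof -
    have "(\<lambda>v. a i v - wt (unit i 1) v) = (\<lambda>v. 0)" unfolding wt_unit[OF that] by (intro ext) simp
    then show ?thesis using rad_zero by presburger
  qed
  have "\<forall>m. unit i0 1 m \<noteq> 0 \<longrightarrow> m \<in> J" using i0(1) by (simp add: unit_def)
  then have "a i0 \<in> ?P" using a_Rx[OF i0(2)] supported_unit[OF i0(2)] rep_a[OF i0(2)] by blast
  then have P: "?P \<noteq> {}" by blast
  have "a j0 \<notin> ?P"
  proof
    assume "a j0 \<in> ?P"
    then obtain k where k: "supported k" "rad (\<lambda>v. a j0 v - wt k v)" "\<forall>m. k m \<noteq> 0 \<longrightarrow> m \<in> J" by blast
    have "k = unit j0 1" by (rule rep_unique[OF a_D[OF j0(1)] k(1) supported_unit[OF j0(1)] k(2) rep_a[OF j0(1)]])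
    then have "k j0 \<noteq> 0" by (simp add: unit_def)
    then show False using k(3) j0 by blast
  qed
  then have Q: "Rx - ?P \<noteq> {}" using a_Rx[OF j0(1)] by blast
  show False
  proof (rule T5a[OF P Q])
    fix \<alpha> \<beta> assume al: "\<alpha> \<in> ?P" and be: "\<beta> \<in> Rx - ?P"
    then have \<beta>: "\<beta> \<in> Rx" by blast
    obtain k where k: "rad (\<lambda>v. \<alpha> v - wt k v)" "\<forall>m. k m \<noteq> 0 \<longrightarrow> m \<in> J" using al by blast
    have \<alpha>: "\<alpha> \<in> Rx" using al by blast
    obtain k' where k': "supported k'" "rad (\<lambda>v. \<beta> v - wt k' v)" using rep_exists[OF Rx_R[OF \<beta>]] by blast
    have s': "\<forall>m. k' m \<noteq> 0 \<longrightarrow> m \<in> - J" using side[OF K_I[OF \<beta> k']] be k' by blast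
    have z: "ip (wt k') (a i) = 0" if i: "i \<in> J" for i
    proof -
      have il: "i < l" using i J(1) by auto
      have "of_int (k' j) * ip (a j) (a i) = 0" if j: "j < l" for j
      proof (cases "j \<in> J")
        case True then show ?thesis using s' by fastforce
      next
        case False then show ?thesis using ip_zero_of_C[OF il j C0[OF i j]] by simp
      qed
      then show ?thesis unfolding wt_ip_sum[OF a_D[OF il]] by (intro sum.neutral ballI) simp
    qed
    have "of_int (k i) * ip (a i) \<beta> = 0" if i: "i < l" for i
    proof (cases "i \<in> J")
      case True
      have "ip \<beta> (a i) = 0" using rep_ip[OF Rx_D[OF \<beta>] k'(2) a_R[OF i]] z[OF True] by simp
      then show ?thesis using ip_sym[of "a i" \<beta>] by simp
    next
      case False then show ?thesis using k(2) by fastforce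
    qed
    then have "ip (wt k) \<beta> = 0" unfolding wt_ip_sum[OF Rx_D[OF \<beta>]] by (intro sum.neutral ballI) simp
    then show "ip \<alpha> \<beta> = 0" using rep_ip[OF Rx_D[OF \<alpha>] k(1) Rx_R[OF \<beta>]] by simp
  qed blast+
qed

text \<open>An isotropic \<open>wt k\<close> would lie in the radical and force \<open>k\<close> to
  be zero. This puts the nonzero weights of actual vectors into the finite set
  \<open>K\<close>.\<close>

lemma R_wt:
  assumes "wt k \<in> R" "supported k" "k \<noteq> (\<lambda>_. 0)"
  shows "k \<in> K"
proof -
  have "wt k \<notin> R0" using R0_rad rad_wt_0 assms(2,3) by blast
  then have x: "wt k \<in> Rx" using R_cases assms(1) by blast
  have "rad (\<lambda>v. wt k v - wt k v)" using rad_zero by simp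
  then show ?thesis using K_I[OF x assms(2)] by blast
qed

lemma wt_inj: "supported k \<Longrightarrow> supported k' \<Longrightarrow> wt k = wt k' \<Longrightarrow> k = k'"
  by (rule pairing_inj) (metis wt_ha of_int_eq_iff)+

end

section \<open>The subalgebra generated by the simple root vectors\<close>

text \<open>Right nesting makes the bracket of a generator with a word a word again. The value 0 of
  the empty word is a default; words are taken nonempty where they span.\<close>

fun bracket_word :: "('v \<Rightarrow> 'v \<Rightarrow> 'v) \<Rightarrow> (nat \<Rightarrow> 'v) \<Rightarrow> nat list \<Rightarrow> 'v::zero" where
  "bracket_word br x [] = 0"
| "bracket_word br x (i # is) = (if is = [] then x i else br (x i) (bracket_word br x is))"

locale generated = base_setup sc br B H l a
  for sc :: "'k::field_char_0 \<Rightarrow> 'v::ab_group_add \<Rightarrow> 'v" (infixr "*s" 75) and br B H l a +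
  fixes ep em :: "nat \<Rightarrow> 'v"
  assumes ep: "i < l \<Longrightarrow> ep i \<in> W H (a i)"
    and em: "i < l \<Longrightarrow> em i \<in> W H (\<lambda>v. - a i v)"
    and ep_em: "i < l \<Longrightarrow> br (ep i) (em i) = ha i"
begin

abbreviation "hs \<equiv> span (hvec sc B H ` a ` {..<l})"
abbreviation "g \<equiv> gen_subalgebra sc br (ep ` {..<l} \<union> em ` {..<l})"

text \<open>The Boolean is the sign of the root, so raising and lowering arguments are carried out
  once, with \<open>\<not> b\<close> for the opposite sign.\<close>

definition X :: "bool \<Rightarrow> nat \<Rightarrow> 'v" where "X b = (if b then ep else em)"
definition sgn_of :: "bool \<Rightarrow> int" where "sgn_of b = (if b then 1 else -1)"
definition content :: "nat list \<Rightarrow> nat \<Rightarrow> int" where "content is j = int (count_list is j)"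
text \<open>Spanning vectors paired with their degrees: a vector may be zero, so its degree cannot be read off.\<close>

definition graded_words :: "((nat \<Rightarrow> int) \<times> 'v) set" where
  "graded_words = (\<lambda>i. (\<lambda>_. 0, ha i)) ` {..<l} \<union>
        {(\<lambda>j. sgn_of b * content is j, bracket_word br (X b) is) | b is. is \<noteq> [] \<and> set is \<subseteq> {..<l}}"

lemma X_W: "i < l \<Longrightarrow> X b i \<in> W H (wt (unit i (sgn_of b)))"
  using ep em by (simp add: X_def sgn_of_def wt_unit)

lemma ha_H: "i < l \<Longrightarrow> ha i \<in> H"
  using hv_H a_D by blast

lemma hs_H: "hs \<subseteq> H"
  by (rule span_minimal[OF _ subspace_H]) (auto intro: ha_H)

lemma X_X_same: "i < l \<Longrightarrow> br (X (\<not> b) i) (X b i) = (- of_int (sgn_of b)) *s ha i"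
  using ep_em[of i] br_anti[of "em i" "ep i"] by (simp add: X_def sgn_of_def)

text \<open>The bracket would have a weight whose coefficients at i and j have opposite signs, which
  sign coherence forbids.\<close>

lemma X_X_other:
  assumes ij: "i < l" "j < l" "i \<noteq> j"
  shows "br (X (\<not> b) i) (X b j) = 0"
proof (rule ccontr)
  assume nz: "br (X (\<not> b) i) (X b j) \<noteq> 0"
  define k where "k = (\<lambda>m. unit i (sgn_of (\<not> b)) m + unit j (sgn_of b) m)"
  have "br (X (\<not> b) i) (X b j) \<in> W H (\<lambda>v. wt (unit i (sgn_of (\<not> b))) v + wt (unit j (sgn_of b)) v)"
    by (rule W_br[OF X_W[OF ij(1)] X_W[OF ij(2)]])
  then have "br (X (\<not> b) i) (X b j) \<in> W H (wt k)" unfolding k_def wt_add .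
  then have "wt k \<in> R" by (rule R_I[OF wt_D _ nz])
  moreover have "supported k" using ij(1,2) by (simp add: supported_def unit_def k_def)
  moreover have ki: "k i = sgn_of (\<not> b)" and kj: "k j = sgn_of b" using ij by (simp_all add: k_def unit_def)
  from ki have "k \<noteq> (\<lambda>_. 0)" by (auto simp: sgn_of_def split: if_splits)
  ultimately have "k \<in> K" by (rule R_wt)
  from K_coherent[OF this] have "0 \<le> k i \<and> 0 \<le> k j \<or> k i \<le> 0 \<and> k j \<le> 0" by auto
  then show False unfolding ki kj by (cases b) (simp_all add: sgn_of_def)
qed

lemma ha_nonzero: "i < l \<Longrightarrow> ha i \<noteq> 0"
  using hv_self[OF a_Rx, of i] dual_zero[OF a_D, of i] by auto

lemma X_nonzero: "i < l \<Longrightarrow> X b i \<noteq> 0"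
  using X_X_same[of i b] ha_nonzero[of i] by (cases b) (auto simp: sgn_of_def)

lemma content_Cons: "content (i # is) = (\<lambda>j. unit i 1 j + content is j)"
  by (auto simp: content_def unit_def)

lemma bracket_word_W: "is \<noteq> [] \<Longrightarrow> set is \<subseteq> {..<l} \<Longrightarrow> bracket_word br (X b) is \<in> W H (wt (\<lambda>j. sgn_of b * content is j))"
proof (induction "is")
  case (Cons i "is")
  then have i: "i < l" by simp
  have e: "(\<lambda>j. sgn_of b * content (i # is) j) = (\<lambda>j. unit i (sgn_of b) j + sgn_of b * content is j)"
    by (auto simp: content_Cons unit_def algebra_simps)
  show ?case
  proof (cases "is = []")
    case True
    then have "(\<lambda>j. sgn_of b * content (i # is) j) = unit i (sgn_of b)" by (auto simp: content_def unit_def)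
    then show ?thesis using True X_W[OF i] by simp
  next
    case False
    then have "bracket_word br (X b) is \<in> W H (wt (\<lambda>j. sgn_of b * content is j))" using Cons by simp
    then have "br (X b i) (bracket_word br (X b) is) \<in> W H (wt (\<lambda>j. sgn_of b * content (i # is) j))"
      unfolding e wt_add by (rule W_br[OF X_W[OF i]])
    then show ?thesis using False by simp
  qed
qed simp

lemma ha_W: "i < l \<Longrightarrow> ha i \<in> W H (wt (\<lambda>_. 0))"
  using W_br[OF ep em, of i i] ep_em[of i] by (simp add: wt_zero)

lemma graded_words_W: "(k, t) \<in> graded_words \<Longrightarrow> t \<in> W H (wt k)"
  unfolding graded_words_def by (elim UnE) (auto intro: ha_W bracket_word_W)

lemma graded_words_supported: "(k, t) \<in> graded_words \<Longrightarrow> supported k"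
  unfolding graded_words_def supported_def content_def by (auto simp: count_list_0_iff)

text \<open>One sign of words together with the coroots, which are needed because an opposite
  generator sends a one-letter word to a multiple of a coroot.\<close>

definition borel :: "bool \<Rightarrow> 'v set" where
  "borel b = span (hvec sc B H ` a ` {..<l} \<union> {bracket_word br (X b) is | is. is \<noteq> [] \<and> set is \<subseteq> {..<l}})"

lemma borel_bracket_word: "is \<noteq> [] \<Longrightarrow> set is \<subseteq> {..<l} \<Longrightarrow> bracket_word br (X b) is \<in> borel b"
  unfolding borel_def by (rule span_base) blast

lemma borel_ha: "i < l \<Longrightarrow> ha i \<in> borel b"
  unfolding borel_def by (rule span_base) blast

lemma subspace_borel: "subspace (borel b)"
  unfolding borel_def by (rule subspace_span)

lemma X_ha: "i < l \<Longrightarrow> j < l \<Longrightarrow> br (X b i) (ha j) = (- wt (unit i (sgn_of b)) (ha j)) *s X b i"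
  using W_D[OF X_W ha_H, of i j b] br_anti[of "X b i" "ha j"] by simp

lemma borel_X:
  assumes "x \<in> borel b" "i < l" shows "br (X b i) x \<in> borel b"
  using assms(1) unfolding borel_def[of b]
proof (induction rule: span_induct_alt)
  case base
  then show ?case using subspace_0[OF subspace_borel] unfolding borel_def by simp
next
  case (step c x y)
  have "br (X b i) x \<in> borel b" using step(1)
  proof
    assume "x \<in> hvec sc B H ` a ` {..<l}"
    then obtain j where j: "j < l" "x = ha j" by auto
    have "X b i \<in> borel b" using borel_bracket_word[of "[i]" b] assms(2) by simp
    then show ?thesis unfolding j(2) X_ha[OF assms(2) j(1)] by (rule subspace_scale[OF subspace_borel])
  next
    assume "x \<in> {bracket_word br (X b) is | is. is \<noteq> [] \<and> set is \<subseteq> {..<l}}"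
    then obtain "is" where "is \<noteq> []" "set is \<subseteq> {..<l}" "x = bracket_word br (X b) is" by blast
    then show ?thesis using borel_bracket_word[of "i # is" b] assms(2) by simp
  qed
  then have "c *s br (X b i) x + br (X b i) y \<in> borel b"
    using step(2) subspace_borel unfolding borel_def[symmetric] by (intro subspace_add subspace_scale)
  then show ?case unfolding borel_def[symmetric] by (simp add: br_add_right br_scale_right)
qed

text \<open>Move the opposite generator past the first letter by the Leibniz rule: the bracket of
  the two letters is a multiple of \<open>ha i\<close>, which acts on the remaining word by a
  scalar, and the other term is handled by induction. A coroot in place of the word would lead to a
  multiple of \<open>X (\<not> b) i\<close>, hence the restriction to words.\<close>

lemma borel_X_opposite:
  "is \<noteq> [] \<Longrightarrow> set is \<subseteq> {..<l} \<Longrightarrow> i < l \<Longrightarrow> br (X (\<not> b) i) (bracket_word br (X b) is) \<in> borel b"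
proof (induction "is")
  case (Cons j "is")
  then have j: "j < l" by simp
  have "\<exists>c. br (X (\<not> b) i) (X b j) = c *s ha i"
  proof (cases "i = j")
    case True
    then show ?thesis using X_X_same[OF j] by blast
  next
    case False
    then have "br (X (\<not> b) i) (X b j) = 0 *s ha i" using X_X_other[OF Cons.prems(3) j] by simp
    then show ?thesis by (rule exI)
  qed
  then obtain c where c: "br (X (\<not> b) i) (X b j) = c *s ha i" by (rule exE)
  show ?case
  proof (cases "is = []")
    case True
    have "c *s ha i \<in> borel b" by (rule subspace_scale[OF subspace_borel borel_ha[OF Cons.prems(3)]])
    then show ?thesis using True c by simp
  next
    case False
    let ?w = "bracket_word br (X b) is"
    have is': "set is \<subseteq> {..<l}" using Cons.prems by simp
    have "br (c *s ha i) ?w = (c * wt (\<lambda>j. sgn_of b * content is j) (ha i)) *s ?w"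
      using W_D[OF bracket_word_W[OF False is'] ha_H[OF Cons.prems(3)]] by (simp add: br_scale_left)
    then have "br (c *s ha i) ?w \<in> borel b"
      using subspace_scale[OF subspace_borel borel_bracket_word[OF False is']] by metis
    moreover have "br (X b j) (br (X (\<not> b) i) ?w) \<in> borel b"
      by (rule borel_X[OF Cons.IH[OF False is' Cons.prems(3)] j])
    ultimately have "br (X (\<not> b) i) (br (X b j) ?w) \<in> borel b"
      unfolding br_derivation[of "X (\<not> b) i" "X b j" ?w] c by (rule subspace_add[OF subspace_borel])
    then show ?thesis using False by simp
  qed
qed simp

lemma graded_words_bracket_word:
  assumes "is \<noteq> []" "set is \<subseteq> {..<l}" shows "bracket_word br (X b) is \<in> snd ` graded_words"
proof (rule image_eqI)
  show "(\<lambda>j. sgn_of b * content is j, bracket_word br (X b) is) \<in> graded_words" unfolding graded_words_def using assms by blast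
qed simp

lemma graded_words_ha:
  assumes "i < l" shows "ha i \<in> snd ` graded_words"
proof (rule image_eqI)
  show "(\<lambda>_. 0, ha i) \<in> graded_words" unfolding graded_words_def using assms by blast
qed simp

lemma borel_graded_words: "borel b \<subseteq> span (snd ` graded_words)"
  unfolding borel_def by (rule span_mono) (use graded_words_ha graded_words_bracket_word in blast)

lemma graded_words_X:
  assumes "x \<in> span (snd ` graded_words)" "i < l"
  shows "br (X b i) x \<in> span (snd ` graded_words)"
  using assms(1)
proof (induction rule: span_induct_alt)
  case base
  then show ?case using span_zero by simp
next
  case (step c x y)
  have "br (X b i) x \<in> span (snd ` graded_words)"
  proof -
    obtain k where "(k, x) \<in> graded_words" using step(1) by auto
    then consider j where "j < l" "x = ha j" | b' "is" where "is \<noteq> []" "set is \<subseteq> {..<l}" "x = bracket_word br (X b') is"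
      unfolding graded_words_def by blast
    then show ?thesis
    proof cases
      case 1
      then show ?thesis using borel_X[OF borel_ha[OF 1(1)] assms(2), of b] borel_graded_words by blast
    next
      case 2
      then show ?thesis
      proof (cases "b' = b")
        case True
        then show ?thesis using 2(3) borel_X[OF borel_bracket_word[OF 2(1,2)] assms(2)] borel_graded_words by blast
      next
        case False
        then have "b = (\<not> b')" by auto
        then show ?thesis using 2(3) borel_X_opposite[OF 2(1,2) assms(2)] borel_graded_words by blast
      qed
    qed
  qed
  then have "c *s br (X b i) x + br (X b i) y \<in> span (snd ` graded_words)"
    using step(2) by (intro span_add span_scale)
  then show ?case by (simp add: br_add_right br_scale_right)
qed

section \<open>The generated subalgebra as a span of coroots and words\<close>

lemma subspace_g: "subspace g" and g_br: "x \<in> g \<Longrightarrow> y \<in> g \<Longrightarrow> br x y \<in> g"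
  using gen_subalgebra_subalgebra[of "ep ` {..<l} \<union> em ` {..<l}"] unfolding lie_subalgebra_def by simp_all

lemma X_g: "i < l \<Longrightarrow> X b i \<in> g"
  using gen_subalgebra_superset[of "ep ` {..<l} \<union> em ` {..<l}"] unfolding X_def by auto

lemma bracket_word_g: "is \<noteq> [] \<Longrightarrow> set is \<subseteq> {..<l} \<Longrightarrow> bracket_word br (X b) is \<in> g"
  by (induction "is") (simp_all add: X_g g_br)

lemma ha_g: "i < l \<Longrightarrow> ha i \<in> g"
  using g_br[OF X_g[of i True] X_g[of i False]] ep_em by (simp add: X_def)

lemma graded_words_g: "snd ` graded_words \<subseteq> g"
proof
  fix t assume "t \<in> snd ` graded_words"
  then obtain k where "(k, t) \<in> graded_words" by auto
  then show "t \<in> g" unfolding graded_words_def by (elim UnE) (auto simp: ha_g bracket_word_g)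
qed

text \<open>By the Jacobi identity the elements whose adjoint map preserves the span form a
  subalgebra. It contains the generators, hence \<open>g\<close>; so the span is itself closed under
  brackets.\<close>

lemma g_eq_span: "g = span (snd ` graded_words)"
proof
  let ?S = "span (snd ` graded_words)"
  show Sg: "?S \<subseteq> g" by (rule span_minimal[OF graded_words_g subspace_g])
  let ?U = "{x. \<forall>y\<in>?S. br x y \<in> ?S}"
  have "subspace ?U"
    by (rule subspaceI) (simp_all add: br_add_left br_scale_left span_zero span_add span_scale)
  then have "lie_subalgebra sc br ?U" unfolding lie_subalgebra_def
    by (simp add: br_br_left span_diff)
  moreover have "X b i \<in> ?U" if "i < l" for b i using graded_words_X that by simp
  from this[of _ True] this[of _ False] have "ep ` {..<l} \<union> em ` {..<l} \<subseteq> ?U"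
    unfolding X_def by (simp add: image_subset_iff)
  ultimately have "g \<subseteq> ?U" by (rule gen_subalgebra_least)
  then have "br x y \<in> ?S" if "x \<in> ?S" "y \<in> ?S" for x y using that Sg by blast
  then have "lie_subalgebra sc br ?S" unfolding lie_subalgebra_def using subspace_span by simp
  moreover have "X b i \<in> ?S" if "i < l" for b i
    using graded_words_bracket_word[of "[i]" b] that by (simp add: span_base)
  from this[of _ True] this[of _ False] have "ep ` {..<l} \<union> em ` {..<l} \<subseteq> ?S"
    unfolding X_def by (simp add: image_subset_iff)
  ultimately show "g \<subseteq> ?S" by (rule gen_subalgebra_least)
qed

section \<open>Weights of the generated subalgebra with respect to the coroots\<close>

lemma hs_g: "hs \<subseteq> g"
  by (rule span_minimal[OF _ subspace_g]) (auto simp: ha_g)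

lemma ha_hs: "i < l \<Longrightarrow> ha i \<in> hs"
  by (rule span_base) simp

lemma hs_W0:
  assumes "x \<in> hs" shows "x \<in> W H (wt (\<lambda>_. 0))"
proof -
  have "hs \<subseteq> W H (wt (\<lambda>_. 0))"
    by (rule span_minimal[OF _ subspace_W]) (auto simp: ha_W)
  then show ?thesis using assms by (rule subsetD)
qed

lemma hs_commute:
  assumes "x \<in> hs" "y \<in> hs" shows "br x y = 0"
proof -
  have "x \<in> H" using assms(1) hs_H by (rule subsetD[rotated])
  then show ?thesis using W_D[OF hs_W0[OF assms(2)], of x] by (simp add: wt_zero)
qed

text \<open>Injectivity of the pairings: the coroots already distinguish the weights of
  \<open>g\<close>, so \<open>hs\<close> can take over the role of \<open>H\<close>.\<close>

lemma separation:
  assumes "supported k" "supported k'" "k \<noteq> k'"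
  shows "\<exists>h\<in>hs. wt k h \<noteq> wt k' h"
proof (rule ccontr)
  assume n: "\<not> ?thesis"
  have "pairing k i = pairing k' i" if i: "i < l" for i
  proof -
    have "wt k (ha i) = wt k' (ha i)" using n ha_hs[OF i] by blast
    then show ?thesis by (simp add: wt_ha[OF i])
  qed
  then show False using pairing_inj[OF assms(1,2)] assms(3) by simp
qed

lemma W_hs: "x \<in> W H \<alpha> \<Longrightarrow> x \<in> W hs \<alpha>"
  by (rule W_mono[OF _ hs_H])

lemma span_graded_words_W: "x \<in> span {t. (k, t) \<in> graded_words} \<Longrightarrow> x \<in> W H (wt k)"
  by (erule span_subspace_induct[OF _ subspace_W]) (simp add: graded_words_W)

lemma span_graded_words_g: "x \<in> span {t. (k, t) \<in> graded_words} \<Longrightarrow> x \<in> g"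
  unfolding g_eq_span by (erule subsetD[OF span_mono, rotated]) force

lemma g_decomp:
  assumes "x \<in> g"
  obtains S f where "finite S" "\<And>k. k \<in> S \<Longrightarrow> supported k" "\<And>k. k \<in> S \<Longrightarrow> f k \<in> span {t. (k, t) \<in> graded_words}"
    "x = sum f S"
proof -
  have "x \<in> span (snd ` graded_words)" using assms unfolding g_eq_span .
  then obtain S f where S: "finite S" "S \<subseteq> fst ` graded_words" "\<forall>k\<in>S. f k \<in> span {t. (k, t) \<in> graded_words}" "x = sum f S"
    using span_weight_decomp[of x graded_words] by auto
  have "supported k" if "k \<in> S" for k using subsetD[OF S(2) that] graded_words_supported by auto
  then show ?thesis using that S by metis
qed

lemma components_stable:
  assumes S: "finite S" "\<And>k. k \<in> S \<Longrightarrow> supported k" "\<And>k. k \<in> S \<Longrightarrow> f k \<in> W hs (wt k)"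
    and M: "subspace M" "\<And>h x. h \<in> hs \<Longrightarrow> x \<in> M \<Longrightarrow> br h x \<in> M"
    and "sum f S \<in> M" "k \<in> S"
  shows "f k \<in> M"
  using S(1,3) separation[OF S(2) S(2)] M assms(6,7) by (rule weight_components[where \<omega> = wt])

text \<open>Here \<alpha> is an arbitrary function. Every nonzero graded component of
  \<open>x\<close> must have weight \<alpha> on \<open>hs\<close>, and by \<open>separation\<close>
  only one degree can do so.\<close>

lemma g_weight:
  assumes x: "x \<in> g" "x \<in> W hs \<alpha>" "x \<noteq> 0"
  obtains k where "supported k" "\<And>h. h \<in> hs \<Longrightarrow> \<alpha> h = wt k h" "x \<in> span {t. (k, t) \<in> graded_words}"
proof -
  obtain S f where S: "finite S" "\<And>k. k \<in> S \<Longrightarrow> supported k" "\<And>k. k \<in> S \<Longrightarrow> f k \<in> span {t. (k, t) \<in> graded_words}"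
    "x = sum f S" using g_decomp[OF x(1)] by blast
  have fW: "f k \<in> W hs (wt k)" if "k \<in> S" for k using W_hs[OF span_graded_words_W[OF S(3)[OF that]]] .
  have eq: "\<alpha> h = wt k h" if k: "k \<in> S" "f k \<noteq> 0" and h: "h \<in> hs" for k h
  proof -
    let ?f = "\<lambda>k. (wt k h - \<alpha> h) *s f k"
    have "br h x = (\<Sum>k\<in>S. wt k h *s f k)"
      unfolding S(4) br_sum_right by (rule sum.cong[OF refl]) (rule W_D[OF fW h])
    moreover have "br h x = \<alpha> h *s x" by (rule W_D[OF x(2) h])
    ultimately have "sum ?f S = 0"
      by (simp add: S(4) scale_left_diff_distrib sum_subtractf scale_sum_right)
    then have "sum ?f S \<in> {0}" by simp
    then have "?f k \<in> {0}"
      by (intro components_stable[of S ?f "{0}" k])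
        (use S(1,2) k fW subspace_scale[OF subspace_W] in auto)
    then show ?thesis using k(2) by simp
  qed
  obtain k where k: "k \<in> S" "f k \<noteq> 0" using x(3) S(4) sum.neutral by metis
  have "f j = 0" if j: "j \<in> S" "j \<noteq> k" for j
  proof (rule ccontr)
    assume "f j \<noteq> 0"
    then have "wt j h = wt k h" if "h \<in> hs" for h using eq[OF j(1) _ that] eq[OF k that] by simp
    then show False using separation[OF S(2)[OF j(1)] S(2)[OF k(1)] j(2)] by blast
  qed
  then have "sum f S = (\<Sum>j\<in>S. if j = k then f k else 0)" by (intro sum.cong) auto
  then have "x = f k" using S(1,4) k(1) by simp
  then show ?thesis using that[OF S(2)[OF k(1)] eq[OF k]] S(3)[OF k(1)] by simp
qed

lemma g_weight_wt:
  assumes x: "x \<in> g" "x \<in> W hs (wt k)" and k: "supported k"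
  shows "x \<in> span {t. (k, t) \<in> graded_words}"
proof (cases "x = 0")
  case True
  then show ?thesis using span_zero by simp
next
  case False
  obtain k' where k': "supported k'" "\<And>h. h \<in> hs \<Longrightarrow> wt k h = wt k' h" "x \<in> span {t. (k', t) \<in> graded_words}"
    using g_weight[OF x False] by blast
  then have "k = k'" using separation[OF k k'(1)] by blast
  then show ?thesis using k' by simp
qed

lemma sgn_of_cases: "sgn_of b = 1 \<or> sgn_of b = -1"
  by (simp add: sgn_of_def)

lemma content_nonzero: "is \<noteq> [] \<Longrightarrow> (\<lambda>j. sgn_of b * content is j) \<noteq> (\<lambda>_. 0)"
proof
  assume "is \<noteq> []" and z: "(\<lambda>j. sgn_of b * content is j) = (\<lambda>_. 0)"
  have "count_list is (hd is) \<noteq> 0" using \<open>is \<noteq> []\<close> by (simp add: count_list_0_iff)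
  then show False using fun_cong[OF z, of "hd is"] sgn_of_cases[of b] by (auto simp: content_def)
qed

text \<open>The letters of a word all have the same sign, so no word has degree zero and only the
  coroots remain.\<close>

lemma g_zero_weight:
  assumes "x \<in> span {t. ((\<lambda>_. 0), t) \<in> graded_words}" shows "x \<in> hs"
proof -
  have "{t. ((\<lambda>_. 0), t) \<in> graded_words} \<subseteq> hs"
  proof
    fix t assume "t \<in> {t. ((\<lambda>_. 0), t) \<in> graded_words}"
    then have "((\<lambda>_. 0), t) \<in> graded_words" by simp
    then show "t \<in> hs" unfolding graded_words_def
    proof
      assume "(\<lambda>_. 0, t) \<in> (\<lambda>i. (\<lambda>_. 0, ha i)) ` {..<l}"
      then show ?thesis using ha_hs by auto
    next
      assume "(\<lambda>_. 0, t) \<in> {(\<lambda>j. sgn_of b * content is j, bracket_word br (X b) is) | b is. is \<noteq> [] \<and> set is \<subseteq> {..<l}}"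
      then obtain b "is" where "is \<noteq> []" "(\<lambda>_. 0) = (\<lambda>j. sgn_of b * content is j)" by blast
      then show ?thesis using content_nonzero[of "is" b] by simp
    qed
  qed
  then show ?thesis using assms span_minimal[OF _ subspace_span] by blast
qed

lemma bracket_word_replicate: "n \<noteq> 0 \<Longrightarrow> n \<noteq> 1 \<Longrightarrow> bracket_word br x (replicate n i) = 0"
proof (induction n)
  case (Suc n)
  then obtain m where m: "n = Suc m" using not0_implies_Suc by auto
  show ?case
  proof (cases "m = 0")
    case True
    then show ?thesis using m by (simp add: br_self)
  next
    case False
    then have "bracket_word br x (replicate n i) = 0" using Suc.IH m by simp
    then show ?thesis using m by simp
  qed
qed simp

text \<open>A word of degree c times the i-th unit vector repeats the letter i, and such a word
  vanishes beyond length one. Thus the weight spaces of \<open>g\<close> along a simple root are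
  known without any Serre relation.\<close>

lemma g_simple_weight:
  assumes x: "x \<in> span {t. (unit i c, t) \<in> graded_words}" "x \<noteq> 0" and c: "c \<noteq> 0"
  shows "\<exists>b s. c = sgn_of b \<and> x = s *s X b i"
proof -
  have t: "t = 0 \<or> (\<exists>b. c = sgn_of b \<and> t = X b i)" if "(unit i c, t) \<in> graded_words" for t
    using that unfolding graded_words_def
  proof
    assume "(unit i c, t) \<in> (\<lambda>i. (\<lambda>_. 0, ha i)) ` {..<l}"
    then have "unit i c = (\<lambda>_. 0)" by auto
    from fun_cong[OF this, of i] show ?thesis using c by (simp add: unit_def)
  next
    assume "(unit i c, t) \<in> {(\<lambda>j. sgn_of b * content is j, bracket_word br (X b) is) | b is. is \<noteq> [] \<and> set is \<subseteq> {..<l}}"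
    then obtain b "is" where is': "is \<noteq> []" and u: "unit i c = (\<lambda>j. sgn_of b * content is j)" and tw: "t = bracket_word br (X b) is" by blast
    have "j = i" if "j \<in> set is" for j
    proof (rule ccontr)
      assume "j \<noteq> i"
      then have "sgn_of b * content is j = 0" using fun_cong[OF u, of j] by (simp add: unit_def)
      then have "count_list is j = 0" using sgn_of_cases[of b] by (auto simp: content_def)
      then show False using that by (simp add: count_list_0_iff)
    qed
    then have r: "replicate (length is) i = is" by (intro replicate_length_same) auto
    show ?thesis
    proof (cases "length is = 1")
      case True
      then have i1: "is = [i]" using r by (metis One_nat_def replicate_0 replicate_Suc)
      then have "c = sgn_of b" using fun_cong[OF u, of i] by (simp add: unit_def content_def)
      then show ?thesis using tw i1 by auto
    next
      case False
      have "bracket_word br (X b) (replicate (length is) i) = 0" by (rule bracket_word_replicate) (use is' False in simp_all)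
      then show ?thesis using tw r by simp
    qed
  qed
  have "\<exists>b. c = sgn_of b"
  proof (rule ccontr)
    assume "\<not> ?thesis"
    then have "{t. (unit i c, t) \<in> graded_words} \<subseteq> {0}" using t by blast
    then have "x \<in> {0}" using x(1) span_minimal[OF _ subspace_single_0] by blast
    then show False using x(2) by simp
  qed
  then obtain b where b: "c = sgn_of b" by blast
  have "b' = b" if "c = sgn_of b'" for b' using that b by (auto simp: sgn_of_def split: if_splits)
  then have "{t. (unit i c, t) \<in> graded_words} \<subseteq> span {X b i}"
    using t span_base[of "X b i" "{X b i}"] span_zero[of "{X b i}"] by fastforce
  then have "x \<in> span {X b i}" using x(1) span_minimal[OF _ subspace_span] by blast
  then obtain s where "x = s *s X b i" by (auto simp: span_singleton)
  then show ?thesis using b by blast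
qed

definition \<Phi> :: "'v set \<Rightarrow> (nat \<Rightarrow> int) set" where
  "\<Phi> M = {k. supported k \<and> (\<exists>x\<in>M. x \<noteq> 0 \<and> x \<in> W H (wt k))}"

text \<open>The reflected weight is the member j = n of the string. \<open>M\<close> is merely
  stable under the generators, so both \<open>g\<close> and its ideals qualify.\<close>

lemma \<Phi>_simple_refl:
  assumes M: "0 \<in> M" "\<And>b i x. i < l \<Longrightarrow> x \<in> M \<Longrightarrow> br (X b i) x \<in> M"
    and k: "k \<in> \<Phi> M" and i: "i < l"
  shows "simple_refl i k \<in> \<Phi> M"
proof -
  obtain x where x: "x \<in> M" "x \<in> W H (wt k)" "x \<noteq> 0" and sk: "supported k" using k unfolding \<Phi>_def by auto
  have Me: "br (ep i) y \<in> M" "br (em i) y \<in> M" if "y \<in> M" for y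
    using M(2)[OF i that, of True] M(2)[OF i that, of False] by (simp_all add: X_def)
  have "\<exists>n::int. wt k (ha i) = of_int n \<and> (\<forall>j::int. (0 \<le> j \<and> j \<le> n) \<or> (n \<le> j \<and> j \<le> 0) \<longrightarrow>
           M \<inter> W H (\<lambda>v. wt k v - of_int j * a i v) \<noteq> {0})"
    by (rule root_string_stable[where M = M, OF a_Rx[OF i] ep[OF i] em[OF i] ep_em[OF i] _ _ x]) (erule Me)+
  then obtain n :: int where n: "wt k (ha i) = of_int n" "\<forall>j::int. (0 \<le> j \<and> j \<le> n) \<or> (n \<le> j \<and> j \<le> 0) \<longrightarrow>
           M \<inter> W H (\<lambda>v. wt k v - of_int j * a i v) \<noteq> {0}" by (elim exE conjE)
  have "n = pairing k i" using n(1) wt_ha[OF i, of k] by simp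
  moreover have "M \<inter> W H (\<lambda>v. wt k v - of_int n * a i v) \<noteq> {0}"
    by (rule n(2)[THEN spec, of n, THEN mp]) linarith
  ultimately have "M \<inter> W H (wt (simple_refl i k)) \<noteq> {0}" unfolding wt_simple_refl[OF i] by simp
  moreover have "0 \<in> M \<inter> W H (wt (simple_refl i k))" using M(1) subspace_0[OF subspace_W] by simp
  ultimately obtain y where "y \<in> M" "y \<in> W H (wt (simple_refl i k))" "y \<noteq> 0" by blast
  then show ?thesis unfolding \<Phi>_def using supported_simple_refl[OF sk i] by blast
qed

lemma \<Phi>_g_simple_refl: "k \<in> \<Phi> g \<Longrightarrow> i < l \<Longrightarrow> simple_refl i k \<in> \<Phi> g"
  by (rule \<Phi>_simple_refl[OF subspace_0[OF subspace_g]]) (auto intro: g_br X_g)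

lemma \<Phi>_K:
  assumes "k \<in> \<Phi> M" "k \<noteq> (\<lambda>_. 0)" shows "k \<in> K"
proof -
  obtain x where "x \<noteq> 0" "x \<in> W H (wt k)" "supported k" using assms(1) unfolding \<Phi>_def by auto
  then show ?thesis using R_wt[OF R_I[OF wt_D] _ assms(2)] by blast
qed

lemma X_\<Phi>: "i < l \<Longrightarrow> unit i (sgn_of b) \<in> \<Phi> g"
  unfolding \<Phi>_def using X_W[of i b] X_g[of i b] X_nonzero[of i b] supported_unit[of i] by blast

lemma \<Phi>_unit:
  assumes "unit i c \<in> \<Phi> M" "M \<subseteq> g" "c \<noteq> 0" "i < l"
  obtains b x s where "c = sgn_of b" "x \<in> M" "x \<noteq> 0" "x = s *s X b i"
proof -
  obtain x where x: "x \<in> M" "x \<noteq> 0" "x \<in> W H (wt (unit i c))" using assms(1) unfolding \<Phi>_def by auto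
  have "x \<in> g" using assms(2) x(1) by (rule subsetD)
  then have "x \<in> span {t. (unit i c, t) \<in> graded_words}" by (rule g_weight_wt[OF _ W_hs[OF x(3)] supported_unit[OF assms(4)]])
  then show ?thesis using g_simple_weight[OF _ x(2) assms(3)] that x(1,2) by blast
qed

section \<open>Reduced roots as weights of the generated subalgebra\<close>

lemma pairing_unit: "i < l \<Longrightarrow> pairing (unit i c) i = 2 * c"
proof -
  assume i: "i < l"
  have "unit i c j * C j i = (if j = i then 2 * c else 0)" for j using C_self[OF i] by (simp add: unit_def)
  then show ?thesis unfolding pairing_def using i by (simp add: sum.delta)
qed

lemma simple_refl_scale: "simple_refl i (\<lambda>j. c * k j) = (\<lambda>j. c * simple_refl i k j)"
proof -
  have "pairing (\<lambda>j. c * k j) i = c * pairing k i" unfolding pairing_def by (simp add: sum_distrib_left mult.assoc)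
  then show ?thesis unfolding simple_refl_def unit_def by (auto simp: right_diff_distrib)
qed

lemma simple_refl_simple_refl: assumes i: "i < l" shows "simple_refl i (simple_refl i k) = k"
proof -
  have "pairing (simple_refl i k) i = pairing k i - pairing (unit i (pairing k i)) i" unfolding simple_refl_def by (rule pairing_diff)
  then have "pairing (simple_refl i k) i = - pairing k i" by (simp add: pairing_unit[OF i])
  then show ?thesis unfolding simple_refl_def[of i "simple_refl i k"] by (auto simp: simple_refl_def unit_def)
qed

lemma K_unit_minus: assumes i: "i < l" shows "unit i (-1) \<in> K"
proof -
  have "simple_refl i (unit i 1) = unit i (-1)" unfolding simple_refl_def pairing_unit[OF i] by (auto simp: unit_def)
  then show ?thesis using K_simple_refl[OF K_unit[OF i] i] by simp
qed

text \<open>For a root congruent to c times \<open>a i\<close> modulo the radical, the Cartan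
  integer z of \<open>a i\<close> with respect to that root is 2/c.\<close>

lemma K_unit_multiple:
  assumes c: "unit i c \<in> K" and i: "i < l"
  shows "c dvd 2"
proof -
  obtain \<alpha> where \<alpha>: "\<alpha> \<in> Rx" "rad (\<lambda>v. \<alpha> v - wt (unit i c) v)" using c unfolding K_def by blast
  have D: "\<alpha> \<in> D" by (rule Rx_D[OF \<alpha>(1)])
  define n where "n = ip (a i) (a i)"
  have n: "n \<noteq> 0" using Rx_ip[OF a_Rx[OF i]] by (simp add: n_def)
  have w: "ip (wt (unit i c)) \<beta> = of_int c * ip (a i) \<beta>" if "\<beta> \<in> D" for \<beta>
    unfolding wt_unit[OF i] using ip_lin_left[OF D_zero a_D[OF i] that, of "of_int c"]
    by (simp add: ip_eval[OF D_zero that])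
  have 1: "ip \<alpha> (a i) = of_int c * n" using rep_ip[OF D \<alpha>(2) a_R[OF i]] w[OF a_D[OF i]] by (simp add: n_def)
  have 2: "ip \<alpha> \<alpha> = of_int c * (of_int c * n)"
    using rep_ip[OF D \<alpha>(2) Rx_R[OF \<alpha>(1)]] w[OF D] 1 ip_sym[of "a i" \<alpha>] by simp
  have c0: "c \<noteq> 0" using 2 Rx_ip[OF \<alpha>(1)] by auto
  obtain z where z: "a i (hv \<alpha>) = of_int z" using cartan_integer[OF \<alpha>(1) a_R[OF i]] .
  have "2 * ip (a i) \<alpha> = of_int z * ip \<alpha> \<alpha>" by (rule hv_int[OF \<alpha>(1) a_D[OF i] z])
  then have "(of_int c * n) * of_int 2 = (of_int c * n) * of_int (c * z)"
    unfolding 2 ip_sym[of "a i"] 1 by (simp add: mult.commute mult.left_commute)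
  then have "(of_int 2 :: 'k) = of_int (c * z)" using c0 n by (simp only: mult_cancel_left mult_eq_0_iff of_int_eq_0_iff) simp
  then have "2 = c * z" by (simp only: of_int_eq_iff)
  then show ?thesis by (rule dvdI)
qed

text \<open>Both alternatives survive simple reflections, which are linear involutions, so multiples
  c of unit vectors decide: c = 1, -1 come from generators, and c = 2, -2 are doubles.\<close>

lemma reduced_root:
  assumes "k \<in> K"
  shows "(\<exists>j\<in>K. k = (\<lambda>i. 2 * j i)) \<or> k \<in> \<Phi> g"
  using assms
proof (induction rule: K_induct)
  case (unit i c)
  have "c dvd 2" by (rule K_unit_multiple[OF unit(3,1)])
  then have "\<bar>c\<bar> \<le> 2" using dvd_imp_le_int[of 2 c] by simp
  then have "c = 1 \<or> c = -1 \<or> c = 2 \<or> c = -2" using unit(2) by linarith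
  then show ?case
  proof (elim disjE)
    assume "c = 1"
    then show ?thesis using X_\<Phi>[OF unit(1), of True] by (simp add: sgn_of_def)
  next
    assume "c = -1"
    then show ?thesis using X_\<Phi>[OF unit(1), of False] by (simp add: sgn_of_def)
  next
    assume "c = 2"
    then have "unit i c = (\<lambda>m. 2 * unit i 1 m)" by (auto simp: unit_def)
    then show ?thesis using K_unit[OF unit(1)] by blast
  next
    assume "c = -2"
    then have "unit i c = (\<lambda>m. 2 * unit i (-1) m)" by (auto simp: unit_def)
    then show ?thesis using K_unit_minus[OF unit(1)] by blast
  qed
next
  case (reflect k i)
  show ?case using reflect(3)
  proof
    assume "\<exists>j\<in>K. simple_refl i k = (\<lambda>i. 2 * j i)"
    then obtain j where j: "j \<in> K" "simple_refl i k = (\<lambda>i. 2 * j i)" by blast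
    have "k = simple_refl i (\<lambda>i. 2 * j i)" using simple_refl_simple_refl[OF reflect(2), of k] j(2) by simp
    then have "k = (\<lambda>m. 2 * simple_refl i j m)" using simple_refl_scale[of i 2 j] by simp
    then show ?thesis using K_simple_refl[OF j(1) reflect(2)] by blast
  next
    assume "simple_refl i k \<in> \<Phi> g"
    then show ?thesis using \<Phi>_g_simple_refl[OF _ reflect(2), of "simple_refl i k"] simple_refl_simple_refl[OF reflect(2), of k] by simp
  qed
qed

text \<open>Reflection reduces this to a multiple 2c of a simple root, where a weight of
  \<open>g\<close> would require 2c = 1 or 2c = -1.\<close>

lemma doubled_root:
  assumes "k \<in> K"
  shows "(\<lambda>i. 2 * k i) \<notin> \<Phi> g"
  using assms
proof (induction rule: K_induct)
  case (unit i c)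
  show ?case
  proof
    assume u: "(\<lambda>m. 2 * unit i c m) \<in> \<Phi> g"
    have "(\<lambda>m. 2 * unit i c m) = unit i (2 * c)" by (auto simp: unit_def)
    then have "unit i (2 * c) \<in> \<Phi> g" using u by simp
    then obtain b where "2 * c = sgn_of b" using \<Phi>_unit[of i "2 * c" g] unit(1,2) by auto
    then show False using sgn_of_cases[of b] by presburger
  qed
next
  case (reflect k i)
  show ?case
  proof
    assume "(\<lambda>m. 2 * k m) \<in> \<Phi> g"
    then have "simple_refl i (\<lambda>m. 2 * k m) \<in> \<Phi> g" by (rule \<Phi>_g_simple_refl[OF _ reflect(2)])
    then show False using reflect(3) by (simp add: simple_refl_scale)
  qed
qed

text \<open>Reflections carry the weight to a multiple of a simple root without leaving
  \<open>\<Phi> M\<close>; there a nonzero vector of \<open>g\<close> is a nonzero multiple of a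
  generator.\<close>

lemma \<Phi>_generator:
  assumes M: "subspace M" "M \<subseteq> g" "\<And>b i x. i < l \<Longrightarrow> x \<in> M \<Longrightarrow> br (X b i) x \<in> M"
    and "k \<in> K"
  shows "k \<in> \<Phi> M \<Longrightarrow> \<exists>i<l. \<exists>b. X b i \<in> M"
  using assms(4)
proof (induction rule: K_induct)
  case (unit i c)
  obtain b x s where x: "x \<in> M" "x \<noteq> 0" "x = s *s X b i"
    using \<Phi>_unit[OF unit(4) M(2) unit(2,1)] by metis
  then have "inverse s *s x = X b i" by (cases "s = 0") simp_all
  then have "X b i \<in> M" using subspace_scale[OF M(1) x(1), of "inverse s"] by simp
  then show ?case using unit(1) by blast
next
  case (reflect k i)
  then show ?case using \<Phi>_simple_refl[OF subspace_0[OF M(1)] M(3) _ reflect(2)] by blast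
qed

section \<open>Structure of the generated subalgebra\<close>

lemma hs_coordinates:
  assumes "x \<in> hs" shows "\<exists>c. x = (\<Sum>i<l. c i *s ha i)"
  using assms
proof (induction rule: span_induct_alt)
  case base
  show ?case by (rule exI[of _ "\<lambda>_. 0"]) simp
next
  case (step c x y)
  obtain j where j: "j < l" "x = ha j" using step(1) by auto
  obtain d where d: "y = (\<Sum>i<l. d i *s ha i)" using step(2) by (rule exE)
  have "c *s x = (\<Sum>i<l. (if i = j then c else 0) *s ha i)"
  proof -
    have "(if i = j then c else 0) *s ha i = (if i = j then c *s ha j else 0)" for i by simp
    then show ?thesis using j by simp
  qed
  then have "c *s x + y = (\<Sum>i<l. ((if i = j then c else 0) + d i) *s ha i)"
    by (simp only: d scale_left_distrib sum.distrib)
  then show ?case by (rule exI[of _ "\<lambda>i. (if i = j then c else 0) + d i"])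
qed

lemma dual_coordinates: "\<alpha> \<in> D \<Longrightarrow> \<alpha> (\<Sum>i<l. c i *s ha i) = (\<Sum>i<l. c i * \<alpha> (ha i))"
proof -
  assume \<alpha>: "\<alpha> \<in> D"
  have "(\<Sum>i\<in>S. c i *s ha i) \<in> H \<and> \<alpha> (\<Sum>i\<in>S. c i *s ha i) = (\<Sum>i\<in>S. c i * \<alpha> (ha i))"
    if "finite S" "S \<subseteq> {..<l}" for S
    using that
  proof (induction S rule: finite_induct)
    case empty
    then show ?case using subspace_0[OF subspace_H] dual_zero[OF \<alpha>] by simp
  next
    case (insert s S)
    then have s: "ha s \<in> H" and S: "(\<Sum>i\<in>S. c i *s ha i) \<in> H" using ha_H by auto
    have cs: "c s *s ha s \<in> H" by (rule subspace_scale[OF subspace_H s])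
    show ?case using insert dual_add[OF \<alpha> cs S] dual_scale[OF \<alpha> s] subspace_add[OF subspace_H cs S] by simp
  qed
  from this[of "{..<l}"] show ?thesis by simp
qed

lemma coroots_coefficients_zero:
  assumes "(\<Sum>i<l. c i *s ha i) = 0" "i < l" shows "c i = 0"
proof (rule coroot_coefficients[OF _ assms(2)])
  fix j assume "j < l"
  then show "(\<Sum>i<l. c i * a j (ha i)) = 0"
    using dual_coordinates[OF a_D, of j c] dual_zero[OF a_D, of j] by (simp add: assms(1))
qed

text \<open>The same nondegeneracy as in \<open>coroot_coefficients\<close>; it will turn an ideal
  element of weight zero into a root vector.\<close>

lemma hs_detect:
  assumes x: "x \<in> hs" "x \<noteq> 0" shows "\<exists>j<l. a j x \<noteq> 0"
proof (rule ccontr)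
  assume n: "\<not> ?thesis"
  obtain c where c: "x = (\<Sum>i<l. c i *s ha i)" using hs_coordinates[OF x(1)] by (rule exE)
  have "c i = 0" if i: "i < l" for i
  proof (rule coroot_coefficients[OF _ i])
    fix j assume "j < l"
    then show "(\<Sum>i<l. c i * a j (ha i)) = 0" using dual_coordinates[OF a_D, of j c] n c by simp
  qed
  then show False using x(2) c by simp
qed

lemma inj_coroots: "inj_on (\<lambda>i. ha i) {..<l}"
proof (rule inj_onI)
  fix i j assume ij: "i \<in> {..<l}" "j \<in> {..<l}" "ha i = ha j"
  show "i = j"
  proof (rule ccontr)
    assume ne: "i \<noteq> j"
    define c :: "nat \<Rightarrow> 'k" where "c m = (if m = i then 1 else 0) + (if m = j then -1 else 0)" for m
    have "c m *s ha m = (if m = i then ha i else 0) + (if m = j then - ha j else 0)" for m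
      using ne by (simp add: c_def)
    then have "(\<Sum>m<l. c m *s ha m) = (\<Sum>m<l. if m = i then ha i else 0) + (\<Sum>m<l. if m = j then - ha j else 0)"
      by (simp only: sum.distrib)
    also have "\<dots> = 0" using ij by simp
    finally have "c i = 0" using coroots_coefficients_zero ij(1) by simp
    then show False using ne by (simp add: c_def)
  qed
qed

lemma independent_coroots: "independent (hvec sc B H ` a ` {..<l})"
proof (rule independent_if_scalars_zero)
  show "finite (hvec sc B H ` a ` {..<l})" by simp
  fix f x assume s: "(\<Sum>x\<in>hvec sc B H ` a ` {..<l}. f x *s x) = 0" and "x \<in> hvec sc B H ` a ` {..<l}"
  then obtain i where i: "i < l" "x = ha i" by auto
  have "(\<Sum>x\<in>hvec sc B H ` a ` {..<l}. f x *s x) = (\<Sum>i<l. f (ha i) *s ha i)"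
    unfolding image_image by (subst sum.reindex[OF inj_coroots]) simp
  then show "f x = 0" using coroots_coefficients_zero[of "\<lambda>i. f (ha i)" i] s i by simp
qed

text \<open>The degree of a nonzero word lies in the finite set \<open>K\<close>, and the length of
  the word is the sum of the absolute values of its degree. So only finitely many words can be
  nonzero.\<close>

lemma finite_dim_g: "finite_dim sc g"
proof -
  define Ws where "Ws = {bracket_word br (X b) is | b is. is \<noteq> [] \<and> set is \<subseteq> {..<l} \<and> bracket_word br (X b) is \<noteq> 0}"
  define N where "N k = nat (\<Sum>j<l. \<bar>k j\<bar>)" for k :: "nat \<Rightarrow> int"
  have "Ws \<subseteq> (\<Union>b. \<Union>k\<in>K. bracket_word br (X b) ` {is. set is \<subseteq> {..<l} \<and> length is = N k})"
  proof
    fix t assume "t \<in> Ws"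
    then obtain b "is" where is': "is \<noteq> []" "set is \<subseteq> {..<l}" "bracket_word br (X b) is \<noteq> 0" "t = bracket_word br (X b) is"
      unfolding Ws_def by blast
    define k where "k = (\<lambda>j. sgn_of b * content is j)"
    have "(k, t) \<in> graded_words" unfolding graded_words_def k_def using is' by blast
    then have "supported k" "t \<in> W H (wt k)" using graded_words_supported graded_words_W by auto
    moreover have "k \<noteq> (\<lambda>_. 0)" unfolding k_def by (rule content_nonzero[OF is'(1)])
    ultimately have "k \<in> K" using R_wt[OF R_I[OF wt_D]] is'(3,4) by blast
    moreover have "\<bar>k j\<bar> = int (count_list is j)" for j
      using sgn_of_cases[of b] by (auto simp: k_def content_def)
    then have "N k = sum (count_list is) {..<l}" unfolding N_def by (simp flip: of_nat_sum)
    then have "length is = N k" using sum_count_set[OF is'(2)] by simp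
    ultimately show "t \<in> (\<Union>b. \<Union>k\<in>K. bracket_word br (X b) ` {is. set is \<subseteq> {..<l} \<and> length is = N k})"
      using is'(2,4) by blast
  qed
  moreover have "finite (\<Union>b. \<Union>k\<in>K. bracket_word br (X b) ` {is. set is \<subseteq> {..<l} \<and> length is = N k})"
    by (intro finite_UN_I finite_K finite_imageI finite_lists_length_eq) auto
  ultimately have fin: "finite Ws" by (rule finite_subset)
  let ?F = "hvec sc B H ` a ` {..<l} \<union> Ws"
  have "snd ` graded_words \<subseteq> span ?F"
  proof
    fix t assume "t \<in> snd ` graded_words"
    then obtain k where "(k, t) \<in> graded_words" by auto
    then consider j where "j < l" "t = ha j" | b "is" where "is \<noteq> []" "set is \<subseteq> {..<l}" "t = bracket_word br (X b) is"
      unfolding graded_words_def by blast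
    then show "t \<in> span ?F"
    proof cases
      case 1
      then show ?thesis by (intro span_base) simp
    next
      case 2
      then show ?thesis
      proof (cases "t = 0")
        case True
        then show ?thesis using span_zero by simp
      next
        case False
        then have "t \<in> Ws" unfolding Ws_def using 2 by blast
        then show ?thesis by (intro span_base) simp
      qed
    qed
  qed
  then have "g \<subseteq> span ?F" unfolding g_eq_span by (rule span_minimal[OF _ subspace_span])
  moreover have "?F \<subseteq> g" using ha_g bracket_word_g unfolding Ws_def by auto
  moreover have "finite ?F" using fin by simp
  ultimately show ?thesis unfolding finite_dim_def by blast
qed

section \<open>Inclusion in the core, and simplicity\<close>

lemma g_core: "g \<subseteq> core sc br B H"
proof (rule gen_subalgebra_least)
  show "lie_subalgebra sc br (core sc br B H)" unfolding core_def by (rule gen_subalgebra_subalgebra)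
  have "ep i \<in> core sc br B H" "em i \<in> core sc br B H" if i: "i < l" for i
  proof -
    have "ep i \<in> (\<Union>\<alpha>\<in>Rx. W H \<alpha>)" using ep[OF i] a_Rx[OF i] by (rule UN_I[rotated])
    moreover have "em i \<in> (\<Union>\<alpha>\<in>Rx. W H \<alpha>)" using em[OF i] minus_Rx[OF a_Rx[OF i]] by (rule UN_I[rotated])
    ultimately show "ep i \<in> core sc br B H" "em i \<in> core sc br B H"
      unfolding core_def using gen_subalgebra_superset by (meson subsetD)+
  qed
  then show "ep ` {..<l} \<union> em ` {..<l} \<subseteq> core sc br B H" by (simp add: image_subset_iff)
qed

lemma g_subalgebra: "lie_subalgebra sc br g"
  by (rule gen_subalgebra_subalgebra)

text \<open>An ideal contains the graded components of its elements. A component of nonzero degree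
  is reflected to a simple root; one of degree zero lies in \<open>hs\<close>, and its bracket with
  a suitable \<open>ep j\<close> is a nonzero multiple of \<open>ep j\<close>.\<close>

lemma ideal_generator:
  assumes I: "lie_ideal sc br g I" and ne: "I \<noteq> {0}"
  shows "\<exists>i<l. \<exists>b. X b i \<in> I"
proof -
  have Is: "subspace I" and Ig: "I \<subseteq> g" and Ib: "\<And>x y. x \<in> g \<Longrightarrow> y \<in> I \<Longrightarrow> br x y \<in> I"
    using I unfolding lie_ideal_def by simp_all
  obtain x where x: "x \<in> I" "x \<noteq> 0" using ne subspace_0[OF Is] by blast
  have "x \<in> g" using Ig x(1) by (rule subsetD)
  then obtain S f where S: "finite S" "\<And>k. k \<in> S \<Longrightarrow> supported k" "\<And>k. k \<in> S \<Longrightarrow> f k \<in> span {t. (k, t) \<in> graded_words}"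
    "x = sum f S" using g_decomp by blast
  have fI: "f k \<in> I" if "k \<in> S" for k
  proof (rule components_stable[OF S(1,2) _ Is])
    show "f k \<in> W hs (wt k)" if "k \<in> S" for k using W_hs[OF span_graded_words_W[OF S(3)[OF that]]] .
    show "br h y \<in> I" if "h \<in> hs" "y \<in> I" for h y using Ib[OF subsetD[OF hs_g that(1)] that(2)] .
    show "sum f S \<in> I" using x(1) S(4) by simp
  qed (use that in simp_all)
  obtain k where k: "k \<in> S" "f k \<noteq> 0" using x(2) S(4) sum.neutral by metis
  show ?thesis
  proof (cases "k = (\<lambda>_. 0)")
    case True
    have "f k \<in> span {t. ((\<lambda>_. 0), t) \<in> graded_words}" using S(3)[OF k(1)] unfolding True .
    then have "f k \<in> hs" by (rule g_zero_weight)
    then obtain j where j: "j < l" "a j (f k) \<noteq> 0" using hs_detect k(2) by blast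
    have "br (f k) (ep j) = a j (f k) *s ep j" by (rule W_D[OF ep[OF j(1)] subsetD[OF hs_H \<open>f k \<in> hs\<close>]])
    moreover have "br (f k) (ep j) \<in> I"
      using Ib[OF X_g[OF j(1), of True] fI[OF k(1)]] subspace_neg[OF Is] br_anti[of "f k" "ep j"] by (simp add: X_def)
    ultimately have "a j (f k) *s ep j \<in> I" by simp
    then have "inverse (a j (f k)) *s a j (f k) *s ep j \<in> I" by (rule subspace_scale[OF Is])
    then have "X True j \<in> I" using j(2) by (simp add: X_def)
    then show ?thesis using j(1) by blast
  next
    case False
    have "k \<in> \<Phi> I" unfolding \<Phi>_def using S(2)[OF k(1)] fI[OF k(1)] k(2) span_graded_words_W[OF S(3)[OF k(1)]] by blast
    moreover have "k \<in> K" by (rule \<Phi>_K[OF \<open>k \<in> \<Phi> I\<close> False])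
    ultimately show ?thesis using \<Phi>_generator[OF Is Ig Ib[OF X_g]] by blast
  qed
qed

lemma g_simple: "simple_lie sc br g"
  unfolding simple_lie_def
proof (intro conjI allI impI)
  show "lie_subalgebra sc br g" by (rule g_subalgebra)
  have "br (ha 0) (ep 0) = a 0 (ha 0) *s ep 0" by (rule W_D[OF ep[OF l_pos] ha_H[OF l_pos]])
  then have "br (ha 0) (ep 0) \<noteq> 0" using hv_self[OF a_Rx[OF l_pos]] X_nonzero[OF l_pos, of True] by (simp add: X_def)
  moreover have "ep 0 \<in> g" using X_g[OF l_pos, of True] by (simp add: X_def)
  ultimately show "\<exists>x\<in>g. \<exists>y\<in>g. br x y \<noteq> 0" using ha_g[OF l_pos] by blast
next
  fix I assume I: "lie_ideal sc br g I"
  have Is: "subspace I" and Ig: "I \<subseteq> g" and Ib: "\<And>x y. x \<in> g \<Longrightarrow> y \<in> I \<Longrightarrow> br x y \<in> I"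
    using I unfolding lie_ideal_def by simp_all
  have Ib': "br y x \<in> I" if "x \<in> g" "y \<in> I" for x y
    using subspace_neg[OF Is Ib[OF that]] br_anti[of y x] by simp
  have cancel: "x \<in> I" if "c *s x \<in> I" "c \<noteq> 0" for c x
    using subspace_scale[OF Is that(1), of "inverse c"] that(2) by simp
  have ha_I: "ha i \<in> I" if i: "i < l" and x: "X b i \<in> I" for b i
  proof -
    have "(- of_int (sgn_of b)) *s ha i \<in> I" using Ib[OF X_g[OF i] x, of "\<not> b"] X_X_same[OF i, of b] by simp
    then show ?thesis by (rule cancel) (simp add: sgn_of_def)
  qed
  have X_I: "X b i \<in> I" if i: "i < l" and h: "ha i \<in> I" for b i
  proof -
    have "wt (unit i (sgn_of b)) (ha i) *s X b i \<in> I"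
      using Ib'[OF X_g[OF i] h, of b] W_D[OF X_W[OF i] ha_H[OF i], of b] by simp
    then show ?thesis by (rule cancel) (simp add: wt_unit[OF i] hv_self[OF a_Rx[OF i]] sgn_of_def)
  qed
  show "I = {0} \<or> I = g"
  proof (rule disjCI)
    assume "I \<noteq> g"
    show "I = {0}"
    proof (rule ccontr)
      assume "I \<noteq> {0}"
      then obtain i0 b0 where i0: "i0 < l" "X b0 i0 \<in> I" using ideal_generator[OF I] by blast
      \<comment> \<open>If i is in \<open>?J\<close> and j is not, then
        [\<open>ha i\<close>, \<open>ep j\<close>] = \<open>C j i\<close> \<open>ep j\<close> lies
        in \<open>I\<close>; a nonzero \<open>C j i\<close> would bring \<open>ep j\<close> and then
        \<open>ha j\<close> into \<open>I\<close>. So \<open>?J\<close> is closed in the Dynkin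
        diagram.\<close>
      let ?J = "{i. i < l \<and> ha i \<in> I}"
      have "?J = {..<l}"
      proof (rule dynkin_connected)
        show "?J \<subseteq> {..<l}" by auto
        show "?J \<noteq> {}" using i0(1) ha_I[OF i0] by blast
        fix i j assume i: "i \<in> ?J" and j: "j < l" "j \<notin> ?J"
        have il: "i < l" and hi: "ha i \<in> I" using i by auto
        have "of_int (C j i) *s ep j \<in> I"
          using Ib'[OF X_g[OF j(1), of True] hi] W_D[OF ep[OF j(1)] ha_H[OF il]] C[OF il j(1)] by (simp add: X_def)
        moreover have "ep j \<notin> I" using ha_I[OF j(1), of True] j by (auto simp: X_def)
        ultimately show "C j i = 0" using cancel by (metis of_int_eq_0_iff)
      qed
      then have hI: "ha i \<in> I" if "i < l" for i using that by auto
      have "ep i \<in> I" "em i \<in> I" if "i < l" for i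
        using X_I[OF that hI[OF that], of True] X_I[OF that hI[OF that], of False] by (simp_all add: X_def)
      then have "ep ` {..<l} \<union> em ` {..<l} \<subseteq> I" by (simp add: image_subset_iff)
      moreover have "br x y \<in> I" if "x \<in> I" "y \<in> I" for x y using Ib[OF subsetD[OF Ig that(1)] that(2)] .
      then have "lie_subalgebra sc br I" unfolding lie_subalgebra_def using Is by simp
      ultimately have "g \<subseteq> I" using gen_subalgebra_least by metis
      then show False using Ig \<open>I \<noteq> g\<close> by simp
    qed
  qed
qed

lemma g_cartan: "cartan_subalgebra sc br g hs"
  unfolding cartan_subalgebra_def
proof (intro conjI)
  show "lie_subalgebra sc br hs" unfolding lie_subalgebra_def
    using subspace_span span_zero by (simp add: hs_commute)
  show "hs \<subseteq> g" by (rule hs_g)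
  show "nilpotent_lie br hs" unfolding nilpotent_lie_def
  proof (intro exI[of _ 1] allI impI)
    fix xs assume xs: "length xs = Suc 1 \<and> set xs \<subseteq> hs"
    then obtain x y where xy: "xs = [x, y]" by (auto simp: length_Suc_conv)
    then show "foldr br (butlast xs) (last xs) = 0" using xs hs_commute[of x y] by simp
  qed
  show "{x \<in> g. \<forall>y\<in>hs. br x y \<in> hs} = hs"
  proof
    show "hs \<subseteq> {x \<in> g. \<forall>y\<in>hs. br x y \<in> hs}"
      using hs_g hs_commute span_zero by auto
    show "{x \<in> g. \<forall>y\<in>hs. br x y \<in> hs} \<subseteq> hs"
    proof
      fix x assume "x \<in> {x \<in> g. \<forall>y\<in>hs. br x y \<in> hs}"
      then have x: "x \<in> g" "\<And>y. y \<in> hs \<Longrightarrow> br x y \<in> hs" by auto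
      obtain S f where S: "finite S" "\<And>k. k \<in> S \<Longrightarrow> supported k" "\<And>k. k \<in> S \<Longrightarrow> f k \<in> span {t. (k, t) \<in> graded_words}"
        "x = sum f S" using g_decomp[OF x(1)] by blast
      have fW: "f k \<in> W hs (wt k)" if "k \<in> S" for k using W_hs[OF span_graded_words_W[OF S(3)[OF that]]] .
      have "f k \<in> hs" if k: "k \<in> S" for k
      proof (cases "k = (\<lambda>_. 0)")
        case True
        have "f k \<in> span {t. ((\<lambda>_. 0), t) \<in> graded_words}" using S(3)[OF k] unfolding True .
        then show ?thesis by (rule g_zero_weight)
      next
        case False
        \<comment> \<open>Since x normalizes \<open>hs\<close>, the element [h, x] lies in
          \<open>hs\<close>, and so do its components \<open>wt k h *s f k\<close>; this h makes the
          k-th scalar nonzero.\<close>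
        then obtain h where h: "h \<in> hs" "wt k h \<noteq> wt (\<lambda>_. 0) h"
          using separation[OF S(2)[OF k], of "\<lambda>_. 0"] by (auto simp: supported_def)
        let ?f = "\<lambda>k. wt k h *s f k"
        have "br h x = sum ?f S"
          unfolding S(4) br_sum_right by (rule sum.cong[OF refl]) (rule W_D[OF fW h(1)])
        moreover have "br h x \<in> hs" using span_neg[OF x(2)[OF h(1)]] br_anti[of h x] by simp
        ultimately have sm: "sum ?f S \<in> hs" by simp
        have "?f k \<in> hs"
        proof (rule components_stable[OF S(1,2) _ subspace_span _ sm k])
          show "?f k \<in> W hs (wt k)" if "k \<in> S" for k by (rule subspace_scale[OF subspace_W fW[OF that]])
          show "br h y \<in> hs" if "h \<in> hs" "y \<in> hs" for h y using hs_commute[OF that] span_zero by simp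
        qed
        then have "inverse (wt k h) *s ?f k \<in> hs" by (rule span_scale)
        then show ?thesis using h(2) by (simp add: wt_zero)
      qed
      then show "x \<in> hs" unfolding S(4) by (rule span_sum)
    qed
  qed
qed

section \<open>Weight decomposition and comparison with the reduced root system\<close>

lemma restrict_D:
  assumes \<alpha>: "\<alpha> \<in> D" shows "restrict_fun hs \<alpha> \<in> dual sc hs"
proof -
  have "x \<in> H" if "x \<in> hs" for x using hs_H that by (rule subsetD)
  then show ?thesis unfolding dual_def restrict_fun_def
    by (simp add: span_add span_scale dual_add[OF \<alpha>] dual_scale[OF \<alpha>])
qed

lemma W_restrict: "W hs (restrict_fun hs \<alpha>) = W hs \<alpha>"
  by (rule W_cong) (simp add: restrict_fun_def)

lemma g_weight_decomposition: "weight_decomposition sc br g hs"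
  unfolding weight_decomposition_def
proof (intro conjI ballI allI impI)
  fix x assume "x \<in> g"
  then obtain S f where S: "finite S" "\<And>k. k \<in> S \<Longrightarrow> supported k" "\<And>k. k \<in> S \<Longrightarrow> f k \<in> span {t. (k, t) \<in> graded_words}"
    "x = sum f S" using g_decomp by blast
  \<comment> \<open>Functionals on \<open>hs\<close> must vanish outside \<open>hs\<close>, so the
    weights are restricted; \<open>separation\<close> keeps distinct degrees distinct after
    restriction.\<close>
  define \<rho> where "\<rho> k = restrict_fun hs (wt k)" for k
  have inj: "inj_on \<rho> S"
  proof (rule inj_onI)
    fix k k' assume k: "k \<in> S" "k' \<in> S" "\<rho> k = \<rho> k'"
    have "wt k h = wt k' h" if "h \<in> hs" for h
      using fun_cong[OF k(3), of h] that by (simp add: \<rho>_def restrict_fun_def)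
    then show "k = k'" using separation[OF S(2)[OF k(1)] S(2)[OF k(2)]] by blast
  qed
  define F where "F \<alpha> = f (inv_into S \<rho> \<alpha>)" for \<alpha>
  have F: "F (\<rho> k) = f k" if "k \<in> S" for k using inv_into_f_f[OF inj that] by (simp add: F_def)
  have "sum F (\<rho> ` S) = sum f S" unfolding sum.reindex[OF inj] by (rule sum.cong) (simp_all add: F)
  then have "x = sum F (\<rho> ` S)" using S(4) by simp
  moreover have "\<forall>\<alpha>\<in>\<rho> ` S. F \<alpha> \<in> g \<inter> W hs \<alpha>"
  proof
    fix \<alpha> assume "\<alpha> \<in> \<rho> ` S"
    then obtain k where k: "k \<in> S" "\<alpha> = \<rho> k" by blast
    have "f k \<in> g" "f k \<in> W hs (\<rho> k)"
      using span_graded_words_g[OF S(3)[OF k(1)]] W_hs[OF span_graded_words_W[OF S(3)[OF k(1)]]]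
      unfolding \<rho>_def W_restrict by simp_all
    then show "F \<alpha> \<in> g \<inter> W hs \<alpha>" using F[OF k(1)] k(2) by simp
  qed
  moreover have "\<rho> ` S \<subseteq> dual sc hs" unfolding \<rho>_def using restrict_D[OF wt_D] by blast
  ultimately show "\<exists>S f. finite S \<and> S \<subseteq> dual sc hs \<and> (\<forall>\<alpha>\<in>S. f \<alpha> \<in> g \<inter> W hs \<alpha>) \<and> x = sum f S"
    using finite_imageI[OF S(1)] by (intro exI[of _ "\<rho> ` S"] exI[of _ F] conjI)
next
  fix S f \<alpha>
  assume "finite S \<and> S \<subseteq> dual sc hs \<and> (\<forall>\<alpha>\<in>S. f \<alpha> \<in> g \<inter> W hs \<alpha>) \<and> sum f S = 0" and \<alpha>: "\<alpha> \<in> S"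
  then have S: "finite S" "S \<subseteq> dual sc hs" "\<And>\<alpha>. \<alpha> \<in> S \<Longrightarrow> f \<alpha> \<in> W hs \<alpha>" "sum f S = 0" by auto
  have "f \<alpha> \<in> {0}"
  proof (rule weight_components[where \<omega> = "\<lambda>\<alpha>. \<alpha>", OF S(1,3) _ subspace_single_0 _ _ \<alpha>])
    fix \<beta> \<gamma> assume b: "\<beta> \<in> S" "\<gamma> \<in> S" "\<beta> \<noteq> \<gamma>"
    have "\<beta> x = 0" "\<gamma> x = 0" if "x \<notin> hs" for x
      using subsetD[OF S(2) b(1)] subsetD[OF S(2) b(2)] that unfolding dual_def by simp_all
    then show "\<exists>h\<in>hs. \<beta> h \<noteq> \<gamma> h" using b(3) by (metis ext)
  qed (simp_all add: S(4))
  then show "f \<alpha> = 0" by simp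
qed

text \<open>\<open>Rdot\<close> also admits isotropic roots as witnesses, but such a witness would
  put \<open>wt k\<close> into the radical.\<close>

lemma Rdot_K: 
  assumes "wt k \<in> Rdot sc br B H l a" "supported k" "k \<noteq> (\<lambda>_. 0)"
  shows "k \<in> K"
proof -
  obtain k' \<alpha> where k': "wt k = wt k'" "\<alpha> \<in> R" "rad (\<lambda>v. \<alpha> v - wt k' v)"
    using assms(1) unfolding Rdot_def by blast
  have r: "rad (\<lambda>v. \<alpha> v - wt k v)" using k' by simp
  have D: "(\<lambda>v. \<alpha> v - wt k v) \<in> D" using D_diff[OF R_D[OF k'(2)] wt_D, of 1 k] by simp
  have "\<alpha> \<notin> R0"
  proof
    assume "\<alpha> \<in> R0"
    then have "rad (\<lambda>v. \<alpha> v - (\<alpha> v - wt k v))"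
      by (intro rad_diff[OF R0_rad r R_D[OF k'(2)] D])
    then have "rad (wt k)" by simp
    then show False using rad_wt_0 assms(2,3) by blast
  qed
  then have "\<alpha> \<in> Rx" using R_cases[OF k'(2)] by blast
  then show ?thesis using assms(2) r by (rule K_I)
qed

lemma K_Rdot: "k \<in> K \<Longrightarrow> wt k \<in> Rdot sc br B H l a"
  unfolding K_def Rdot_def using Rx_R by blast

lemma Rdot_supported:
  assumes "\<alpha> \<in> Rdot sc br B H l a"
  obtains k where "supported k" "\<alpha> = wt k"
proof -
  obtain k where k: "\<alpha> = wt k" using assms unfolding Rdot_def by blast
  have "wt (\<lambda>i. if i < l then k i else 0) = wt k" by (rule wt_cong) simp
  moreover have "supported (\<lambda>i. if i < l then k i else 0)" by (simp add: supported_def)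
  ultimately show ?thesis using that k by metis
qed

lemma wt_double: "wt (\<lambda>i. 2 * k i) = (\<lambda>v. 2 * wt k v)"
  using wt_scale[of 2 k] by simp

text \<open>Nonzero weights of \<open>g\<close> are indivisible in \<open>Rdot\<close> by
  \<open>doubled_root\<close>, and indivisible elements of \<open>Rdot\<close> are weights by
  \<open>reduced_root\<close>. The zero weight comes from a coroot, which exists because l >
  0.\<close>

lemma g_root_system: "root_system_of sc br g hs = restrict_fun hs ` reduced_part (Rdot sc br B H l a)"
proof
  show "root_system_of sc br g hs \<subseteq> restrict_fun hs ` reduced_part (Rdot sc br B H l a)"
  proof
    fix \<alpha> assume "\<alpha> \<in> root_system_of sc br g hs"
    then have \<alpha>: "\<alpha> \<in> dual sc hs" "g \<inter> W hs \<alpha> \<noteq> {0}" unfolding root_system_of_def by auto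
    have "0 \<in> g \<inter> W hs \<alpha>" using subspace_0[OF subspace_g] subspace_0[OF subspace_W] by simp
    then obtain x where x: "x \<in> g" "x \<in> W hs \<alpha>" "x \<noteq> 0" using \<alpha>(2) by blast
    obtain k where k: "supported k" "\<And>h. h \<in> hs \<Longrightarrow> \<alpha> h = wt k h" "x \<in> span {t. (k, t) \<in> graded_words}"
      using g_weight[OF x] by blast
    have "\<alpha> h = restrict_fun hs (wt k) h" for h
      using k(2) \<alpha>(1) unfolding dual_def restrict_fun_def by simp
    then have eq: "\<alpha> = restrict_fun hs (wt k)" by (rule ext)
    have "wt k \<in> reduced_part (Rdot sc br B H l a)"
    proof (cases "k = (\<lambda>_. 0)")
      case True
      then show ?thesis unfolding reduced_part_def by (simp add: wt_zero)
    next
      case False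
      have k\<Phi>: "k \<in> \<Phi> g" unfolding \<Phi>_def using k(1) x(1,3) span_graded_words_W[OF k(3)] by blast
      then have kK: "k \<in> K" using False by (rule \<Phi>_K)
      have "(\<lambda>v. wt k v / 2) \<notin> Rdot sc br B H l a"
      proof
        assume h: "(\<lambda>v. wt k v / 2) \<in> Rdot sc br B H l a"
        obtain j where j: "supported j" "(\<lambda>v. wt k v / 2) = wt j" using Rdot_supported[OF h] by blast
        have "wt (\<lambda>i. 2 * j i) = wt k" unfolding wt_double using fun_cong[OF j(2)] by (intro ext) (simp add: field_simps)
        moreover have "supported (\<lambda>i. 2 * j i)" using j(1) by (simp add: supported_def)
        ultimately have kj: "(\<lambda>i. 2 * j i) = k" using wt_inj k(1) by blast
        then have "j \<noteq> (\<lambda>_. 0)" using False by auto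
        then have "j \<in> K" using Rdot_K[OF _ j(1)] h j(2) by simp
        then show False using doubled_root[of j] k\<Phi> kj by simp
      qed
      then show ?thesis unfolding reduced_part_def using K_Rdot[OF kK] by simp
    qed
    then show "\<alpha> \<in> restrict_fun hs ` reduced_part (Rdot sc br B H l a)" using eq by (intro rev_image_eqI)
  qed
next
  have root: "restrict_fun hs (wt k) \<in> root_system_of sc br g hs" if x: "x \<in> g" "x \<noteq> 0" "x \<in> W H (wt k)" for k x
    unfolding root_system_of_def using restrict_D[OF wt_D] W_hs[OF x(3)] x(1,2) W_restrict by auto
  show "restrict_fun hs ` reduced_part (Rdot sc br B H l a) \<subseteq> root_system_of sc br g hs"
  proof
    fix \<alpha> assume "\<alpha> \<in> restrict_fun hs ` reduced_part (Rdot sc br B H l a)"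
    then obtain \<beta> where \<beta>: "\<alpha> = restrict_fun hs \<beta>" "\<beta> \<in> reduced_part (Rdot sc br B H l a)" by blast
    show "\<alpha> \<in> root_system_of sc br g hs"
    proof (cases "\<beta> = (\<lambda>v. 0)")
      case True
      then show ?thesis using root[OF ha_g[OF l_pos] ha_nonzero[OF l_pos] ha_W[OF l_pos]] \<beta>(1)
        by (simp add: wt_zero)
    next
      case False
      then have b: "\<beta> \<in> Rdot sc br B H l a" "(\<lambda>v. \<beta> v / 2) \<notin> Rdot sc br B H l a"
        using \<beta>(2) unfolding reduced_part_def by auto
      obtain k where k: "supported k" "\<beta> = wt k" using Rdot_supported[OF b(1)] by blast
      have "k \<noteq> (\<lambda>_. 0)" using False k(2) wt_zero by auto
      then have kK: "k \<in> K" using Rdot_K[OF _ k(1)] b(1) k(2) by simp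
      have "\<not> (\<exists>j\<in>K. k = (\<lambda>i. 2 * j i))"
      proof
        assume "\<exists>j\<in>K. k = (\<lambda>i. 2 * j i)"
        then obtain j where j: "j \<in> K" "k = (\<lambda>i. 2 * j i)" by blast
        have "(\<lambda>v. \<beta> v / 2) = wt j" unfolding k(2) j(2) wt_double by simp
        then show False using K_Rdot[OF j(1)] b(2) by simp
      qed
      then have "k \<in> \<Phi> g" using reduced_root[OF kK] by blast
      then obtain x where "x \<in> g" "x \<noteq> 0" "x \<in> W H (wt k)" unfolding \<Phi>_def by blast
      then show ?thesis using root \<beta>(1) k(2) by simp
    qed
  qed
qed

end

theorem theorem2p4:
  fixes sc :: "'k::field_char_0 \<Rightarrow> 'v::ab_group_add \<Rightarrow> 'v"
    and br :: "'v \<Rightarrow> 'v \<Rightarrow> 'v"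
    and B :: "'v \<Rightarrow> 'v \<Rightarrow> 'k"
    and H :: "'v set"
    and l :: nat
    and a :: "nat \<Rightarrow> 'v \<Rightarrow> 'k"
    and ep em :: "nat \<Rightarrow> 'v"
  assumes T: "class_T sc br B H"
    and base: "base_preimages sc br B H l a"
    and ep_root: "\<forall>i<l. ep i \<in> weight_space sc br H (a i)"
    and em_root: "\<forall>i<l. em i \<in> weight_space sc br H (\<lambda>v. - a i v)"
    and ep_h: "\<forall>i<l. br (hvec sc B H (a i)) (ep i) = sc 2 (ep i)"
    and em_h: "\<forall>i<l. br (hvec sc B H (a i)) (em i) = sc (- 2) (em i)"
    and ep_em: "\<forall>i<l. br (ep i) (em i) = hvec sc B H (a i)"
  shows "let g = gen_subalgebra sc br (ep ` {..<l} \<union> em ` {..<l});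
             h = module.span sc (hvec sc B H ` a ` {..<l})
         in g \<subseteq> core sc br B H \<and> lie_subalgebra sc br g \<and> finite_dim sc g \<and>
            simple_lie sc br g \<and> splitting_cartan sc br g h \<and>
            module.independent sc (hvec sc B H ` a ` {..<l}) \<and>
            inj_on (\<lambda>i. hvec sc B H (a i)) {..<l} \<and>
            root_system_of sc br g h = restrict_fun h ` reduced_part (Rdot sc br B H l a)"
proof -
  have lie: "lie_algebra sc br" using T unfolding class_T_def by (elim conjE)
  then have "vector_space sc" unfolding lie_algebra_def by (elim conjE)
  then interpret vector_space sc .
  interpret generated sc br B H l a ep em
    by unfold_locales (use lie T base ep_root em_root ep_em in simp_all)
  show ?thesis unfolding Let_def splitting_cartan_def
    by (intro conjI g_core g_subalgebra finite_dim_g g_simple g_cartan g_weight_decomposition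
        independent_coroots inj_coroots g_root_system)
qed

end
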